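(* Let $K$ be a field and let $G$ be a graph with $\operatorname{odd-girth}(G)=2t-1$. If $1\leq k\leq t$, then, for every $i$, the natural map $$H_{\mathfrak{m}}^{i}(S/I(G)^{k})\rightarrow H_{\mathfrak{m}}^{i}(S/I(G)^{(k)})$$ induced from the short exact sequence $0\rightarrow I(G)^{(k)}/I(G)^{k}\rightarrow S/I(G)^{k}\rightarrow S/I(G)^{(k)}\rightarrow0$ is surjective. In particular, $$\operatorname{reg} I(G)^{(k)}\leq\operatorname{reg} I(G)^{k}\quad\text{for all }1\leq k\leq t.$$
   Context: All graphs are finite, without loops and multiple edges. For a graph $G$ on vertex set $[n]=\{1,\dots,n\}$ and the polynomial ring $S=K[x_1,\dots,x_n]$ with $\mathfrak m=(x_1,\dots,x_n)$, the edge ideal is $I(G)=(x_ix_j : \{i,j\}\in E(G))\subset S$. For a squarefree monomial ideal $I$, the $k$-th symbolic power is $I^{(k)}=\bigcap_{P\in\operatorname{Min}(I)}P^k$, where $\operatorname{Min}(I)$ is the set of minimal primes of $I$; one always has $I^k\subset I^{(k)}$. $H^i_{\mathfrak m}$ denotes local cohomology with respect to $\mathfrak m$, and $\operatorname{reg}$ denotes Castelnuovo--Mumford regularity. $\operatorname{odd-girth}(G)$ is the length of a shortest induced odd cycle of $G$ (set to $\infty$ if $G$ is bipartite). *)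

theory Defs
  imports
    "HOL-Algebra.QuotRing"
    "HOL-Algebra.Ideal_Product"
    "HOL-Algebra.Module"
    "HOL-Library.Poly_Mapping"
    "HOL-Library.Extended_Nat"
    "HOL-Library.Extended_Real"
    "HOL-Library.FuncSet"
begin

section \<open>Graphs\<close>

text \<open>The vertex set is a finite linearly ordered type \<open>'v\<close>, in the role of \<open>{1, \<dots>, n}\<close>; a graph
  is given by its set of edges.  The order is used only for the signs in the Cech complex.\<close>

definition simple_graph :: "'v set set \<Rightarrow> bool" where
  "simple_graph E \<longleftrightarrow> (\<forall>e\<in>E. card e = 2)"

definition induced_cycle :: "'v set set \<Rightarrow> 'v list \<Rightarrow> bool" where
  "induced_cycle E vs \<longleftrightarrow> 3 \<le> length vs \<and> distinct vs \<and>
     (\<forall>i<length vs. \<forall>j<length vs.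
        {vs ! i, vs ! j} \<in> E \<longleftrightarrow> j = Suc i mod length vs \<or> i = Suc j mod length vs)"

text \<open>The infimum of the empty set in \<^typ>\<open>enat\<close> is \<open>\<infinity>\<close>, so bipartite graphs get the value \<open>\<infinity>\<close>.\<close>

definition odd_girth :: "'v set set \<Rightarrow> enat" where
  "odd_girth E = (INF vs\<in>{vs. induced_cycle E vs \<and> odd (length vs)}. enat (length vs))"

section \<open>The polynomial ring, ideals and symbolic powers\<close>

type_synonym ('v, 'k) mpoly = "('v \<Rightarrow>\<^sub>0 nat) \<Rightarrow>\<^sub>0 'k"

abbreviation monomial :: "('v \<Rightarrow>\<^sub>0 nat) \<Rightarrow> ('v, 'k::field) mpoly" where
  "monomial e \<equiv> Poly_Mapping.single e 1"

definition var :: "'v \<Rightarrow> ('v, 'k::field) mpoly" where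
  "var v = monomial (Poly_Mapping.single v 1)"

definition poly_ring :: "('v, 'k::field) mpoly ring" where
  "poly_ring = \<lparr>carrier = UNIV, mult = (*), one = 1, zero = 0, add = (+)\<rparr>"

definition edge_ideal :: "'v set set \<Rightarrow> ('v, 'k::field) mpoly set" where
  "edge_ideal E = Idl\<^bsub>poly_ring\<^esub> {var u * var v | u v. {u, v} \<in> E}"

definition minimal_primes :: "('v, 'k::field) mpoly set \<Rightarrow> ('v, 'k) mpoly set set" where
  "minimal_primes I = {P. primeideal P poly_ring \<and> I \<subseteq> P \<and>
     (\<forall>Q. primeideal Q poly_ring \<and> I \<subseteq> Q \<and> Q \<subseteq> P \<longrightarrow> Q = P)}"

definition ideal_power :: "('v, 'k::field) mpoly set \<Rightarrow> nat \<Rightarrow> ('v, 'k) mpoly set" where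
  "ideal_power I k = I [^]\<^bsub>ideals_set poly_ring\<^esub> k"

definition symbolic_power :: "('v, 'k::field) mpoly set \<Rightarrow> nat \<Rightarrow> ('v, 'k) mpoly set" where
  "symbolic_power I k = (\<Inter>P\<in>minimal_primes I. ideal_power P k)"

section \<open>Modules, quotients and localizations\<close>

text \<open>The fields \<open>mult\<close> and \<open>one\<close> of a module record carry no meaning for a module.\<close>

definition poly_module :: "(('v, 'k::field) mpoly, ('v, 'k) mpoly) module" where
  "poly_module = \<lparr>carrier = UNIV, mult = (*), one = 1, zero = 0, add = (+), smult = (*)\<rparr>"

definition ideal_module ::
  "('v, 'k::field) mpoly set \<Rightarrow> (('v, 'k) mpoly, ('v, 'k) mpoly) module" where
  "ideal_module I = poly_module\<lparr>carrier := I\<rparr>"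

definition quot_module :: "('r, 'm) module \<Rightarrow> 'm set \<Rightarrow> ('r, 'm set) module" where
  "quot_module M N =
     \<lparr>carrier = a_rcosets\<^bsub>M\<^esub> N, mult = undefined, one = undefined, zero = N, add = set_add M,
      smult = (\<lambda>r X. \<Union>x\<in>X. N +>\<^bsub>M\<^esub> (r \<odot>\<^bsub>M\<^esub> x))\<rparr>"

text \<open>For \<open>I \<subseteq> J\<close> the natural map \<open>S/I \<rightarrow> S/J\<close>: it sends \<open>I + x\<close> to \<open>J + (I + x) = J + x\<close>.\<close>

definition quot_proj ::
  "('v, 'k::field) mpoly set \<Rightarrow> ('v, 'k) mpoly set \<Rightarrow> ('v, 'k) mpoly set" where
  "quot_proj J X = J <+>\<^bsub>poly_module\<^esub> X"

text \<open>In the next definitions \<open>W\<close> is a multiplicatively closed subset of the ring, containing \<open>1\<close>.\<close>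

definition frac_rel :: "('r::comm_ring_1, 'm) module \<Rightarrow> 'r set \<Rightarrow> (('m \<times> 'r) \<times> ('m \<times> 'r)) set" where
  "frac_rel M W = {((m, s), (m', s')). m \<in> carrier M \<and> m' \<in> carrier M \<and> s \<in> W \<and> s' \<in> W \<and>
     (\<exists>u\<in>W. u \<odot>\<^bsub>M\<^esub> (s' \<odot>\<^bsub>M\<^esub> m) = u \<odot>\<^bsub>M\<^esub> (s \<odot>\<^bsub>M\<^esub> m'))}"

definition fraction :: "('r::comm_ring_1, 'm) module \<Rightarrow> 'r set \<Rightarrow> 'm \<Rightarrow> 'r \<Rightarrow> ('m \<times> 'r) set" where
  "fraction M W m s = frac_rel M W `` {(m, s)}"

definition localization ::
  "('r::comm_ring_1, 'm) module \<Rightarrow> 'r set \<Rightarrow> ('r, ('m \<times> 'r) set) module" where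
  "localization M W =
     \<lparr>carrier = (carrier M \<times> W) // frac_rel M W, mult = undefined, one = undefined,
      zero = fraction M W \<zero>\<^bsub>M\<^esub> 1,
      add = (\<lambda>X Y. \<Union>(m, s)\<in>X. \<Union>(m', s')\<in>Y. fraction M W (s' \<odot>\<^bsub>M\<^esub> m \<oplus>\<^bsub>M\<^esub> s \<odot>\<^bsub>M\<^esub> m') (s * s')),
      smult = (\<lambda>r X. \<Union>(m, s)\<in>X. fraction M W (r \<odot>\<^bsub>M\<^esub> m) s)\<rparr>"

text \<open>The map \<open>m/s \<mapsto> f(m)/s\<close> into the localization of \<open>N\<close> at \<open>W\<close>, on a localization of the domain
  of \<open>f\<close> at a multiplicative subset of \<open>W\<close>.\<close>

definition frac_map ::
  "('m \<Rightarrow> 'n) \<Rightarrow> ('r::comm_ring_1, 'n) module \<Rightarrow> 'r set \<Rightarrow> ('m \<times> 'r) set \<Rightarrow> ('n \<times> 'r) set" where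
  "frac_map f N W X = (\<Union>(m, s)\<in>X. fraction N W (f m) s)"

section \<open>Local cohomology with respect to the irrelevant maximal ideal\<close>

text \<open>Local cohomology with support in \<open>(x_v : v \<in> V)\<close> is defined as the cohomology of the Cech
  complex \<open>0 \<rightarrow> M \<rightarrow> \<Oplus>_v M_(x_v) \<rightarrow> \<dots> \<rightarrow> M_(\<Prod>_v x_v) \<rightarrow> 0\<close> on the variables.  Its summand indexed by
  a set \<open>\<sigma>\<close> of vertices is the localization of \<open>M\<close> that inverts \<open>x_v\<close> for \<open>v \<in> \<sigma>\<close>.\<close>

definition monomials_on :: "'v set \<Rightarrow> ('v, 'k::field) mpoly set" where
  "monomials_on \<sigma> = {monomial e | e. Poly_Mapping.keys e \<subseteq> \<sigma>}"

abbreviation cech_term ::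
  "(('v, 'k::field) mpoly, 'm) module \<Rightarrow> 'v set
    \<Rightarrow> (('v, 'k) mpoly, ('m \<times> ('v, 'k) mpoly) set) module" where
  "cech_term M \<sigma> \<equiv> localization M (monomials_on \<sigma>)"

type_synonym ('v, 'k, 'm) cochain = "'v set \<Rightarrow> ('m \<times> ('v, 'k) mpoly) set"

definition cech_module ::
  "(('v::finite, 'k::field) mpoly, 'm) module \<Rightarrow> nat
    \<Rightarrow> (('v, 'k) mpoly, ('v, 'k, 'm) cochain) module" where
  "cech_module M p =
     \<lparr>carrier = (\<Pi>\<^sub>E \<sigma>\<in>{\<sigma>. card \<sigma> = p}. carrier (cech_term M \<sigma>)), mult = undefined, one = undefined,
      zero = (\<lambda>\<sigma>\<in>{\<sigma>. card \<sigma> = p}. \<zero>\<^bsub>cech_term M \<sigma>\<^esub>),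
      add = (\<lambda>c c'. \<lambda>\<sigma>\<in>{\<sigma>. card \<sigma> = p}. c \<sigma> \<oplus>\<^bsub>cech_term M \<sigma>\<^esub> c' \<sigma>),
      smult = (\<lambda>r c. \<lambda>\<sigma>\<in>{\<sigma>. card \<sigma> = p}. r \<odot>\<^bsub>cech_term M \<sigma>\<^esub> c \<sigma>)\<rparr>"

definition cech_diff ::
  "(('v::{finite,linorder}, 'k::field) mpoly, 'm) module \<Rightarrow> nat
    \<Rightarrow> ('v, 'k, 'm) cochain \<Rightarrow> ('v, 'k, 'm) cochain" where
  "cech_diff M p c = (\<lambda>\<tau>\<in>{\<tau>. card \<tau> = Suc p}.
     finsum (cech_term M \<tau>)
       (\<lambda>j. ((-1) ^ card {l\<in>\<tau>. l < j})
              \<odot>\<^bsub>cech_term M \<tau>\<^esub> frac_map (\<lambda>m. m) M (monomials_on \<tau>) (c (\<tau> - {j}))) \<tau>)"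

definition cocycles ::
  "(('v::{finite,linorder}, 'k::field) mpoly, 'm) module \<Rightarrow> nat \<Rightarrow> ('v, 'k, 'm) cochain set" where
  "cocycles M p = {c \<in> carrier (cech_module M p). cech_diff M p c = \<zero>\<^bsub>cech_module M (Suc p)\<^esub>}"

definition coboundaries ::
  "(('v::{finite,linorder}, 'k::field) mpoly, 'm) module \<Rightarrow> nat \<Rightarrow> ('v, 'k, 'm) cochain set" where
  "coboundaries M p = (case p of 0 \<Rightarrow> {\<zero>\<^bsub>cech_module M 0\<^esub>}
     | Suc q \<Rightarrow> cech_diff M q ` carrier (cech_module M q))"

definition local_cohomology ::
  "(('v::{finite,linorder}, 'k::field) mpoly, 'm) module \<Rightarrow> nat
    \<Rightarrow> (('v, 'k) mpoly, ('v, 'k, 'm) cochain set) module" where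
  "local_cohomology M p =
     quot_module ((cech_module M p)\<lparr>carrier := cocycles M p\<rparr>) (coboundaries M p)"

text \<open>The map on local cohomology induced by a linear map \<open>f\<close> into \<open>N\<close>.\<close>

definition local_cohomology_map ::
  "('m \<Rightarrow> 'n) \<Rightarrow> (('v::{finite,linorder}, 'k::field) mpoly, 'n) module \<Rightarrow> nat
    \<Rightarrow> ('v, 'k, 'm) cochain set \<Rightarrow> ('v, 'k, 'n) cochain set" where
  "local_cohomology_map f N p X = (\<Union>c\<in>X. coboundaries N p +>\<^bsub>cech_module N p\<^esub>
     (\<lambda>\<sigma>\<in>{\<sigma>. card \<sigma> = p}. frac_map f N (monomials_on \<sigma>) (c \<sigma>)))"

section \<open>Gradings and Castelnuovo--Mumford regularity\<close>

text \<open>A grading of \<open>M\<close> is given by its homogeneous components \<open>D d\<close>, \<open>d \<in> \<int>\<close>.  The fraction \<open>m/s\<close> of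
  a homogeneous \<open>m\<close> and a monomial \<open>s\<close> has degree \<open>deg m - deg s\<close>.\<close>

definition mono_deg :: "('v::finite \<Rightarrow>\<^sub>0 nat) \<Rightarrow> int" where
  "mono_deg e = (\<Sum>v\<in>UNIV. int (Poly_Mapping.lookup e v))"

definition homogeneous_polys :: "int \<Rightarrow> ('v::finite, 'k::field) mpoly set" where
  "homogeneous_polys d = {p. \<forall>e\<in>Poly_Mapping.keys p. mono_deg e = d}"

definition cech_term_degree ::
  "(('v::finite, 'k::field) mpoly, 'm) module \<Rightarrow> (int \<Rightarrow> 'm set) \<Rightarrow> 'v set \<Rightarrow> int
    \<Rightarrow> ('m \<times> ('v, 'k) mpoly) set set" where
  "cech_term_degree M D \<sigma> d =
     {fraction M (monomials_on \<sigma>) m (monomial e) | m e.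
        Poly_Mapping.keys e \<subseteq> \<sigma> \<and> m \<in> D (d + mono_deg e)}"

definition local_cohomology_degree ::
  "(('v::{finite,linorder}, 'k::field) mpoly, 'm) module \<Rightarrow> (int \<Rightarrow> 'm set) \<Rightarrow> nat \<Rightarrow> int
    \<Rightarrow> ('v, 'k, 'm) cochain set set" where
  "local_cohomology_degree M D p d = {coboundaries M p +>\<^bsub>cech_module M p\<^esub> c | c.
     c \<in> cocycles M p \<and> (\<forall>\<sigma>. card \<sigma> = p \<longrightarrow> c \<sigma> \<in> cech_term_degree M D \<sigma> d)}"

text \<open>\<open>reg M = sup {i + d | H\<^sup>i(M)_d \<noteq> 0}\<close>, that is, the supremum over \<open>i\<close> of \<open>a_i(M) + i\<close>; the zero
  module has regularity \<open>-\<infinity>\<close>.\<close>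

definition regularity ::
  "(('v::{finite,linorder}, 'k::field) mpoly, 'm) module \<Rightarrow> (int \<Rightarrow> 'm set) \<Rightarrow> ereal" where
  "regularity M D =
     (SUP (i, d)\<in>{(i, d). local_cohomology_degree M D i d \<noteq> {\<zero>\<^bsub>local_cohomology M i\<^esub>}}.
        ereal (real_of_int (int i + d)))"

definition ideal_regularity :: "('v::{finite,linorder}, 'k::field) mpoly set \<Rightarrow> ereal" where
  "ideal_regularity I = regularity (ideal_module I) (\<lambda>d. I \<inter> homogeneous_polys d)"

end

theory Submission
  imports Defs "HOL-Library.Function_Algebras"
begin

text \<open>
  All ideals here are monomial, so everything is decided by the set \<open>U\<close> of exponent vectors of
  \<open>I\<^sup>k\<close> and the set \<open>V\<close> of those of \<open>I\<^sup>(\<^sup>k\<^sup>)\<close>.  An exponent vector \<open>a\<close> lies in \<open>U\<close> if it dominates a sum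
  of \<open>k\<close> edges, and in \<open>V\<close> if its weight on every vertex cover is at least \<open>k\<close>
  (\<open>symbolic_power_edge_ideal\<close>: the minimal primes are the ideals generated by the minimal covers).

  The combinatorial heart is \<open>sym_exps_saturation\<close>: if \<open>a\<close> is not in \<open>V\<close> but \<open>a + b\<close> is, then
  \<open>a + 2b\<close> is in \<open>U\<close>; in particular \<open>I\<^sup>k : x\<^sup>a\<close> and \<open>I\<^sup>(\<^sup>k\<^sup>) : x\<^sup>a\<close> have the same radical whenever
  \<open>x\<^sup>a\<close> is not in \<open>I\<^sup>(\<^sup>k\<^sup>)\<close>.  To see this, restrict the graph to the support of \<open>c = a + b\<close>.  If that
  graph is bipartite, a weighted form of Koenig's theorem gives \<open>c \<in> U\<close>.  Otherwise it contains an
  induced odd cycle, whose length is at least \<open>2t - 1 \<ge> 2k - 1\<close>.  A cycle of length at least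
  \<open>2k + 1\<close> contains \<open>k\<close> disjoint edges, and again \<open>c \<in> U\<close>.  A cycle of length \<open>2k - 1\<close> has weight
  at least \<open>k\<close> on every cover, so \<open>a\<close> cannot contain all of it, and \<open>b\<close> is positive at some vertex
  \<open>v\<close> of the cycle.  Then \<open>c + b\<close> contains the cycle with \<open>v\<close> doubled, which is a union of \<open>k\<close> edges.

  The Cech complex of a monomial subquotient is graded by Laurent exponents \<open>a\<close>, and in degree \<open>a\<close>
  it only depends on which localizations contain \<open>x\<^sup>a\<close>.  Let \<open>a\<^sub>+\<close> be the positive part of \<open>a\<close>.  If
  \<open>a\<^sub>+ \<notin> V\<close>, saturation says that the complexes of \<open>S/I\<^sup>k\<close> and of \<open>S/I\<^sup>(\<^sup>k\<^sup>)\<close> agree in degree \<open>a\<close>; if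
  \<open>a\<^sub>+ \<in> V\<close>, the complex of \<open>S/I\<^sup>(\<^sup>k\<^sup>)\<close> vanishes in degree \<open>a\<close>.  Hence a cocycle of \<open>S/I\<^sup>(\<^sup>k\<^sup>)\<close>, written in
  Laurent coordinates, is verbatim a cocycle of \<open>S/I\<^sup>k\<close>, and the map on cohomology is surjective
  (\<open>local_cohomology_map_surjective\<close>).

  For the regularity the same comparison is made for the ideals themselves.  In the degrees with
  \<open>a\<^sub>+ \<notin> V\<close> the complexes of \<open>I\<^sup>k\<close> and \<open>I\<^sup>(\<^sup>k\<^sup>)\<close> agree.  In the degrees with \<open>a\<^sub>+ \<in> V\<close> the complex of
  \<open>I\<^sup>(\<^sup>k\<^sup>)\<close> is that of \<open>S\<close>, which is contractible because \<open>0 \<notin> V\<close> forces \<open>a\<close> to have a nonnegative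
  coordinate.  So every nonzero class of \<open>I\<^sup>(\<^sup>k\<^sup>)\<close> yields a nonzero class of \<open>I\<^sup>k\<close> of the same
  cohomological and internal degree (\<open>ideal_regularity_le\<close>).
\<close>

section \<open>Upsets of exponent vectors, covers and edges\<close>

text \<open>Exponent vectors have integer entries, so that nonnegative vectors and Laurent exponents live in
  one type.\<close>

definition unit_vec :: "'v \<Rightarrow> 'v \<Rightarrow> int" where
  "unit_vec v = (\<lambda>w. if w = v then 1 else 0)"

text \<open>The exponent set of the \<open>k\<close>-th power of the monomial ideal with exponent set \<open>U\<close>.  The base
  case is the exponent set of the unit ideal.\<close>

fun upset_power :: "('v \<Rightarrow> int) set \<Rightarrow> nat \<Rightarrow> ('v \<Rightarrow> int) set" where
  "upset_power U 0 = {a. 0 \<le> a}"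
| "upset_power U (Suc k) = {a + b | a b. a \<in> upset_power U k \<and> b \<in> U}"

definition upset :: "('v \<Rightarrow> int) set \<Rightarrow> bool" where
  "upset U \<longleftrightarrow> (\<forall>a\<in>U. 0 \<le> a) \<and> (\<forall>a b. a \<in> U \<longrightarrow> a \<le> b \<longrightarrow> b \<in> U)"

lemma upsetI:
  assumes "\<And>a. a \<in> U \<Longrightarrow> 0 \<le> a" "\<And>a b. a \<in> U \<Longrightarrow> a \<le> b \<Longrightarrow> b \<in> U"
  shows "upset U"
  using assms unfolding upset_def by blast

lemma upset_nonneg: "upset U \<Longrightarrow> a \<in> U \<Longrightarrow> 0 \<le> a"
  and upset_mono: "upset U \<Longrightarrow> a \<in> U \<Longrightarrow> a \<le> b \<Longrightarrow> b \<in> U"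
  unfolding upset_def by blast+

lemma add_nonneg_vec: "0 \<le> a \<Longrightarrow> 0 \<le> b \<Longrightarrow> 0 \<le> (a + b :: 'v \<Rightarrow> int)"
  by (simp add: le_fun_def)

lemma le_add_vec: "0 \<le> b \<Longrightarrow> a \<le> (a + b :: 'v \<Rightarrow> int)"
  by (simp add: le_fun_def)

lemma upset_power_upset:
  assumes "upset U"
  shows "upset (upset_power U k)"
proof (induction k)
  case 0
  then show ?case using order_trans[of "0 :: 'a \<Rightarrow> int"] by (simp add: upset_def)
next
  case (Suc k)
  have "c \<in> upset_power U (Suc k)" if "a \<in> upset_power U k" "b \<in> U" "a + b \<le> c" for a b c
  proof -
    have "a \<le> c - b" using that(3) by (simp add: le_fun_def le_diff_eq)
    then have "c - b \<in> upset_power U k" using Suc that(1) upset_mono by blast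
    then have "(c - b) + b \<in> upset_power U (Suc k)" using that(2) unfolding upset_power.simps by blast
    then show ?thesis by simp
  qed
  moreover have "0 \<le> a + b" if "a \<in> upset_power U k" "b \<in> U" for a b
    using upset_nonneg[OF Suc that(1)] upset_nonneg[OF assms that(2)] by (rule add_nonneg_vec)
  ultimately show ?case by (auto simp: upset_def)
qed

definition vertex_cover :: "'v set set \<Rightarrow> 'v set \<Rightarrow> bool" where
  "vertex_cover E C \<longleftrightarrow> (\<forall>u v. {u, v} \<in> E \<longrightarrow> u \<in> C \<or> v \<in> C)"

definition edge_exps :: "'v set set \<Rightarrow> ('v \<Rightarrow> int) set" where
  "edge_exps E = {a. 0 \<le> a \<and> (\<exists>u v. {u, v} \<in> E \<and> unit_vec u + unit_vec v \<le> a)}"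

text \<open>The exponent set of the \<open>k\<close>-th symbolic power of the edge ideal.\<close>

definition sym_exps :: "'v::finite set set \<Rightarrow> nat \<Rightarrow> ('v \<Rightarrow> int) set" where
  "sym_exps E k = {a. 0 \<le> a \<and> (\<forall>C. vertex_cover E C \<longrightarrow> int k \<le> sum a C)}"

lemma unit_vec_nonneg: "0 \<le> unit_vec v"
  by (simp add: unit_vec_def le_fun_def)

lemma edge_exps_upset: "upset (edge_exps E)"
proof (rule upsetI)
  show "b \<in> edge_exps E" if "a \<in> edge_exps E" "a \<le> b" for a b
  proof -
    obtain u v where uv: "0 \<le> a" "{u, v} \<in> E" "unit_vec u + unit_vec v \<le> a"
      using \<open>a \<in> edge_exps E\<close> by (auto simp: edge_exps_def)
    have "0 \<le> b" by (rule order_trans[OF uv(1) \<open>a \<le> b\<close>])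
    moreover have "unit_vec u + unit_vec v \<le> b" by (rule order_trans[OF uv(3) \<open>a \<le> b\<close>])
    ultimately show ?thesis unfolding edge_exps_def using uv(2) by blast
  qed
qed (simp add: edge_exps_def)

lemma sym_exps_upset: "upset (sym_exps E k)"
proof (rule upsetI)
  have "sum a C \<le> sum b C" if "a \<le> b" for a b :: "'a \<Rightarrow> int" and C
    using that by (simp add: le_fun_def sum_mono)
  then show "b \<in> sym_exps E k" if "a \<in> sym_exps E k" "a \<le> b" for a b
    using that order_trans[of 0 a b] unfolding sym_exps_def mem_Collect_eq
    by (metis order_trans)
qed (simp add: sym_exps_def)

lemma sum_vec_if:
  fixes a :: "'v::finite \<Rightarrow> int"
  shows "sum a C = (\<Sum>v\<in>UNIV. if v \<in> C then a v else 0)"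
  by (simp add: sum.If_cases)

lemma sum_unit_vec: "sum (unit_vec u) (C :: 'v::finite set) = (if u \<in> C then 1 else 0)"
  by (simp add: unit_vec_def)

lemma sum_nonzero_vertex: "1 \<le> sum a C \<Longrightarrow> \<exists>v\<in>C. a v \<noteq> (0 :: int)"
  by (metis not_one_le_zero sum.neutral)

lemma edge_power_SucI:
  assumes "{u, v} \<in> E" "a - unit_vec u - unit_vec v \<in> upset_power (edge_exps E) k"
  shows "a \<in> upset_power (edge_exps E) (Suc k)"
proof -
  have "unit_vec u + unit_vec v \<in> edge_exps E"
    using assms(1) add_nonneg_vec[OF unit_vec_nonneg unit_vec_nonneg, of u v]
    by (auto simp: edge_exps_def)
  then have "(a - unit_vec u - unit_vec v) + (unit_vec u + unit_vec v) \<in> upset_power (edge_exps E) (Suc k)"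
    using assms(2) by (simp only: upset_power.simps) blast
  then show ?thesis by simp
qed

text \<open>Weighted form of Koenig's theorem, by induction on \<open>k\<close>: an edge \<open>uv\<close> is removed from \<open>a\<close> such
  that no cover of least weight contains both \<open>u\<close> and \<open>v\<close>, so that the weight of every cover stays
  at least \<open>k\<close>.  To find it, take a vertex \<open>u\<close> of positive weight in a cover of least weight, and
  among the covers of least weight containing \<open>u\<close> one, \<open>C\<close>, that is largest on the side opposite
  to \<open>u\<close>.  As \<open>C - {u}\<close> is too light to be a cover, \<open>u\<close> has a neighbour \<open>v \<notin> C\<close>.\<close>

lemma bipartite_cover_power:
  fixes a :: "'v::finite \<Rightarrow> int"
  assumes bip: "\<And>u v. {u, v} \<in> E \<Longrightarrow> u \<in> A \<longleftrightarrow> v \<notin> A"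
    and "a \<in> sym_exps E k"
  shows "a \<in> upset_power (edge_exps E) k"
  using assms(2)
proof (induction k arbitrary: a)
  case 0
  then show ?case by (simp add: sym_exps_def)
next
  case (Suc k)
  have a0: "0 \<le> a" and acov: "\<And>C. vertex_cover E C \<Longrightarrow> int (Suc k) \<le> sum a C"
    using Suc.prems by (auto simp: sym_exps_def)
  have a0': "0 \<le> a v" for v using a0 by (simp add: le_fun_def)
  have "vertex_cover E UNIV" by (simp add: vertex_cover_def)
  then obtain C0 where C0: "vertex_cover E C0"
    and min0: "\<And>C. vertex_cover E C \<Longrightarrow> nat (sum a C0) \<le> nat (sum a C)"
    using ex_has_least_nat[of "vertex_cover E" UNIV "\<lambda>C. nat (sum a C)"] by blast
  define m where "m = sum a C0"
  have m: "m \<le> sum a C" if "vertex_cover E C" for C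
    using min0[OF that] sum_nonneg[of C a] a0' by (simp add: m_def)
  have mk: "int (Suc k) \<le> m" using acov[OF C0] m_def by simp
  have "\<exists>u\<in>C0. a u \<noteq> 0" using mk m_def by (intro sum_nonzero_vertex) simp
  then obtain u where u: "u \<in> C0" "a u \<noteq> 0" by blast
  then have au: "1 \<le> a u" using a0'[of u] by simp
  \<comment> \<open>The colour class that contains \<open>u\<close>.\<close>
  define B where "B = (if u \<in> A then A else - A)"
  have uB: "u \<in> B" by (simp add: B_def)
  have bipB: "x \<in> B \<longleftrightarrow> y \<notin> B" if "{x, y} \<in> E" for x y
    using bip[OF that] by (auto simp: B_def)
  let ?P = "\<lambda>C. vertex_cover E C \<and> u \<in> C \<and> sum a C = m"
  have "?P C0" using C0 u m_def by simp
  moreover have "\<forall>C. ?P C \<longrightarrow> card (C - B) < Suc (card (UNIV :: 'v set))"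
    by (simp add: card_mono less_Suc_eq_le)
  ultimately obtain C where C: "?P C" and Cmax: "\<And>D. ?P D \<Longrightarrow> card (D - B) \<le> card (C - B)"
    using ex_has_greatest_nat[of ?P C0 "\<lambda>C. card (C - B)" "Suc (card (UNIV :: 'v set))"] by blast
  have "sum a (C - {u}) = m - a u" using C by (simp add: sum_diff1)
  then have "\<not> vertex_cover E (C - {u})" using m[of "C - {u}"] au by auto
  then obtain x y where xy: "{x, y} \<in> E" "x \<notin> C - {u}" "y \<notin> C - {u}"
    by (auto simp: vertex_cover_def)
  have "x \<in> C \<or> y \<in> C" using C xy(1) by (auto simp: vertex_cover_def)
  then obtain v where v: "{u, v} \<in> E" "v \<notin> C - {u}"
    using xy by (metis insertE insert_commute insert_Diff C)
  have vB: "v \<notin> B" using bipB[OF v(1)] uB by simp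
  then have uv: "u \<noteq> v" using uB by auto
  have vC: "v \<notin> C" using v(2) uv by auto
  \<comment> \<open>If \<open>v\<close> had weight zero, adding it to \<open>C\<close> would contradict the choice of \<open>C\<close>.\<close>
  have "a v \<noteq> 0"
  proof
    assume "a v = 0"
    then have "?P (insert v C)" using C vC by (auto simp: vertex_cover_def)
    then have "card (insert v C - B) \<le> card (C - B)" by (rule Cmax)
    moreover have "insert v C - B = insert v (C - B)" using vB by auto
    ultimately show False using vC by simp
  qed
  then have av: "1 \<le> a v" using a0'[of v] by simp
  let ?b = "a - unit_vec u - unit_vec v"
  have "0 \<le> ?b" using a0' au av uv by (auto simp: le_fun_def unit_vec_def)
  moreover have "int k \<le> sum ?b C'" if C': "vertex_cover E C'" for C'
  proof -
    have eq: "sum ?b C' = sum a C' - (if u \<in> C' then 1 else 0) - (if v \<in> C' then 1 else 0)"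
      using sum_unit_vec[of u C'] sum_unit_vec[of v C'] by (simp add: sum_subtractf)
    show ?thesis
    proof (cases "u \<in> C' \<and> v \<in> C'")
      case False
      then show ?thesis using eq m[OF C'] mk by auto
    next
      case True
      have "sum a C' \<noteq> m"
      proof
        assume w: "sum a C' = m"
        \<comment> \<open>Exchanging intersection and union of the two covers on the two colour classes gives two
          covers with the same total weight; \<open>D\<close> also contains \<open>u\<close> and beats \<open>C\<close> outside \<open>B\<close>.\<close>
        define D where "D = (C \<inter> C' \<inter> B) \<union> ((C \<union> C') - B)"
        define D' where "D' = ((C \<union> C') \<inter> B) \<union> ((C \<inter> C') - B)"
        have "vertex_cover E D" "vertex_cover E D'"
          using C C' bipB unfolding vertex_cover_def D_def D'_def by blast+
        moreover have "sum a D + sum a D' = sum a C + sum a C'"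
          unfolding sum_vec_if[of a] sum.distrib[symmetric]
          by (rule sum.cong) (auto simp: D_def D'_def)
        ultimately have "sum a D = m" using m[of D] m[of D'] C w by linarith
        then have "card (D - B) \<le> card (C - B)"
          using Cmax[of D] \<open>vertex_cover E D\<close> True C uB by (simp add: D_def)
        moreover have "C - B \<subset> D - B" using vB vC True by (auto simp: D_def)
        then have "card (C - B) < card (D - B)" by (simp add: psubset_card_mono)
        ultimately show False by simp
      qed
      then show ?thesis using eq m[OF C'] mk True by simp
    qed
  qed
  ultimately have "?b \<in> sym_exps E k" by (simp add: sym_exps_def)
  then show ?case by (intro edge_power_SucI[OF v(1)] Suc.IH)
qed

section \<open>Odd closed walks and induced odd cycles\<close>

definition adjacency :: "'v set set \<Rightarrow> ('v \<times> 'v) set" where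
  "adjacency E = {(u, v). {u, v} \<in> E}"

lemma adjacency_iff: "(u, v) \<in> adjacency E \<longleftrightarrow> {u, v} \<in> E"
  by (simp add: adjacency_def)

lemma walk_sym: "(u, v) \<in> adjacency E ^^ n \<Longrightarrow> (v, u) \<in> adjacency E ^^ n"
proof (induction n arbitrary: v)
  case (Suc n)
  then obtain w where "(u, w) \<in> adjacency E ^^ n" "(w, v) \<in> adjacency E" by auto
  then have "(v, w) \<in> adjacency E" "(w, u) \<in> adjacency E ^^ n"
    using Suc.IH by (auto simp: adjacency_iff insert_commute)
  then show ?case by (rule relpow_Suc_I2)
qed auto

lemma walk_append: "(u, v) \<in> R ^^ m \<Longrightarrow> (v, w) \<in> R ^^ n \<Longrightarrow> (u, w) \<in> R ^^ (m + n)"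
  by (auto simp: relpow_add)

text \<open>The colour of a vertex is the parity of the walks from a chosen root of its component.\<close>

lemma bipartite_if_no_odd_closed_walk:
  assumes "\<And>n u. odd n \<Longrightarrow> (u, u) \<notin> adjacency E ^^ n"
  shows "\<exists>A. \<forall>u v. {u, v} \<in> E \<longrightarrow> (u \<in> A \<longleftrightarrow> v \<notin> A)"
proof -
  define root where "root v = (SOME x. \<exists>n. (x, v) \<in> adjacency E ^^ n)" for v
  have root: "\<exists>n. (root v, v) \<in> adjacency E ^^ n" for v
    unfolding root_def by (rule someI[of _ v]) (auto intro: exI[of _ 0])
  have root_eq: "root u = root v" if "(u, v) \<in> adjacency E" for u v
  proof -
    have "(v, u) \<in> adjacency E" using that by (auto simp: adjacency_iff insert_commute)
    then have "(\<exists>n. (x, u) \<in> adjacency E ^^ n) \<longleftrightarrow> (\<exists>n. (x, v) \<in> adjacency E ^^ n)" for x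
      using relpow_Suc_I[OF _ that, of x] relpow_Suc_I[OF _ \<open>(v, u) \<in> adjacency E\<close>, of x]
      by (metis (no_types))
    then show ?thesis unfolding root_def by simp
  qed
  define A where "A = {v. \<exists>n. even n \<and> (root v, v) \<in> adjacency E ^^ n}"
  have "u \<in> A \<longleftrightarrow> v \<notin> A" if "{u, v} \<in> E" for u v
  proof -
    have uv: "(u, v) \<in> adjacency E" using that by (simp add: adjacency_iff)
    define r where "r = root v"
    have r: "root u = r" "root v = r" using root_eq[OF uv] by (simp_all add: r_def)
    have uA: "u \<in> A \<longleftrightarrow> (\<exists>n. even n \<and> (r, u) \<in> adjacency E ^^ n)"
      and vA: "v \<in> A \<longleftrightarrow> (\<exists>n. even n \<and> (r, v) \<in> adjacency E ^^ n)"
      by (simp_all add: A_def r)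
    show ?thesis
    proof (cases "u \<in> A")
      case True
      have False if in_A: "v \<in> A"
      proof -
        obtain m where m: "even m" "(r, u) \<in> adjacency E ^^ m"
          using True uA by blast
        obtain n where n: "even n" "(r, v) \<in> adjacency E ^^ n"
          using in_A vA by blast
        have "(r, v) \<in> adjacency E ^^ Suc m" using m(2) uv by (rule relpow_Suc_I)
        then have "(r, r) \<in> adjacency E ^^ (Suc m + n)" using walk_sym[OF n(2)] by (rule walk_append)
        then show False using assms[of "Suc m + n" r] m n by simp
      qed
      then show ?thesis using True by blast
    next
      case False
      obtain n where n: "(r, u) \<in> adjacency E ^^ n" using root[of u] unfolding r(1) by blast
      then have "odd n" using False uA by blast
      moreover have "(r, v) \<in> adjacency E ^^ Suc n" using n uv by (rule relpow_Suc_I)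
      ultimately have "v \<in> A" unfolding vA by (intro exI[of _ "Suc n"]) simp
      then show ?thesis using False by blast
    qed
  qed
  then show ?thesis by blast
qed

lemma walk_segment:
  assumes "\<And>i. i < n \<Longrightarrow> (f i, f (Suc i)) \<in> R" "i \<le> j" "j \<le> n"
  shows "(f i, f j) \<in> R ^^ (j - i)"
  unfolding relpow_fun_conv
  using assms by (intro exI[of _ "\<lambda>m. f (i + m)"]) auto

text \<open>A repeated vertex splits an odd closed walk into two closed walks, one of which is odd and
  shorter; a chord does the same.  So the vertices of a shortest one form an induced cycle.\<close>

lemma shortest_odd_closed_walk:
  assumes "simple_graph E" "odd n" "(x, x) \<in> adjacency E ^^ n"
    and shortest: "\<And>m y. odd m \<Longrightarrow> (y, y) \<in> adjacency E ^^ m \<Longrightarrow> n \<le> m"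
  obtains vs where "induced_cycle E vs" "length vs = n"
proof -
  obtain f where f: "f 0 = x" "f n = x" and step: "\<And>i. i < n \<Longrightarrow> (f i, f (Suc i)) \<in> adjacency E"
    using assms(3) unfolding relpow_fun_conv by blast
  have noloop: "{u, u} \<notin> E" for u using assms(1) by (auto simp: simple_graph_def)
  have "n \<noteq> 1"
  proof
    assume "n = 1"
    then show False using step[of 0] f noloop by (simp add: adjacency_iff)
  qed
  then have n3: "3 \<le> n" using assms(2) by presburger
  have seg: "(f i, f j) \<in> adjacency E ^^ (j - i)" if "i \<le> j" "j \<le> n" for i j
    using step that by (rule walk_segment)
  \<comment> \<open>From \<open>f j\<close> onwards to the end of the walk, which is its start, and then to \<open>f i\<close>.\<close>
  have around: "(f j, f i) \<in> adjacency E ^^ (n - (j - i))" if "i \<le> j" "j \<le> n" for i j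
  proof -
    have "(f j, f i) \<in> adjacency E ^^ ((n - j) + (i - 0))"
      using seg[of j n] seg[of 0 i] f that by (intro walk_append[of _ x]) auto
    then show ?thesis using that by simp
  qed
  have inj: "f i \<noteq> f j" if "i < j" "j < n" for i j
  proof
    assume eq: "f i = f j"
    have "n = (j - i) + (n - (j - i))" using that by simp
    then have "odd (j - i) \<or> odd (n - (j - i))" using assms(2) by (metis even_add)
    then consider "odd (j - i)" | "odd (n - (j - i))" by blast
    then show False
    proof cases
      case 1
      then show False using shortest[OF 1, of "f i"] seg[of i j] eq that by simp
    next
      case 2
      then show False using shortest[OF 2, of "f i"] around[of i j] eq that by simp
    qed
  qed
  \<comment> \<open>A chord cuts the walk into two closed walks of total length \<open>n + 2\<close>, which is odd.\<close>
  have nochord: "j = Suc i \<or> (i = 0 \<and> Suc j = n)" if "i < j" "j < n" "{f i, f j} \<in> E" for i j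
  proof (rule ccontr)
    assume neg: "\<not> ?thesis"
    have ij: "(f i, f j) \<in> adjacency E" "(f j, f i) \<in> adjacency E"
      using that(3) by (auto simp: adjacency_iff insert_commute)
    have w1: "(f i, f i) \<in> adjacency E ^^ Suc (j - i)"
      using seg[of i j] that ij by (intro relpow_Suc_I) auto
    have w2: "(f j, f j) \<in> adjacency E ^^ Suc (n - (j - i))"
      using around[of i j] that ij by (intro relpow_Suc_I) auto
    have "n = (j - i) + (n - (j - i))" using that by simp
    then have "odd (Suc (j - i)) \<or> odd (Suc (n - (j - i)))" using assms(2) by (metis even_add even_Suc)
    then show False using shortest[OF _ w1] shortest[OF _ w2] neg that by linarith
  qed
  have cyc: "{f i, f (Suc i mod n)} \<in> E" if "i < n" for i
  proof (cases "Suc i = n")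
    case True
    then show ?thesis using step[OF that] f by (simp add: adjacency_iff)
  next
    case False
    then show ?thesis using step[OF that] that by (simp add: adjacency_iff)
  qed
  have "{f i, f j} \<in> E \<longleftrightarrow> j = Suc i mod n \<or> i = Suc j mod n" if "i < n" "j < n" for i j
  proof
    assume e: "{f i, f j} \<in> E"
    then have "i \<noteq> j" using noloop by auto
    then consider "i < j" | "j < i" by linarith
    then show "j = Suc i mod n \<or> i = Suc j mod n"
    proof cases
      case 1
      then show ?thesis using nochord[OF 1 that(2) e] that by auto
    next
      case 2
      then show ?thesis using nochord[of j i] that e by (auto simp: insert_commute)
    qed
  next
    assume "j = Suc i mod n \<or> i = Suc j mod n"
    then show "{f i, f j} \<in> E" using cyc[OF that(1)] cyc[OF that(2)] by (auto simp: insert_commute)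
  qed
  then have "induced_cycle E (map f [0..<n])"
    using n3 inj unfolding induced_cycle_def distinct_conv_nth
    by (auto simp: nat_neq_iff) metis+
  then show ?thesis using that by simp
qed

lemma sum_unit_vec_inj:
  assumes "finite S" "inj_on f S"
  shows "(\<Sum>i\<in>S. unit_vec (f i) w) = (if w \<in> f ` S then 1 else 0)"
proof -
  have "(\<Sum>i\<in>S. unit_vec (f i) w) = (\<Sum>v\<in>f ` S. unit_vec v w)"
    using assms(2) by (simp add: sum.reindex)
  also have "\<dots> = (if w \<in> f ` S then 1 else 0)"
    using assms(1) by (simp add: unit_vec_def)
  finally show ?thesis .
qed

text \<open>The edges join the consecutive pairs \<open>f 0, f 1\<close>, then \<open>f 2, f 3\<close>, and so on; vertices may be
  repeated as long as \<open>a\<close> has room for them.\<close>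

lemma matching_power:
  assumes "\<And>j. j < k \<Longrightarrow> {f (2 * j), f (Suc (2 * j))} \<in> E"
    and "\<And>w. (\<Sum>i<2 * k. unit_vec (f i) w) \<le> a w"
  shows "a \<in> upset_power (edge_exps E) k"
  using assms
proof (induction k arbitrary: a)
  case 0
  then show ?case by (simp add: le_fun_def)
next
  case (Suc k)
  have "a - unit_vec (f (2 * k)) - unit_vec (f (Suc (2 * k))) \<in> upset_power (edge_exps E) k"
  proof (rule Suc.IH)
    show "{f (2 * j), f (Suc (2 * j))} \<in> E" if "j < k" for j using Suc.prems(1) that by simp
    show "(\<Sum>i<2 * k. unit_vec (f i) w)
        \<le> (a - unit_vec (f (2 * k)) - unit_vec (f (Suc (2 * k)))) w" for w
      using Suc.prems(2)[of w] by simp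
  qed
  then show ?case using Suc.prems(1)[of k] by (intro edge_power_SucI) auto
qed

lemma upset_power_mono: "U \<subseteq> V \<Longrightarrow> upset_power U k \<subseteq> upset_power V k"
  by (induction k) (simp, fastforce)

text \<open>Below the odd girth, the only obstruction to equality of symbolic and ordinary powers is an odd
  cycle of length exactly \<open>2k - 1\<close>.  The dichotomy is whether the graph induced on the support of
  \<open>a\<close> is bipartite.\<close>

lemma sym_exps_edge_power_or_odd_cycle:
  fixes E :: "'v::finite set set"
  assumes "simple_graph E" "enat (2 * t - 1) \<le> odd_girth E" "1 \<le> k" "k \<le> t"
    and a: "a \<in> sym_exps E k"
  shows "a \<in> upset_power (edge_exps E) k
    \<or> (\<exists>vs. induced_cycle E vs \<and> length vs = 2 * k - 1 \<and> (\<forall>v\<in>set vs. 1 \<le> a v))"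
proof -
  have a0: "0 \<le> a v" for v using a by (auto simp: sym_exps_def le_fun_def)
  define W where "W = {v. 1 \<le> a v}"
  define E' where "E' = {e \<in> E. e \<subseteq> W}"
  show ?thesis
  proof (cases "\<exists>n u. odd n \<and> (u, u) \<in> adjacency E' ^^ n")
    case False
    then have "odd n \<Longrightarrow> (u, u) \<notin> adjacency E' ^^ n" for n u by blast
    then have "\<exists>A. \<forall>u v. {u, v} \<in> E' \<longrightarrow> (u \<in> A \<longleftrightarrow> v \<notin> A)"
      by (rule bipartite_if_no_odd_closed_walk)
    then obtain A where A: "\<forall>u v. {u, v} \<in> E' \<longrightarrow> (u \<in> A \<longleftrightarrow> v \<notin> A)" by blast
    have "int k \<le> sum a C" if "vertex_cover E' C" for C
    proof -
      \<comment> \<open>Vertices outside the support complete \<open>C\<close> to a cover of the whole graph at no cost.\<close>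
      have "vertex_cover E (C \<union> - W)" using that by (auto simp: vertex_cover_def E'_def)
      then have "int k \<le> sum a (C \<union> - W)" using a by (simp add: sym_exps_def)
      also have "\<dots> = sum a C"
      proof (rule sum.mono_neutral_right)
        show "\<forall>i\<in>C \<union> - W - C. a i = 0"
        proof
          fix i assume "i \<in> C \<union> - W - C"
          then have "\<not> 1 \<le> a i" by (auto simp: W_def)
          then show "a i = 0" using a0[of i] by simp
        qed
      qed auto
      finally show ?thesis .
    qed
    then have "a \<in> sym_exps E' k" using a by (simp add: sym_exps_def)
    then have "a \<in> upset_power (edge_exps E') k" using A by (intro bipartite_cover_power[of E' A]) auto
    moreover have "edge_exps E' \<subseteq> edge_exps E" by (auto simp: edge_exps_def E'_def)
    then have "upset_power (edge_exps E') k \<subseteq> upset_power (edge_exps E) k" by (rule upset_power_mono)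
    ultimately show ?thesis by auto
  next
    case True
    let ?odd = "\<lambda>n. odd n \<and> (\<exists>u. (u, u) \<in> adjacency E' ^^ n)"
    define n where "n = (LEAST n. ?odd n)"
    have "\<exists>n. ?odd n" using True by blast
    then have odd_n: "?odd n" unfolding n_def by (rule LeastI_ex[of ?odd])
    then obtain x where x: "(x, x) \<in> adjacency E' ^^ n" by blast
    have least: "n \<le> m" if "odd m" "(u, u) \<in> adjacency E' ^^ m" for m u
      unfolding n_def by (rule Least_le[of ?odd]) (use that in blast)
    have simple: "simple_graph E'" using assms(1) by (simp add: simple_graph_def E'_def)
    obtain vs where vs: "induced_cycle E' vs" "length vs = n"
      using shortest_odd_closed_walk[OF simple conjunct1[OF odd_n] x least] .
    have vsW: "vs ! i \<in> W" if "i < n" for i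
    proof -
      have "{vs ! i, vs ! (Suc i mod n)} \<in> E'"
        using vs that unfolding induced_cycle_def by (auto simp: mod_less_divisor)
      then show ?thesis by (auto simp: E'_def)
    qed
    then have ind: "induced_cycle E vs" using vs unfolding induced_cycle_def E'_def by auto
    then have "odd_girth E \<le> enat n" unfolding odd_girth_def using vs(2) odd_n by (auto intro!: INF_lower2[of vs])
    then have n: "2 * t - 1 \<le> n" using assms(2) order_trans by (metis enat_ord_simps(1))
    have vs1: "\<forall>v\<in>set vs. 1 \<le> a v" using vsW vs(2) by (auto simp: in_set_conv_nth W_def)
    show ?thesis
    proof (cases "2 * k \<le> n")
      case True
      have "a \<in> upset_power (edge_exps E) k"
      proof (rule matching_power)
        show "{vs ! (2 * j), vs ! Suc (2 * j)} \<in> E" if "j < k" for j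
          using ind vs(2) that True unfolding induced_cycle_def by auto
        show "(\<Sum>i<2 * k. unit_vec (vs ! i) w) \<le> a w" for w
        proof -
          have "inj_on (\<lambda>i. vs ! i) {..<2 * k}"
            using ind vs(2) True by (auto simp: induced_cycle_def inj_on_def nth_eq_iff_index_eq)
          then have "(\<Sum>i<2 * k. unit_vec (vs ! i) w) = (if w \<in> (\<lambda>i. vs ! i) ` {..<2 * k} then 1 else 0)"
            by (intro sum_unit_vec_inj) auto
          also have "\<dots> \<le> a w" using vs1 vs(2) True a0[of w] by auto
          finally show ?thesis .
        qed
      qed
      then show ?thesis ..
    next
      case False
      then have "n = 2 * k - 1" using n assms(3,4) odd_n by presburger
      then show ?thesis using ind vs(2) vs1 by blast
    qed
  qed
qed

text \<open>Every edge of the cycle meets a given cover, and every vertex lies on two edges of the cycle,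
  so the cover contains at least half of the \<open>2k - 1\<close> vertices, that is, at least \<open>k\<close>.\<close>

lemma odd_cycle_in_sym_exps:
  fixes E :: "'v::finite set set"
  assumes "induced_cycle E vs" "length vs = 2 * k - 1" "\<And>v. v \<in> set vs \<Longrightarrow> 1 \<le> a v" "0 \<le> a"
  shows "a \<in> sym_exps E k"
proof -
  have "int k \<le> sum a C" if C: "vertex_cover E C" for C
  proof -
    define n where "n = length vs"
    have n3: "3 \<le> n" using assms(1) by (simp add: induced_cycle_def n_def)
    then obtain m where m: "n = Suc m" by (cases n) auto
    define g where "g i = (if vs ! i \<in> C then 1 else 0 :: nat)" for i
    have "n = (\<Sum>i<n. 1)" by simp
    also have "\<dots> \<le> (\<Sum>i<n. g i + g (Suc i mod n))"
    proof (rule sum_mono)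
      fix i assume "i \<in> {..<n}"
      then have "{vs ! i, vs ! (Suc i mod n)} \<in> E"
        using assms(1) n3 unfolding induced_cycle_def n_def[symmetric] by auto
      then show "1 \<le> g i + g (Suc i mod n)" using C by (auto simp: vertex_cover_def g_def)
    qed
    also have "\<dots> = (\<Sum>i<n. g i) + (\<Sum>i<n. g (Suc i mod n))" by (rule sum.distrib)
    also have "(\<Sum>i<n. g (Suc i mod n)) = (\<Sum>i<n. g i)"
    proof -
      have "(\<Sum>i<n. g (Suc i mod n)) = (\<Sum>i<m. g (Suc i)) + g 0" unfolding m by simp
      also have "\<dots> = (\<Sum>i<n. g i)" unfolding m by (simp only: sum.lessThan_Suc_shift add.commute)
      finally show ?thesis .
    qed
    finally have k: "k \<le> (\<Sum>i<n. g i)" using assms(2) n3 by (simp add: n_def)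
    have dist: "inj_on (\<lambda>i. vs ! i) {i. i < n \<and> vs ! i \<in> C}"
      using assms(1) by (auto simp: induced_cycle_def inj_on_def nth_eq_iff_index_eq n_def)
    have "(\<Sum>i<n. g i) = card {i. i < n \<and> vs ! i \<in> C}"
      unfolding g_def by (simp add: sum.If_cases Collect_conj_eq lessThan_def)
    also have "\<dots> = card ((\<lambda>i. vs ! i) ` {i. i < n \<and> vs ! i \<in> C})"
      by (simp add: card_image dist)
    also have "\<dots> \<le> card (set vs \<inter> C)" by (rule card_mono) (auto simp: n_def)
    finally have "int k \<le> int (card (set vs \<inter> C))" using k by simp
    also have "\<dots> = (\<Sum>v\<in>set vs \<inter> C. 1)" by simp
    also have "\<dots> \<le> sum a (set vs \<inter> C)" using assms(3) by (intro sum_mono) auto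
    also have "\<dots> \<le> sum a C" using assms(4) by (intro sum_mono2) (auto simp: le_fun_def)
    finally show ?thesis .
  qed
  then show ?thesis using assms(4) by (simp add: sym_exps_def)
qed

text \<open>The combinatorial heart of the theorem.  If \<open>a + b\<close> contains an odd cycle of length \<open>2k - 1\<close>
  but \<open>a\<close> does not, the second copy of \<open>b\<close> doubles a vertex of the cycle and completes it to \<open>k\<close>
  edges.\<close>

lemma sym_exps_saturation:
  fixes E :: "'v::finite set set"
  assumes "simple_graph E" "enat (2 * t - 1) \<le> odd_girth E" "1 \<le> k" "k \<le> t"
    and "0 \<le> a" "a \<notin> sym_exps E k" "0 \<le> b" "a + b \<in> sym_exps E k"
  shows "a + b + b \<in> upset_power (edge_exps E) k"
  using sym_exps_edge_power_or_odd_cycle[OF assms(1-4,8)]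
proof
  assume "a + b \<in> upset_power (edge_exps E) k"
  then show ?thesis
    using upset_power_upset[OF edge_exps_upset] le_add_vec[OF assms(7)] upset_mono by blast
next
  assume "\<exists>vs. induced_cycle E vs \<and> length vs = 2 * k - 1 \<and> (\<forall>v\<in>set vs. 1 \<le> (a + b) v)"
  then obtain vs where vs: "induced_cycle E vs" "length vs = 2 * k - 1"
    and ab1: "\<And>v. v \<in> set vs \<Longrightarrow> 1 \<le> (a + b) v" by blast
  define n where "n = length vs"
  have n3: "3 \<le> n" using vs by (simp add: induced_cycle_def n_def)
  have n: "n = 2 * k - 1" using vs n_def by simp
  have a0: "0 \<le> a v" and b0: "0 \<le> b v" for v using assms(5,7) by (auto simp: le_fun_def)
  have "\<exists>v\<in>set vs. a v < 1"
  proof (rule ccontr)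
    assume "\<not> ?thesis"
    then show False using odd_cycle_in_sym_exps[OF vs, of a] assms(5,6) by force
  qed
  then obtain v where v: "v \<in> set vs" "1 \<le> b v" using ab1 by fastforce
  then obtain p where p: "p < n" "vs ! p = v" by (auto simp: in_set_conv_nth n_def)
  \<comment> \<open>Walk once around the cycle from \<open>v\<close> to \<open>v\<close>; the \<open>2k\<close> vertices are matched along the walk.\<close>
  define f where "f i = vs ! ((p + i) mod n)" for i
  have step: "{f i, f (Suc i)} \<in> E" for i
  proof -
    have "(p + Suc i) mod n = Suc ((p + i) mod n) mod n" by (simp add: mod_Suc_eq)
    moreover have "(p + i) mod n < n" "(p + Suc i) mod n < n" using n3 by auto
    ultimately show ?thesis using vs(1) unfolding f_def induced_cycle_def n_def[symmetric] by blast
  qed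
  have inj: "inj_on f {..<n}"
  proof (rule inj_onI)
    fix i j assume ij: "i \<in> {..<n}" "j \<in> {..<n}" "f i = f j"
    have "(p + i) mod n < n" "(p + j) mod n < n" using n3 by auto
    then have "(p + i) mod n = (p + j) mod n"
      using ij(3) vs(1) unfolding f_def induced_cycle_def by (simp add: nth_eq_iff_index_eq n_def)
    then show "i = j" using ij(1,2) p(1) by (auto simp: mod_if split: if_splits)
  qed
  show ?thesis
  proof (rule matching_power)
    show "{f (2 * j), f (Suc (2 * j))} \<in> E" for j by (rule step)
    show "(\<Sum>i<2 * k. unit_vec (f i) w) \<le> (a + b + b) w" for w
    proof -
      have "2 * k = Suc n" using n n3 by simp
      then have "(\<Sum>i<2 * k. unit_vec (f i) w) = (\<Sum>i<n. unit_vec (f i) w) + unit_vec (f n) w"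
        by simp
      also have "f n = v" using p by (simp add: f_def)
      also have "(\<Sum>i<n. unit_vec (f i) w) = (if w \<in> f ` {..<n} then 1 else 0)"
        using inj by (intro sum_unit_vec_inj) auto
      also have "\<dots> \<le> (a + b) w"
      proof -
        have "f i \<in> set vs" for i unfolding f_def by (rule nth_mem) (use n3 in \<open>simp add: n_def[symmetric]\<close>)
        then show ?thesis using ab1 a0[of w] b0[of w] by auto
      qed
      also have "unit_vec v w \<le> b w" using v(2) b0[of w] by (simp add: unit_vec_def)
      finally show ?thesis by simp
    qed
  qed
qed

section \<open>Monomial ideals\<close>

definition expo_vec :: "('v \<Rightarrow>\<^sub>0 nat) \<Rightarrow> 'v \<Rightarrow> int" where
  "expo_vec e = (\<lambda>v. int (Poly_Mapping.lookup e v))"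

definition vec_expo :: "('v::finite \<Rightarrow> int) \<Rightarrow> 'v \<Rightarrow>\<^sub>0 nat" where
  "vec_expo a = Abs_poly_mapping (\<lambda>v. nat (a v))"

lemma expo_vec_apply: "expo_vec e v = int (Poly_Mapping.lookup e v)"
  by (simp add: expo_vec_def)

lemma expo_vec_add: "expo_vec (e + f) = expo_vec e + expo_vec f"
  by (simp add: expo_vec_def lookup_add fun_eq_iff)

lemma expo_vec_zero: "expo_vec 0 = 0"
  by (simp add: expo_vec_def fun_eq_iff)

lemma expo_vec_single: "expo_vec (Poly_Mapping.single v 1) = unit_vec v"
  by (simp add: expo_vec_def unit_vec_def fun_eq_iff lookup_single when_def)

lemma expo_vec_nonneg: "0 \<le> expo_vec e"
  by (simp add: expo_vec_def le_fun_def)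

lemma expo_vec_eq_iff: "expo_vec e = expo_vec f \<longleftrightarrow> e = f"
  by (auto simp: expo_vec_def fun_eq_iff intro: poly_mapping_eqI)

lemma expo_vec_vec_expo: "0 \<le> a \<Longrightarrow> expo_vec (vec_expo a) = a"
  by (simp add: expo_vec_def vec_expo_def fun_eq_iff le_fun_def)

lemma vec_expo_expo_vec: "vec_expo (expo_vec e) = e"
  by (simp add: vec_expo_def expo_vec_def lookup_inverse)

lemma exponent_split:
  fixes e f :: "'v::finite \<Rightarrow>\<^sub>0 nat"
  assumes "expo_vec f \<le> expo_vec e"
  obtains b where "e = b + f"
proof
  have "0 \<le> expo_vec e - expo_vec f" using assms by (simp add: le_fun_def)
  then have "expo_vec e = expo_vec (vec_expo (expo_vec e - expo_vec f) + f)"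
    by (simp only: expo_vec_add expo_vec_vec_expo diff_add_cancel)
  then show "e = vec_expo (expo_vec e - expo_vec f) + f"
    by (simp only: expo_vec_eq_iff)
qed

definition mono_ideal :: "('v \<Rightarrow> int) set \<Rightarrow> ('v, 'k::field) mpoly set" where
  "mono_ideal U = {p. \<forall>e\<in>Poly_Mapping.keys p. expo_vec e \<in> U}"

lemma poly_ring_simps [simp]:
  "carrier poly_ring = UNIV" "mult poly_ring = (*)" "one poly_ring = 1"
  "zero poly_ring = 0" "add poly_ring = (+)"
  by (simp_all add: poly_ring_def)

lemma poly_ring_cring: "cring (poly_ring :: ('v, 'k::field) mpoly ring)"
proof (rule cringI)
  show "abelian_group (poly_ring :: ('v, 'k) mpoly ring)"
  proof (rule abelian_groupI)
    fix x :: "('v, 'k) mpoly"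
    show "\<exists>y\<in>carrier poly_ring. y \<oplus>\<^bsub>poly_ring\<^esub> x = \<zero>\<^bsub>poly_ring\<^esub>"
      by (rule bexI[of _ "- x"]) simp_all
  qed (simp_all add: add.assoc add.commute)
  show "Group.comm_monoid (poly_ring :: ('v, 'k) mpoly ring)"
    by (rule comm_monoidI) (simp_all add: mult.assoc mult.commute)
qed (simp add: distrib_right)

lemma poly_mapping_sum_single:
  "(\<Sum>e\<in>Poly_Mapping.keys p. Poly_Mapping.single e (Poly_Mapping.lookup p e)) = p"
  by (rule poly_mapping_eqI) (auto simp: lookup_sum lookup_single when_def in_keys_iff)

lemma ideal_sum_mem:
  assumes "ideal J poly_ring" "\<And>x. x \<in> S \<Longrightarrow> f x \<in> J"
  shows "sum f S \<in> J"
proof -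
  note J = ideal.axioms(1)[OF assms(1)]
  have "0 \<in> J" using additive_subgroup.zero_closed[OF J] by simp
  with assms(2) show ?thesis
  proof (induction S rule: infinite_finite_induct)
    case (insert x S)
    then have "f x \<in> J" "sum f S \<in> J" by auto
    then have "f x \<oplus>\<^bsub>poly_ring\<^esub> sum f S \<in> J" by (rule additive_subgroup.a_closed[OF J])
    then show ?case using insert.hyps by simp
  qed simp_all
qed

lemma mono_ideal_add:
  "p \<in> mono_ideal U \<Longrightarrow> q \<in> mono_ideal U \<Longrightarrow> p + q \<in> mono_ideal U"
  using keys_add[of p q] by (auto simp: mono_ideal_def)

lemma mono_ideal_mult:
  assumes "upset U" "p \<in> mono_ideal U"
  shows "q * p \<in> mono_ideal U"
  unfolding mono_ideal_def mem_Collect_eq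
proof
  fix e assume "e \<in> Poly_Mapping.keys (q * p)"
  then obtain a b where e: "e = a + b" "b \<in> Poly_Mapping.keys p" using keys_mult by blast
  then have "expo_vec b \<in> U" using assms(2) by (simp add: mono_ideal_def)
  moreover have "expo_vec b \<le> expo_vec e"
    by (simp add: e expo_vec_def le_fun_def lookup_add)
  ultimately show "expo_vec e \<in> U" using assms(1) upset_mono by metis
qed

lemma mono_ideal_ideal:
  assumes "upset U"
  shows "ideal (mono_ideal U :: ('v, 'k::field) mpoly set) poly_ring"
proof (rule idealI)
  interpret cring "poly_ring :: ('v, 'k) mpoly ring" by (rule poly_ring_cring)
  show "ring (poly_ring :: ('v, 'k) mpoly ring)" ..
  show "subgroup (mono_ideal U :: ('v, 'k) mpoly set) (add_monoid poly_ring)"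
  proof
    fix x :: "('v, 'k) mpoly" assume x: "x \<in> mono_ideal U"
    have "\<ominus>\<^bsub>poly_ring\<^esub> x = - x" by (rule minus_equality) simp_all
    then have "inv\<^bsub>add_monoid poly_ring\<^esub> x = - x" by (simp only: a_inv_def)
    moreover have "- x \<in> mono_ideal U"
      using x by (simp add: mono_ideal_def in_keys_iff)
    ultimately show "inv\<^bsub>add_monoid poly_ring\<^esub> x \<in> mono_ideal U" by simp
  next
    show "\<one>\<^bsub>add_monoid poly_ring\<^esub> \<in> (mono_ideal U :: ('v, 'k) mpoly set)"
      by (simp add: mono_ideal_def)
  qed (simp_all add: mono_ideal_add)
qed (use assms mono_ideal_mult in \<open>auto simp: mult.commute\<close>)

lemma single_mem_mono_ideal: "expo_vec e \<in> U \<Longrightarrow> Poly_Mapping.single e c \<in> mono_ideal U"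
  by (auto simp: mono_ideal_def)

text \<open>An ideal containing a monomial contains all its scalar multiples, and a polynomial is the sum
  of its terms.\<close>

lemma mono_ideal_subset:
  fixes J :: "('v, 'k::field) mpoly set"
  assumes "ideal J poly_ring" "\<And>e. expo_vec e \<in> U \<Longrightarrow> monomial e \<in> J"
  shows "mono_ideal U \<subseteq> J"
proof
  fix p :: "('v, 'k) mpoly" assume p: "p \<in> mono_ideal U"
  have "Poly_Mapping.single e c \<in> J" if "expo_vec e \<in> U" for e c
  proof -
    have "Poly_Mapping.single 0 c \<otimes>\<^bsub>poly_ring\<^esub> monomial e \<in> J"
      using assms(2)[OF that] by (rule ideal.I_l_closed[OF assms(1)]) simp
    then show ?thesis by (simp add: mult_single)
  qed
  then have "(\<Sum>e\<in>Poly_Mapping.keys p. Poly_Mapping.single e (Poly_Mapping.lookup p e)) \<in> J"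
    using p by (intro ideal_sum_mem[OF assms(1)]) (auto simp: mono_ideal_def)
  then show "p \<in> J" by (simp add: poly_mapping_sum_single)
qed

lemma mono_ideal_prod:
  assumes "upset U" "upset V"
  shows "mono_ideal U \<cdot>\<^bsub>poly_ring\<^esub> mono_ideal V
    = (mono_ideal {a + b | a b. a \<in> U \<and> b \<in> V} :: ('v::finite, 'k::field) mpoly set)"
proof
  interpret cring "poly_ring :: ('v, 'k) mpoly ring" by (rule poly_ring_cring)
  show "mono_ideal U \<cdot>\<^bsub>poly_ring\<^esub> mono_ideal V
    \<subseteq> (mono_ideal {a + b | a b. a \<in> U \<and> b \<in> V} :: ('v, 'k) mpoly set)"
  proof
    fix x :: "('v, 'k) mpoly"
    assume "x \<in> mono_ideal U \<cdot>\<^bsub>poly_ring\<^esub> mono_ideal V"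
    then show "x \<in> mono_ideal {a + b | a b. a \<in> U \<and> b \<in> V}"
    proof (induction rule: ideal_prod.induct)
      case (prod i j)
      have "expo_vec e \<in> {a + b | a b. a \<in> U \<and> b \<in> V}" if e: "e \<in> Poly_Mapping.keys (i * j)" for e
      proof -
        obtain a b where "e = a + b" "a \<in> Poly_Mapping.keys i" "b \<in> Poly_Mapping.keys j"
          using keys_mult[of i j] e by blast
        then show ?thesis using prod by (auto simp: mono_ideal_def expo_vec_add)
      qed
      then show ?case unfolding mono_ideal_def by simp
    next
      case (sum s1 s2)
      then show ?case by (simp add: mono_ideal_add)
    qed
  qed
  show "mono_ideal {a + b | a b. a \<in> U \<and> b \<in> V}
    \<subseteq> (mono_ideal U \<cdot>\<^bsub>poly_ring\<^esub> mono_ideal V :: ('v, 'k) mpoly set)"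
  proof (rule mono_ideal_subset)
    show "ideal (mono_ideal U \<cdot>\<^bsub>poly_ring\<^esub> mono_ideal V :: ('v, 'k) mpoly set) poly_ring"
      using assms by (intro ideal_prod_is_ideal mono_ideal_ideal)
    fix e :: "'v \<Rightarrow>\<^sub>0 nat" assume "expo_vec e \<in> {a + b | a b. a \<in> U \<and> b \<in> V}"
    then obtain a b where ab: "expo_vec e = a + b" "a \<in> U" "b \<in> V" by blast
    have 0: "0 \<le> a" "0 \<le> b" using ab assms upset_nonneg by blast+
    have "expo_vec e = expo_vec (vec_expo a + vec_expo b)"
      by (simp only: ab(1) expo_vec_add expo_vec_vec_expo[OF 0(1)]
          expo_vec_vec_expo[OF 0(2)])
    then have e: "e = vec_expo a + vec_expo b" by (simp only: expo_vec_eq_iff)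
    have "(monomial (vec_expo a) :: ('v, 'k) mpoly) \<otimes>\<^bsub>poly_ring\<^esub> monomial (vec_expo b)
        \<in> mono_ideal U \<cdot>\<^bsub>poly_ring\<^esub> mono_ideal V"
      using ab 0 by (intro ideal_prod.prod single_mem_mono_ideal)
        (simp_all only: expo_vec_vec_expo)
    then show "(monomial e :: ('v, 'k) mpoly) \<in> mono_ideal U \<cdot>\<^bsub>poly_ring\<^esub> mono_ideal V"
      by (simp add: e mult_single)
  qed
qed

lemma mono_ideal_power:
  assumes "upset U"
  shows "ideal_power (mono_ideal U :: ('v::finite, 'k::field) mpoly set) k
    = mono_ideal (upset_power U k)"
  unfolding ideal_power_def
proof (induction k)
  case 0
  then show ?case by (simp add: ideals_set_def mono_ideal_def expo_vec_nonneg)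
next
  case (Suc k)
  then show ?case
    using mono_ideal_prod[OF upset_power_upset[OF assms] assms]
    by (simp add: ideals_set_def)
qed

lemma edge_ideal_eq:
  "(edge_ideal E :: ('v::finite, 'k::field) mpoly set) = mono_ideal (edge_exps E)"
proof
  interpret cring "poly_ring :: ('v, 'k) mpoly ring" by (rule poly_ring_cring)
  let ?G = "{var u * var v | u v. {u, v} \<in> E} :: ('v, 'k) mpoly set"
  have var_mult: "var u * var v
      = (monomial (Poly_Mapping.single u 1 + Poly_Mapping.single v 1) :: ('v, 'k) mpoly)" for u v
    by (simp add: var_def mult_single)
  show "edge_ideal E \<subseteq> (mono_ideal (edge_exps E) :: ('v, 'k) mpoly set)"
    unfolding edge_ideal_def
  proof (rule genideal_minimal)
    show "ideal (mono_ideal (edge_exps E) :: ('v, 'k) mpoly set) poly_ring"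
      by (intro mono_ideal_ideal edge_exps_upset)
    have "expo_vec (Poly_Mapping.single u 1 + Poly_Mapping.single v 1) \<in> edge_exps E"
      if "{u, v} \<in> E" for u v
      using that expo_vec_nonneg[of "Poly_Mapping.single u 1 + Poly_Mapping.single v 1"]
      by (auto simp: edge_exps_def expo_vec_add expo_vec_single[simplified])
    then show "?G \<subseteq> mono_ideal (edge_exps E)"
      unfolding var_mult using single_mem_mono_ideal by blast
  qed
  show "(mono_ideal (edge_exps E) :: ('v, 'k) mpoly set) \<subseteq> edge_ideal E"
  proof (rule mono_ideal_subset)
    show id: "ideal (edge_ideal E :: ('v, 'k) mpoly set) poly_ring"
      unfolding edge_ideal_def by (rule genideal_ideal) simp
    fix e :: "'v \<Rightarrow>\<^sub>0 nat" assume "expo_vec e \<in> edge_exps E"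
    then obtain u v where uv: "{u, v} \<in> E" "unit_vec u + unit_vec v \<le> expo_vec e"
      by (auto simp: edge_exps_def)
    then have "expo_vec (Poly_Mapping.single u 1 + Poly_Mapping.single v 1) \<le> expo_vec e"
      by (simp only: expo_vec_add expo_vec_single)
    then obtain b where e: "e = b + (Poly_Mapping.single u 1 + Poly_Mapping.single v 1)"
      by (rule exponent_split)
    have "var u * var v \<in> (edge_ideal E :: ('v, 'k) mpoly set)"
      unfolding edge_ideal_def using genideal_self[of ?G] uv(1) by auto
    then have "monomial b \<otimes>\<^bsub>poly_ring\<^esub> (var u * var v) \<in> (edge_ideal E :: ('v, 'k) mpoly set)"
      by (rule ideal.I_l_closed[OF id]) simp
    then show "monomial e \<in> (edge_ideal E :: ('v, 'k) mpoly set)"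
      unfolding var_mult by (simp add: e mult_single)
  qed
qed

section \<open>Minimal primes and symbolic powers of edge ideals\<close>

text \<open>The exponent set of the ideal generated by the variables in \<open>C\<close>.\<close>

definition cover_exps :: "'v::finite set \<Rightarrow> ('v \<Rightarrow> int) set" where
  "cover_exps C = {a. 0 \<le> a \<and> 1 \<le> sum a C}"

lemma cover_exps_upset: "upset (cover_exps C)"
proof (rule upsetI)
  fix a b :: "'a \<Rightarrow> int"
  assume a: "a \<in> cover_exps C" and ab: "a \<le> b"
  have "sum a C \<le> sum b C" using ab by (simp add: le_fun_def sum_mono)
  moreover have "0 \<le> b" using a ab order_trans[of 0 a b] by (simp add: cover_exps_def)
  ultimately show "b \<in> cover_exps C" using a by (simp add: cover_exps_def)
qed (simp add: cover_exps_def)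

lemma cover_exps_power: "upset_power (cover_exps C) k = {a. 0 \<le> a \<and> int k \<le> sum a C}"
proof (induction k)
  case 0
  then show ?case by (auto simp: le_fun_def intro: sum_nonneg)
next
  case (Suc k)
  show ?case
  proof (intro subset_antisym subsetI)
    fix c assume "c \<in> upset_power (cover_exps C) (Suc k)"
    then obtain a b where "c = a + b" "0 \<le> a" "int k \<le> sum a C" "0 \<le> b" "1 \<le> sum b C"
      unfolding upset_power.simps Suc unfolding cover_exps_def by blast
    then show "c \<in> {a. 0 \<le> a \<and> int (Suc k) \<le> sum a C}"
      by (simp add: add_nonneg_vec sum.distrib)
  next
    fix c assume "c \<in> {a. 0 \<le> a \<and> int (Suc k) \<le> sum a C}"
    then have c: "0 \<le> c" "int (Suc k) \<le> sum c C" by auto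
    have "\<exists>v\<in>C. c v \<noteq> 0" using c(2) by (intro sum_nonzero_vertex) simp
    then obtain v where v: "v \<in> C" "c v \<noteq> 0" by blast
    have "0 \<le> c v" using c(1) by (simp add: le_fun_def)
    then have cv: "1 \<le> c v" using v(2) by simp
    have "0 \<le> c - unit_vec v" using c(1) cv by (auto simp: le_fun_def unit_vec_def)
    moreover have "int k \<le> sum (c - unit_vec v) C"
      using c(2) sum_unit_vec[of v C] v(1) by (simp add: sum_subtractf)
    ultimately have "c - unit_vec v \<in> upset_power (cover_exps C) k" unfolding Suc by blast
    moreover have "unit_vec v \<in> cover_exps C"
      using v(1) sum_unit_vec[of v C] unit_vec_nonneg by (simp add: cover_exps_def)
    ultimately have "(c - unit_vec v) + unit_vec v \<in> upset_power (cover_exps C) (Suc k)"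
      unfolding upset_power.simps by blast
    then show "c \<in> upset_power (cover_exps C) (Suc k)" by simp
  qed
qed

text \<open>Modulo the ideal, each polynomial equals its part supported on monomials without a variable in
  \<open>C\<close>.  Such polynomials are closed under products, and the polynomial ring is a domain.\<close>

lemma cover_exps_prime:
  "primeideal (mono_ideal (cover_exps C) :: ('v::{finite,linorder}, 'k::field) mpoly set) poly_ring"
proof (rule primeidealI)
  let ?U = "cover_exps C"
  let ?P = "mono_ideal ?U :: ('v, 'k) mpoly set"
  show "ideal ?P poly_ring" by (intro mono_ideal_ideal cover_exps_upset)
  show "cring (poly_ring :: ('v, 'k) mpoly ring)" by (rule poly_ring_cring)
  have "1 \<notin> ?P" by (simp add: mono_ideal_def expo_vec_zero cover_exps_def)
  then show "carrier poly_ring \<noteq> ?P" by auto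
  have split: "\<exists>p1 p2. p = p1 + p2 \<and> p1 \<in> ?P \<and> (\<forall>e\<in>Poly_Mapping.keys p2. expo_vec e \<notin> ?U)"
    for p :: "('v, 'k) mpoly"
  proof -
    let ?s = "\<lambda>e. Poly_Mapping.single e (Poly_Mapping.lookup p e)"
    let ?K = "Poly_Mapping.keys p"
    define p1 where "p1 = (\<Sum>e\<in>{e\<in>?K. expo_vec e \<in> ?U}. ?s e)"
    define p2 where "p2 = (\<Sum>e\<in>{e\<in>?K. expo_vec e \<notin> ?U}. ?s e)"
    have "?K = {e\<in>?K. expo_vec e \<in> ?U} \<union> {e\<in>?K. expo_vec e \<notin> ?U}" by blast
    then have "(\<Sum>e\<in>?K. ?s e)
        = sum ?s ({e\<in>?K. expo_vec e \<in> ?U} \<union> {e\<in>?K. expo_vec e \<notin> ?U})" by simp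
    also have "\<dots> = p1 + p2" unfolding p1_def p2_def by (rule sum.union_disjoint) auto
    finally have "(\<Sum>e\<in>?K. ?s e) = p1 + p2" .
    then have "p = p1 + p2" by (simp only: poly_mapping_sum_single)
    moreover have "p1 \<in> ?P" unfolding p1_def
      by (rule ideal_sum_mem[OF \<open>ideal ?P poly_ring\<close>]) (auto intro: single_mem_mono_ideal)
    moreover have "\<forall>e\<in>Poly_Mapping.keys p2. expo_vec e \<notin> ?U"
    proof
      fix e assume "e \<in> Poly_Mapping.keys p2"
      then have "(\<Sum>f\<in>{e\<in>?K. expo_vec e \<notin> ?U}. Poly_Mapping.lookup (?s f) e) \<noteq> 0"
        by (simp add: p2_def in_keys_iff lookup_sum)
      then obtain f where "f \<in> {e\<in>?K. expo_vec e \<notin> ?U}" "Poly_Mapping.lookup (?s f) e \<noteq> 0"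
        by (rule sum.not_neutral_contains_not_neutral)
      then show "expo_vec e \<notin> ?U" by (auto simp: lookup_single when_def split: if_splits)
    qed
    ultimately show ?thesis by blast
  qed
  fix p q :: "('v, 'k) mpoly"
  assume "p \<otimes>\<^bsub>poly_ring\<^esub> q \<in> ?P"
  then have pq: "p * q \<in> ?P" by simp
  obtain p1 p2 where p: "p = p1 + p2" "p1 \<in> ?P" "\<forall>e\<in>Poly_Mapping.keys p2. expo_vec e \<notin> ?U"
    using split[of p] by blast
  obtain q1 q2 where q: "q = q1 + q2" "q1 \<in> ?P" "\<forall>e\<in>Poly_Mapping.keys q2. expo_vec e \<notin> ?U"
    using split[of q] by blast
  \<comment> \<open>The product \<open>p2 * q2\<close> lies in the ideal but none of its monomials does, so it is zero.\<close>
  have "p2 * q2 = p * q + (- p) * q1 + (- q2) * p1" by (simp add: p(1) q(1) algebra_simps)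
  also have "\<dots> \<in> ?P"
    by (intro mono_ideal_add mono_ideal_mult[OF cover_exps_upset] pq p(2) q(2))
  finally have "p2 * q2 \<in> ?P" .
  moreover have "expo_vec e \<notin> ?U" if e: "e \<in> Poly_Mapping.keys (p2 * q2)" for e
  proof -
    obtain a b where ab: "e = a + b" "a \<in> Poly_Mapping.keys p2" "b \<in> Poly_Mapping.keys q2"
      using keys_mult[of p2 q2] e by blast
    then have "sum (expo_vec a) C < 1" "sum (expo_vec b) C < 1"
      using p(3) q(3) by (auto simp: cover_exps_def expo_vec_nonneg not_le)
    moreover have "sum (expo_vec e) C = sum (expo_vec a) C + sum (expo_vec b) C"
      by (simp add: ab(1) expo_vec_add sum.distrib)
    ultimately have "sum (expo_vec e) C < 1" by linarith
    then show ?thesis by (simp add: cover_exps_def)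
  qed
  ultimately have "Poly_Mapping.keys (p2 * q2) = {}" by (auto simp: mono_ideal_def)
  then have "p2 * q2 = 0" by simp
  then have "p2 = 0 \<or> q2 = 0" by simp
  then show "p \<in> ?P \<or> q \<in> ?P" using p q by auto
qed

lemma var_mem_cover_ideal:
  "(var v :: ('v::finite, 'k::field) mpoly) \<in> mono_ideal (cover_exps C) \<longleftrightarrow> v \<in> C"
  by (simp add: var_def mono_ideal_def expo_vec_single[simplified] cover_exps_def
      unit_vec_nonneg sum_unit_vec)

lemma edge_exps_cover_sum:
  fixes E :: "'v::finite set set"
  assumes "vertex_cover E C" "b \<in> edge_exps E"
  shows "1 \<le> sum b C"
proof -
  obtain u v where uv: "{u, v} \<in> E" "unit_vec u + unit_vec v \<le> b"
    using assms(2) by (auto simp: edge_exps_def)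
  have "1 \<le> sum (unit_vec u + unit_vec v) C"
    using assms(1) uv(1) sum_unit_vec[of u C] sum_unit_vec[of v C]
    by (auto simp: vertex_cover_def sum.distrib)
  also have "\<dots> \<le> sum b C" using uv(2) by (intro sum_mono) (simp add: le_fun_def)
  finally show ?thesis .
qed

lemma edge_power_subset_sym_exps:
  fixes E :: "'v::finite set set"
  shows "upset_power (edge_exps E) k \<subseteq> sym_exps E k"
proof (induction k)
  case 0
  then show ?case by (auto simp: sym_exps_def le_fun_def intro: sum_nonneg)
next
  case (Suc k)
  show ?case
  proof
    fix c assume "c \<in> upset_power (edge_exps E) (Suc k)"
    then obtain a b where c: "c = a + b" "a \<in> upset_power (edge_exps E) k" "b \<in> edge_exps E"
      unfolding upset_power.simps by blast
    have a: "a \<in> sym_exps E k" using Suc c(2) by blast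
    have "int (Suc k) \<le> sum c C" if C: "vertex_cover E C" for C
    proof -
      have "int k \<le> sum a C" using a C by (simp add: sym_exps_def)
      then show ?thesis using edge_exps_cover_sum[OF C c(3)] by (simp add: c(1) sum.distrib)
    qed
    moreover have "0 \<le> c"
      using a c(3) unfolding c(1) sym_exps_def edge_exps_def by (intro add_nonneg_vec) blast+
    ultimately show "c \<in> sym_exps E (Suc k)" unfolding sym_exps_def by blast
  qed
qed

lemma edge_ideal_subset_cover_ideal:
  assumes "vertex_cover E C"
  shows "(edge_ideal E :: ('v::finite, 'k::field) mpoly set) \<subseteq> mono_ideal (cover_exps C)"
proof -
  have "a \<in> cover_exps C" if "a \<in> edge_exps E" for a
    using edge_exps_cover_sum[OF assms that] that by (simp add: cover_exps_def edge_exps_def)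
  then show ?thesis unfolding edge_ideal_eq by (auto simp: mono_ideal_def)
qed

text \<open>A prime containing \<open>var u * var v\<close> contains one of the two factors, so its variables cover the
  edges.\<close>

lemma cover_ideal_subset_prime:
  fixes P :: "('v::finite, 'k::field) mpoly set"
  assumes "primeideal P poly_ring" "edge_ideal E \<subseteq> P"
  shows "vertex_cover E {v. var v \<in> P}" "mono_ideal (cover_exps {v. var v \<in> P}) \<subseteq> P"
proof -
  interpret primeideal P poly_ring by fact
  have "var u * var v \<in> P" if "{u, v} \<in> E" for u v
  proof -
    have "{var u * var v | u v. {u, v} \<in> E} \<subseteq> P"
      using assms(2) genideal_self[of "{var u * var v | u v. {u, v} \<in> E}"]
      unfolding edge_ideal_def by auto
    then show ?thesis using that by blast
  qed
  then show "vertex_cover E {v. var v \<in> P}"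
    using I_prime by (auto simp: vertex_cover_def)
  show "mono_ideal (cover_exps {v. var v \<in> P}) \<subseteq> P"
  proof (rule mono_ideal_subset[OF ideal_axioms])
    fix e :: "'v \<Rightarrow>\<^sub>0 nat" assume "expo_vec e \<in> cover_exps {v. var v \<in> P}"
    then have e: "1 \<le> sum (expo_vec e) {v. var v \<in> P}" by (simp add: cover_exps_def)
    have "\<exists>v\<in>{v. var v \<in> P}. expo_vec e v \<noteq> 0" using e by (rule sum_nonzero_vertex)
    then obtain v where v: "var v \<in> P" "expo_vec e v \<noteq> 0" by auto
    have "expo_vec (Poly_Mapping.single v 1) \<le> expo_vec e"
      using v(2) unfolding expo_vec_single
      by (auto simp: le_fun_def unit_vec_def expo_vec_def)
    then obtain b where "e = b + Poly_Mapping.single v 1" by (rule exponent_split)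
    then have "monomial e = monomial b \<otimes>\<^bsub>poly_ring\<^esub> (var v :: ('v, 'k) mpoly)"
      by (simp add: var_def mult_single)
    moreover have "\<dots> \<in> P" using v(1) by (rule I_l_closed) simp
    ultimately show "monomial e \<in> P" by simp
  qed
qed

lemma minimal_primeD:
  fixes P :: "('v::{finite,linorder}, 'k::field) mpoly set"
  assumes "P \<in> minimal_primes (edge_ideal E)"
  shows "\<exists>C. vertex_cover E C \<and> P = mono_ideal (cover_exps C)"
proof -
  have P: "primeideal P poly_ring" "edge_ideal E \<subseteq> P"
    and min: "\<And>Q. primeideal Q poly_ring \<Longrightarrow> edge_ideal E \<subseteq> Q \<Longrightarrow> Q \<subseteq> P \<Longrightarrow> Q = P"
    using assms by (auto simp: minimal_primes_def)
  let ?C = "{v. var v \<in> P}"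
  have "mono_ideal (cover_exps ?C) = P"
    using cover_ideal_subset_prime[OF P] edge_ideal_subset_cover_ideal
    by (intro min cover_exps_prime) auto
  then show ?thesis using cover_ideal_subset_prime(1)[OF P] by metis
qed

lemma minimal_cover_exists:
  fixes E :: "'v::finite set set"
  assumes "vertex_cover E C"
  shows "\<exists>C'. vertex_cover E C' \<and> C' \<subseteq> C \<and> (\<forall>D. vertex_cover E D \<longrightarrow> D \<subseteq> C' \<longrightarrow> D = C')"
proof -
  have "\<exists>C'\<in>{D. vertex_cover E D}. C' \<subseteq> C \<and> (\<forall>D\<in>{D. vertex_cover E D}. D \<subseteq> C' \<longrightarrow> C' = D)"
    by (rule finite_has_minimal2) (simp_all add: assms)
  then show ?thesis unfolding Bex_def Ball_def mem_Collect_eq by metis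
qed

lemma minimal_coverD:
  fixes E :: "'v::{finite,linorder} set set"
  assumes "vertex_cover E C" "\<And>D. vertex_cover E D \<Longrightarrow> D \<subseteq> C \<Longrightarrow> D = C"
  shows "(mono_ideal (cover_exps C) :: ('v, 'k::field) mpoly set) \<in> minimal_primes (edge_ideal E)"
  unfolding minimal_primes_def mem_Collect_eq
proof (intro conjI allI impI)
  let ?P = "mono_ideal (cover_exps C) :: ('v, 'k) mpoly set"
  show "primeideal ?P poly_ring" by (rule cover_exps_prime)
  show "edge_ideal E \<subseteq> ?P" using assms by (intro edge_ideal_subset_cover_ideal)
  fix Q assume Q: "primeideal Q poly_ring \<and> edge_ideal E \<subseteq> Q \<and> Q \<subseteq> ?P"
  have "{v. var v \<in> Q} \<subseteq> C" using Q var_mem_cover_ideal by blast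
  then have "{v. var v \<in> Q} = C"
    using Q by (intro assms(2) cover_ideal_subset_prime(1)) auto
  moreover have "mono_ideal (cover_exps {v. var v \<in> Q}) \<subseteq> Q"
    using Q by (intro cover_ideal_subset_prime(2)[of Q E]) auto
  ultimately show "Q = ?P" using Q by auto
qed

text \<open>Intersecting over the minimal covers or over all covers makes no difference, because weights are
  nonnegative.\<close>

lemma symbolic_power_edge_ideal:
  fixes E :: "'v::{finite,linorder} set set"
  shows "symbolic_power (edge_ideal E :: ('v, 'k::field) mpoly set) k = mono_ideal (sym_exps E k)"
proof (intro subset_antisym subsetI)
  fix p :: "('v, 'k) mpoly"
  assume p: "p \<in> symbolic_power (edge_ideal E) k"
  have "expo_vec e \<in> sym_exps E k" if e: "e \<in> Poly_Mapping.keys p" for e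
  proof -
    have "int k \<le> sum (expo_vec e) C" if "vertex_cover E C" for C
    proof -
      obtain C' where C': "vertex_cover E C'" "C' \<subseteq> C" "\<And>D. vertex_cover E D \<Longrightarrow> D \<subseteq> C' \<Longrightarrow> D = C'"
        using minimal_cover_exists[OF \<open>vertex_cover E C\<close>] by blast
      have "p \<in> ideal_power (mono_ideal (cover_exps C')) k"
        using p minimal_coverD[OF C'(1,3)] unfolding symbolic_power_def by blast
      then have "int k \<le> sum (expo_vec e) C'"
        using e unfolding mono_ideal_power[OF cover_exps_upset] cover_exps_power
        by (auto simp: mono_ideal_def)
      also have "\<dots> \<le> sum (expo_vec e) C"
        using C'(2) by (intro sum_mono2) (auto simp: expo_vec_def)
      finally show ?thesis .
    qed
    then show ?thesis by (simp add: sym_exps_def expo_vec_nonneg)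
  qed
  then show "p \<in> mono_ideal (sym_exps E k)" by (simp add: mono_ideal_def)
next
  fix p :: "('v, 'k) mpoly"
  assume p: "p \<in> mono_ideal (sym_exps E k)"
  have "p \<in> ideal_power P k" if P: "P \<in> minimal_primes (edge_ideal E)" for P
  proof -
    obtain C where C: "vertex_cover E C" "P = mono_ideal (cover_exps C)"
      using minimal_primeD[OF P] by blast
    show ?thesis
      using p C(1) unfolding C(2) mono_ideal_power[OF cover_exps_upset] cover_exps_power
      by (auto simp: mono_ideal_def sym_exps_def)
  qed
  then show "p \<in> symbolic_power (edge_ideal E) k" by (simp add: symbolic_power_def)
qed

section \<open>Localizations of monomial subquotients in Laurent coordinates\<close>

definition vecs_on :: "'v set \<Rightarrow> ('v \<Rightarrow> int) set" where
  "vecs_on \<sigma> = {g. 0 \<le> g \<and> (\<forall>v. v \<notin> \<sigma> \<longrightarrow> g v = 0)}"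

lemma vecs_on_zero: "0 \<in> vecs_on \<sigma>"
  by (simp add: vecs_on_def)

lemma vecs_on_add: "g \<in> vecs_on \<sigma> \<Longrightarrow> h \<in> vecs_on \<sigma> \<Longrightarrow> g + h \<in> vecs_on \<sigma>"
  by (simp add: vecs_on_def add_nonneg_vec)

lemma vecs_on_mono: "\<sigma> \<subseteq> \<tau> \<Longrightarrow> g \<in> vecs_on \<sigma> \<Longrightarrow> g \<in> vecs_on \<tau>"
  by (auto simp: vecs_on_def)

lemma vecs_on_nonneg: "g \<in> vecs_on \<sigma> \<Longrightarrow> 0 \<le> g"
  by (simp add: vecs_on_def)

text \<open>Conditions that hold for all sufficiently large shifts along \<open>\<sigma>\<close> hold simultaneously for
  finitely many exponents: add up the shifts.\<close>

lemma uniform_shift: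
  assumes "finite S" "\<And>b. b \<in> S \<Longrightarrow> \<exists>g\<in>vecs_on \<sigma>. \<forall>h\<in>vecs_on \<sigma>. Q b (g + h)"
  shows "\<exists>g\<in>vecs_on \<sigma>. \<forall>b\<in>S. \<forall>h\<in>vecs_on \<sigma>. Q b (g + h)"
  using assms
proof (induction S rule: finite_induct)
  case empty
  then show ?case using vecs_on_zero by blast
next
  case (insert x S)
  obtain g1 where g1: "g1 \<in> vecs_on \<sigma>" "\<forall>h\<in>vecs_on \<sigma>. Q x (g1 + h)"
    using insert.prems[of x] by blast
  obtain g2 where g2: "g2 \<in> vecs_on \<sigma>" "\<forall>b\<in>S. \<forall>h\<in>vecs_on \<sigma>. Q b (g2 + h)"
    using insert.IH insert.prems by blast
  show ?case
  proof (intro bexI ballI)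
    show "g1 + g2 \<in> vecs_on \<sigma>" using g1 g2 by (intro vecs_on_add)
    fix b h assume b: "b \<in> insert x S" and h: "h \<in> vecs_on \<sigma>"
    have "Q x (g1 + (g2 + h))" using g1(2) vecs_on_add[OF g2(1) h] by blast
    moreover have "Q b (g2 + (g1 + h))" if "b \<in> S" using g2(2) that vecs_on_add[OF g1(1) h] by blast
    ultimately show "Q b (g1 + g2 + h)" using b by (auto simp: add.assoc add.left_commute)
  qed
qed

text \<open>For a subquotient of the polynomial ring with monomial basis \<open>T\<close>, these are the Laurent
  exponents \<open>a\<close> for which \<open>x\<^sup>a\<close> is nonzero in the localization at the variables in \<open>\<sigma>\<close>: all large
  multiples of \<open>x\<^sup>a\<close> by monomials in these variables have to be basis elements.\<close>

definition loc_exps :: "('v \<Rightarrow> int) set \<Rightarrow> 'v set \<Rightarrow> ('v \<Rightarrow> int) set" where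
  "loc_exps T \<sigma> = {a. \<exists>g\<in>vecs_on \<sigma>. \<forall>h\<in>vecs_on \<sigma>. a + (g + h) \<in> T}"

definition finite_fns :: "('v \<Rightarrow> int) set \<Rightarrow> (('v \<Rightarrow> int) \<Rightarrow> 'k::field) set" where
  "finite_fns T = {f. finite {a. f a \<noteq> 0} \<and> (\<forall>a. f a \<noteq> 0 \<longrightarrow> a \<in> T)}"

lemma finite_fnsI: "finite {a. f a \<noteq> 0} \<Longrightarrow> (\<And>a. f a \<noteq> 0 \<Longrightarrow> a \<in> T) \<Longrightarrow> f \<in> finite_fns T"
  by (simp add: finite_fns_def)

lemma finite_fns_finite: "f \<in> finite_fns T \<Longrightarrow> finite {a. f a \<noteq> 0}"
  and finite_fns_supp: "f \<in> finite_fns T \<Longrightarrow> f a \<noteq> 0 \<Longrightarrow> a \<in> T"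
  by (simp_all add: finite_fns_def)

lemma finite_fns_zero: "(\<lambda>a. 0) \<in> finite_fns T"
  by (simp add: finite_fns_def)

lemma finite_fns_add:
  assumes "f \<in> finite_fns T" "g \<in> finite_fns T"
  shows "(\<lambda>a. f a + g a) \<in> finite_fns T"
proof (rule finite_fnsI)
  have "{a. f a + g a \<noteq> 0} \<subseteq> {a. f a \<noteq> 0} \<union> {a. g a \<noteq> 0}" by auto
  then show "finite {a. f a + g a \<noteq> 0}"
    by (rule finite_subset) (use assms finite_fns_finite in blast)
  show "a \<in> T" if "f a + g a \<noteq> 0" for a
  proof -
    have "f a \<noteq> 0 \<or> g a \<noteq> 0" using that by auto
    then show ?thesis using finite_fns_supp[OF assms(1)] finite_fns_supp[OF assms(2)] by blast
  qed
qed

lemma finite_fns_mult: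
  assumes "f \<in> finite_fns T"
  shows "(\<lambda>a. c * f a) \<in> finite_fns T"
proof (rule finite_fnsI)
  have "{a. c * f a \<noteq> 0} \<subseteq> {a. f a \<noteq> 0}" by auto
  then show "finite {a. c * f a \<noteq> 0}" using finite_fns_finite[OF assms] by (rule finite_subset)
qed (use assms finite_fns_supp in auto)

lemma finite_fns_restrict:
  assumes "f \<in> finite_fns T"
  shows "(\<lambda>a. if a \<in> T' then f a else 0) \<in> finite_fns T'"
proof (rule finite_fnsI)
  have "{a. (if a \<in> T' then f a else 0) \<noteq> 0} \<subseteq> {a. f a \<noteq> 0}" by auto
  then show "finite {a. (if a \<in> T' then f a else 0) \<noteq> 0}"
    using finite_fns_finite[OF assms] by (rule finite_subset)
qed (auto split: if_splits)

lemma finite_fns_sum: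
  assumes "\<And>j. j \<in> A \<Longrightarrow> F j \<in> finite_fns T"
  shows "(\<lambda>a. \<Sum>j\<in>A. F j a) \<in> finite_fns T"
  using assms
proof (induction A rule: infinite_finite_induct)
  case (insert x A)
  then have "(\<lambda>a. F x a + (\<Sum>j\<in>A. F j a)) \<in> finite_fns T" by (intro finite_fns_add) auto
  then show ?case using insert.hyps by simp
qed (simp_all add: finite_fns_zero)

text \<open>Defined by description because denominators are given as polynomials; only its values on
  monomials matter.\<close>

definition mono_vec :: "('v, 'k::field) mpoly \<Rightarrow> 'v \<Rightarrow> int" where
  "mono_vec s = expo_vec (THE e. s = monomial e)"

lemma mono_vec_monomial [simp]: "mono_vec (monomial e :: ('v, 'k::field) mpoly) = expo_vec e"
proof -
  have "monomial e = (monomial e' :: ('v, 'k) mpoly) \<longleftrightarrow> e = e'" for e'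
    by (metis keys_single one_neq_zero singleton_inject)
  then show ?thesis by (simp add: mono_vec_def)
qed

lemma one_mem_monomials_on: "1 \<in> monomials_on \<sigma>"
proof -
  have "monomial 0 \<in> monomials_on \<sigma>" unfolding monomials_on_def by (simp) (rule exI[of _ 0], simp)
  then show ?thesis by simp
qed

lemma monomials_onE:
  assumes "s \<in> monomials_on \<sigma>"
  obtains e where "s = monomial e" "mono_vec s = expo_vec e" "expo_vec e \<in> vecs_on \<sigma>"
proof -
  obtain e where e: "s = monomial e" "Poly_Mapping.keys e \<subseteq> \<sigma>"
    using assms by (auto simp: monomials_on_def)
  then have "expo_vec e \<in> vecs_on \<sigma>"
    by (auto simp: vecs_on_def expo_vec_nonneg expo_vec_apply in_keys_iff)
  then show ?thesis using that[of e] e by simp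
qed

lemma mono_vec_on: "s \<in> monomials_on \<sigma> \<Longrightarrow> mono_vec s \<in> vecs_on \<sigma>"
  by (erule monomials_onE) simp

lemma monomials_on_mult:
  assumes "s \<in> monomials_on \<sigma>" "s' \<in> monomials_on \<sigma>"
  shows "s * s' \<in> monomials_on \<sigma>" "mono_vec (s * s') = mono_vec s + mono_vec s'"
proof -
  obtain e e' where e: "s = monomial e" "Poly_Mapping.keys e \<subseteq> \<sigma>"
    and e': "s' = monomial e'" "Poly_Mapping.keys e' \<subseteq> \<sigma>"
    using assms by (auto simp: monomials_on_def)
  have mult: "s * s' = monomial (e + e')" by (simp add: e e' mult_single)
  moreover have "Poly_Mapping.keys (e + e') \<subseteq> \<sigma>" using keys_add[of e e'] e e' by blast
  ultimately show "s * s' \<in> monomials_on \<sigma>" unfolding monomials_on_def by blast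
  show "mono_vec (s * s') = mono_vec s + mono_vec s'"
    unfolding mult by (simp add: e e' expo_vec_add)
qed

lemma mono_vec_expo:
  assumes "g \<in> vecs_on \<sigma>"
  shows "monomial (vec_expo g) \<in> monomials_on \<sigma>" "expo_vec (vec_expo g) = g"
proof -
  show g: "expo_vec (vec_expo g) = g"
    using assms by (intro expo_vec_vec_expo vecs_on_nonneg)
  have "Poly_Mapping.keys (vec_expo g) \<subseteq> \<sigma>"
  proof
    fix v assume "v \<in> Poly_Mapping.keys (vec_expo g)"
    then have "expo_vec (vec_expo g) v \<noteq> 0" by (simp add: expo_vec_apply in_keys_iff)
    then show "v \<in> \<sigma>" using assms g by (auto simp: vecs_on_def)
  qed
  then show "monomial (vec_expo g) \<in> monomials_on \<sigma>" unfolding monomials_on_def by blast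
qed

lemma monomials_on_mono: "\<sigma> \<subseteq> \<tau> \<Longrightarrow> monomials_on \<sigma> \<subseteq> monomials_on \<tau>"
  unfolding monomials_on_def by blast

text \<open>A module with basis \<open>{x\<^sup>a | a \<in> T}\<close> on which a monomial acts by shifting exponents, the result
  being zero when it leaves \<open>T\<close>.  The map \<open>rep\<close> reads off coordinates.  Convexity of \<open>T\<close> makes
  this an action; it holds for the exponents of a monomial ideal and for those of the quotient by
  it, and the locale treats both at once.  Only multiplication by terms is recorded, since the
  Cech complex uses no other multiplication.\<close>

locale monomial_module =
  fixes M :: "(('v::{finite,linorder}, 'k::field) mpoly, 'm) module"
    and T :: "('v \<Rightarrow> int) set"
    and rep :: "'m \<Rightarrow> ('v \<Rightarrow> int) \<Rightarrow> 'k"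
  assumes T_convex: "a \<in> T \<Longrightarrow> c \<in> T \<Longrightarrow> a \<le> b \<Longrightarrow> b \<le> c \<Longrightarrow> b \<in> T"
    and rep_bij: "bij_betw rep (carrier M) (finite_fns T)"
    and zero_closed: "\<zero>\<^bsub>M\<^esub> \<in> carrier M"
    and rep_zero: "rep \<zero>\<^bsub>M\<^esub> a = 0"
    and add_closed: "x \<in> carrier M \<Longrightarrow> y \<in> carrier M \<Longrightarrow> x \<oplus>\<^bsub>M\<^esub> y \<in> carrier M"
    and rep_add: "x \<in> carrier M \<Longrightarrow> y \<in> carrier M \<Longrightarrow> rep (x \<oplus>\<^bsub>M\<^esub> y) a = rep x a + rep y a"
    and smult_closed: "x \<in> carrier M \<Longrightarrow> Poly_Mapping.single e r \<odot>\<^bsub>M\<^esub> x \<in> carrier M"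
    and rep_smult: "x \<in> carrier M \<Longrightarrow>
      rep (Poly_Mapping.single e r \<odot>\<^bsub>M\<^esub> x) a = (if a \<in> T then r * rep x (a - expo_vec e) else 0)"
begin

lemma rep_fns: "x \<in> carrier M \<Longrightarrow> rep x \<in> finite_fns T"
  using rep_bij by (auto simp: bij_betw_def)

lemma rep_inj: "x \<in> carrier M \<Longrightarrow> y \<in> carrier M \<Longrightarrow> rep x = rep y \<Longrightarrow> x = y"
  using rep_bij by (auto simp: bij_betw_def inj_on_def)

lemma rep_supp: "x \<in> carrier M \<Longrightarrow> rep x a \<noteq> 0 \<Longrightarrow> a \<in> T"
  using rep_fns finite_fns_supp by blast

lemma monomial_smult_closed: "x \<in> carrier M \<Longrightarrow> s \<in> monomials_on \<sigma> \<Longrightarrow> s \<odot>\<^bsub>M\<^esub> x \<in> carrier M"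
  by (auto simp: monomials_on_def smult_closed)

lemma rep_monomial_smult:
  assumes "x \<in> carrier M" "s \<in> monomials_on \<sigma>"
  shows "rep (s \<odot>\<^bsub>M\<^esub> x) a = (if a \<in> T then rep x (a - mono_vec s) else 0)"
  using assms(2) by (rule monomials_onE) (simp add: rep_smult[OF assms(1)])

lemma rep_monomial_smult2:
  assumes "x \<in> carrier M" "s \<in> monomials_on \<sigma>" "u \<in> monomials_on \<sigma>"
  shows "rep (u \<odot>\<^bsub>M\<^esub> (s \<odot>\<^bsub>M\<^esub> x)) c
    = (if c \<in> T then rep x (c - mono_vec u - mono_vec s) else 0)"
proof -
  have "c - mono_vec u \<in> T" if "c \<in> T" "rep x (c - mono_vec u - mono_vec s) \<noteq> 0"
  proof (rule T_convex)
    show "c - mono_vec u - mono_vec s \<in> T" using rep_supp[OF assms(1) that(2)] .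
    have "0 \<le> mono_vec u" "0 \<le> mono_vec s"
      using assms(2,3) mono_vec_on vecs_on_nonneg by blast+
    then show "c - mono_vec u - mono_vec s \<le> c - mono_vec u" "c - mono_vec u \<le> c"
      by (simp_all add: le_fun_def)
  qed (rule that(1))
  then show ?thesis
    using rep_monomial_smult[OF monomial_smult_closed[OF assms(1,2)] assms(3)]
      rep_monomial_smult[OF assms(1,2)] by auto
qed

abbreviation Tloc :: "'v set \<Rightarrow> ('v \<Rightarrow> int) set" where
  "Tloc \<sigma> \<equiv> loc_exps T \<sigma>"

text \<open>The Laurent coordinates of the fraction \<open>m/s\<close>.  The coefficients at exponents outside
  \<open>Tloc \<sigma>\<close> are killed by a power of the inverted variables.\<close>

definition frac_coeff :: "'v set \<Rightarrow> 'm \<times> ('v, 'k) mpoly \<Rightarrow> ('v \<Rightarrow> int) \<Rightarrow> 'k" where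
  "frac_coeff \<sigma> = (\<lambda>(m, s) a. if a \<in> Tloc \<sigma> then rep m (a + mono_vec s) else 0)"

lemma frac_coeff_apply: "frac_coeff \<sigma> (m, s) a = (if a \<in> Tloc \<sigma> then rep m (a + mono_vec s) else 0)"
  by (simp add: frac_coeff_def)

text \<open>The next two facts say that a single exponent \<open>b = a + e\<close> in \<open>T\<close> decides whether \<open>a\<close> survives
  in the localization: by convexity either all further shifts of \<open>b\<close> stay in \<open>T\<close>, or all large
  ones have left it.\<close>

lemma TlocD:
  assumes "a \<in> Tloc \<sigma>" "b \<in> T" "e \<in> vecs_on \<sigma>" "b = a + e" "h \<in> vecs_on \<sigma>"
  shows "b + h \<in> T"
proof -
  obtain g where g: "g \<in> vecs_on \<sigma>" "\<forall>h\<in>vecs_on \<sigma>. a + (g + h) \<in> T"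
    using assms(1) by (auto simp: loc_exps_def)
  have "a + (g + (e + h)) \<in> T" using g vecs_on_add assms(3,5) by blast
  moreover have "b \<le> b + h" using assms(5) le_add_vec vecs_on_nonneg by blast
  moreover have "b + h \<le> a + (g + (e + h))"
    using vecs_on_nonneg[OF g(1)] assms(4) by (simp add: le_fun_def)
  ultimately show ?thesis using assms(2) T_convex by metis
qed

lemma Tloc_converse:
  assumes "a \<notin> Tloc \<sigma>" "b \<in> T" "e \<in> vecs_on \<sigma>" "b = a + e"
  shows "\<exists>g\<in>vecs_on \<sigma>. \<forall>h\<in>vecs_on \<sigma>. b + (g + h) \<notin> T"
proof -
  obtain g where g: "g \<in> vecs_on \<sigma>" "b + g \<notin> T"
    using assms by (auto simp: loc_exps_def add.assoc)
  have "b + (g + h) \<notin> T" if h: "h \<in> vecs_on \<sigma>" for h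
  proof
    assume "b + (g + h) \<in> T"
    moreover have "b \<le> b + g" using g(1) le_add_vec vecs_on_nonneg by blast
    moreover have "b + g \<le> b + (g + h)" using vecs_on_nonneg[OF h] by (simp add: le_fun_def)
    ultimately show False using g(2) assms(2) T_convex by metis
  qed
  then show ?thesis using g(1) by blast
qed

text \<open>Two fractions are equal if and only if their Laurent coordinates agree.  For the converse
  direction, the multiplier \<open>u\<close> is chosen so large that it kills the finitely many terms of both
  numerators that vanish in the localization.\<close>

lemma frac_rel_eq_coeff:
  assumes "m \<in> carrier M" "m' \<in> carrier M" "s \<in> monomials_on \<sigma>" "s' \<in> monomials_on \<sigma>"
  shows "((m, s), (m', s')) \<in> frac_rel M (monomials_on \<sigma>)
    \<longleftrightarrow> frac_coeff \<sigma> (m, s) = frac_coeff \<sigma> (m', s')"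
proof
  let ?e = "mono_vec s" and ?e' = "mono_vec s'"
  note e = mono_vec_on[OF assms(3)] and e' = mono_vec_on[OF assms(4)]
  assume "((m, s), (m', s')) \<in> frac_rel M (monomials_on \<sigma>)"
  then obtain u where u: "u \<in> monomials_on \<sigma>"
    and eq: "u \<odot>\<^bsub>M\<^esub> (s' \<odot>\<^bsub>M\<^esub> m) = u \<odot>\<^bsub>M\<^esub> (s \<odot>\<^bsub>M\<^esub> m')"
    by (auto simp: frac_rel_def)
  let ?g = "mono_vec u"
  note g = mono_vec_on[OF u]
  have "rep m (a + ?e) = rep m' (a + ?e')" if a: "a \<in> Tloc \<sigma>" for a
  proof (cases "rep m (a + ?e) \<noteq> 0 \<or> rep m' (a + ?e') \<noteq> 0")
    case True
    define c where "c = a + ?g + ?e + ?e'"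
    have c1: "c = (a + ?e) + (?g + ?e')" and c2: "c = (a + ?e') + (?g + ?e)"
      by (simp_all add: c_def algebra_simps)
    have "c \<in> T"
      using True
    proof
      assume "rep m (a + ?e) \<noteq> 0"
      then have "a + ?e \<in> T" using rep_supp assms(1) by blast
      then show ?thesis unfolding c1 by (rule TlocD[OF a _ e refl vecs_on_add[OF g e']])
    next
      assume "rep m' (a + ?e') \<noteq> 0"
      then have "a + ?e' \<in> T" using rep_supp assms(2) by blast
      then show ?thesis unfolding c2 by (rule TlocD[OF a _ e' refl vecs_on_add[OF g e]])
    qed
    then have "rep m (c - ?g - ?e') = rep m' (c - ?g - ?e)"
      using rep_monomial_smult2[OF assms(1,4) u, of c] rep_monomial_smult2[OF assms(2,3) u, of c] eq
      by simp
    moreover have "c - ?g - ?e' = a + ?e" "c - ?g - ?e = a + ?e'" by (simp_all add: c_def)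
    ultimately show ?thesis by simp
  qed simp
  then show "frac_coeff \<sigma> (m, s) = frac_coeff \<sigma> (m', s')"
    by (auto simp: frac_coeff_apply fun_eq_iff)
next
  let ?e = "mono_vec s" and ?e' = "mono_vec s'"
  note e = mono_vec_on[OF assms(3)] and e' = mono_vec_on[OF assms(4)]
  assume eq: "frac_coeff \<sigma> (m, s) = frac_coeff \<sigma> (m', s')"
  have shift: "\<exists>g\<in>vecs_on \<sigma>. \<forall>b\<in>{b. rep x b \<noteq> 0}. \<forall>h\<in>vecs_on \<sigma>.
      b - mono_vec r \<notin> Tloc \<sigma> \<longrightarrow> b + (g + h) \<notin> T"
    if "x \<in> carrier M" "r \<in> monomials_on \<sigma>" for x r
  proof (rule uniform_shift)
    show "finite {b. rep x b \<noteq> 0}" using rep_fns[OF that(1)] finite_fns_finite by blast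
    fix b assume "b \<in> {b. rep x b \<noteq> 0}"
    then have "b \<in> T" using rep_supp[OF that(1)] by simp
    then show "\<exists>g\<in>vecs_on \<sigma>. \<forall>h\<in>vecs_on \<sigma>. b - mono_vec r \<notin> Tloc \<sigma> \<longrightarrow> b + (g + h) \<notin> T"
      using Tloc_converse[of "b - mono_vec r" \<sigma> b "mono_vec r"] mono_vec_on[OF that(2)]
        vecs_on_zero by (cases "b - mono_vec r \<in> Tloc \<sigma>") auto
  qed
  obtain g1 where g1: "g1 \<in> vecs_on \<sigma>" "\<And>b h. rep m b \<noteq> 0 \<Longrightarrow> h \<in> vecs_on \<sigma> \<Longrightarrow>
      b - ?e \<notin> Tloc \<sigma> \<Longrightarrow> b + (g1 + h) \<notin> T" using shift[OF assms(1,3)] by blast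
  obtain g2 where g2: "g2 \<in> vecs_on \<sigma>" "\<And>b h. rep m' b \<noteq> 0 \<Longrightarrow> h \<in> vecs_on \<sigma> \<Longrightarrow>
      b - ?e' \<notin> Tloc \<sigma> \<Longrightarrow> b + (g2 + h) \<notin> T" using shift[OF assms(2,4)] by blast
  define g where "g = g1 + g2"
  have g: "g \<in> vecs_on \<sigma>" unfolding g_def using g1(1) g2(1) by (rule vecs_on_add)
  define u where "u = (monomial (vec_expo g) :: ('v, 'k) mpoly)"
  have u: "u \<in> monomials_on \<sigma>" "mono_vec u = g"
    unfolding u_def using mono_vec_expo[OF g] by simp_all
  have "u \<odot>\<^bsub>M\<^esub> (s' \<odot>\<^bsub>M\<^esub> m) = u \<odot>\<^bsub>M\<^esub> (s \<odot>\<^bsub>M\<^esub> m')"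
  proof (rule rep_inj)
    show "u \<odot>\<^bsub>M\<^esub> (s' \<odot>\<^bsub>M\<^esub> m) \<in> carrier M" "u \<odot>\<^bsub>M\<^esub> (s \<odot>\<^bsub>M\<^esub> m') \<in> carrier M"
      using assms u(1) monomial_smult_closed by blast+
    have "rep m (c - g - ?e') = rep m' (c - g - ?e)" if c: "c \<in> T" for c
    proof (cases "rep m (c - g - ?e') \<noteq> 0 \<or> rep m' (c - g - ?e) \<noteq> 0")
      case True
      define a where "a = c - g - ?e' - ?e"
      have a: "a + ?e = c - g - ?e'" "a + ?e' = c - g - ?e" by (simp_all add: a_def algebra_simps)
      have "a \<in> Tloc \<sigma>"
        using True
      proof
        assume "rep m (c - g - ?e') \<noteq> 0"
        then have m: "rep m (a + ?e) \<noteq> 0" using a by simp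
        have "(a + ?e) + (g1 + (g2 + ?e')) = c" by (simp add: a_def g_def algebra_simps)
        then show ?thesis using g1(2)[OF m vecs_on_add[OF g2(1) e']] c by auto
      next
        assume "rep m' (c - g - ?e) \<noteq> 0"
        then have m: "rep m' (a + ?e') \<noteq> 0" using a by simp
        have "(a + ?e') + (g2 + (g1 + ?e)) = c" by (simp add: a_def g_def algebra_simps)
        then show ?thesis using g2(2)[OF m vecs_on_add[OF g1(1) e]] c by auto
      qed
      then show ?thesis using fun_cong[OF eq, of a] a by (simp add: frac_coeff_apply)
    qed simp
    then show "rep (u \<odot>\<^bsub>M\<^esub> (s' \<odot>\<^bsub>M\<^esub> m)) = rep (u \<odot>\<^bsub>M\<^esub> (s \<odot>\<^bsub>M\<^esub> m'))"
      unfolding fun_eq_iff rep_monomial_smult2[OF assms(1,4) u(1)]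
        rep_monomial_smult2[OF assms(2,3) u(1)] u(2) by simp
  qed
  then show "((m, s), (m', s')) \<in> frac_rel M (monomials_on \<sigma>)"
    using assms u(1) by (auto simp: frac_rel_def)
qed

text \<open>The element of the localization with Laurent coordinates \<open>f\<close>, as the set of all fractions
  that represent it.  All operations on localizations are translated into operations on \<open>f\<close>.\<close>

definition frac_class :: "'v set \<Rightarrow> (('v \<Rightarrow> int) \<Rightarrow> 'k) \<Rightarrow> ('m \<times> ('v, 'k) mpoly) set" where
  "frac_class \<sigma> f = {x \<in> carrier M \<times> monomials_on \<sigma>. frac_coeff \<sigma> x = f}"

lemma fraction_eq:
  assumes "m \<in> carrier M" "s \<in> monomials_on \<sigma>"
  shows "fraction M (monomials_on \<sigma>) m s = frac_class \<sigma> (frac_coeff \<sigma> (m, s))"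
proof -
  have "(x, y) \<in> fraction M (monomials_on \<sigma>) m s
      \<longleftrightarrow> (x, y) \<in> frac_class \<sigma> (frac_coeff \<sigma> (m, s))" for x y
  proof (cases "x \<in> carrier M \<and> y \<in> monomials_on \<sigma>")
    case True
    then show ?thesis
      using frac_rel_eq_coeff[of m x s \<sigma> y] assms by (auto simp: fraction_def frac_class_def)
  next
    case False
    then show ?thesis by (auto simp: fraction_def frac_class_def frac_rel_def)
  qed
  then show ?thesis by auto
qed

lemma frac_coeff_fns:
  assumes "m \<in> carrier M" "s \<in> monomials_on \<sigma>"
  shows "frac_coeff \<sigma> (m, s) \<in> finite_fns (Tloc \<sigma>)"
proof (rule finite_fnsI)
  have "{a. frac_coeff \<sigma> (m, s) a \<noteq> 0} \<subseteq> (\<lambda>b. b - mono_vec s) ` {b. rep m b \<noteq> 0}"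
  proof
    fix a assume "a \<in> {a. frac_coeff \<sigma> (m, s) a \<noteq> 0}"
    then have "rep m (a + mono_vec s) \<noteq> 0" by (auto simp: frac_coeff_apply split: if_splits)
    moreover have "a = (a + mono_vec s) - mono_vec s" by simp
    ultimately show "a \<in> (\<lambda>b. b - mono_vec s) ` {b. rep m b \<noteq> 0}" by blast
  qed
  then show "finite {a. frac_coeff \<sigma> (m, s) a \<noteq> 0}"
    using finite_fns_finite[OF rep_fns[OF assms(1)]] finite_surj by blast
qed (auto simp: frac_coeff_apply split: if_splits)

text \<open>Every finitely supported function on \<open>Tloc \<sigma>\<close> arises from a fraction with a monomial
  denominator: clear denominators with a common large shift \<open>g\<close>.  The explicit numerator shows that
  homogeneous functions come from homogeneous numerators.\<close>

lemma finite_fns_frac_coeff: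
  assumes "f \<in> finite_fns (Tloc \<sigma>)"
  shows "\<exists>m\<in>carrier M. \<exists>e. Poly_Mapping.keys e \<subseteq> \<sigma> \<and> frac_coeff \<sigma> (m, monomial e) = f
    \<and> (\<forall>b. rep m b = f (b - expo_vec e))"
proof -
  have "\<exists>g\<in>vecs_on \<sigma>. \<forall>a\<in>{a. f a \<noteq> 0}. \<forall>h\<in>vecs_on \<sigma>. a + (g + h) \<in> T"
  proof (rule uniform_shift)
    show "finite {a. f a \<noteq> 0}" using assms by (rule finite_fns_finite)
    fix b assume "b \<in> {a. f a \<noteq> 0}"
    then have "b \<in> Tloc \<sigma>" using assms finite_fns_supp by auto
    then show "\<exists>g\<in>vecs_on \<sigma>. \<forall>h\<in>vecs_on \<sigma>. b + (g + h) \<in> T" by (simp add: loc_exps_def)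
  qed
  then obtain g where g: "g \<in> vecs_on \<sigma>" "\<And>a h. f a \<noteq> 0 \<Longrightarrow> h \<in> vecs_on \<sigma> \<Longrightarrow> a + (g + h) \<in> T"
    by blast
  have "(\<lambda>b. f (b - g)) \<in> finite_fns T"
  proof (rule finite_fnsI)
    have "{b. f (b - g) \<noteq> 0} \<subseteq> (\<lambda>a. a + g) ` {a. f a \<noteq> 0}"
    proof
      fix b assume "b \<in> {b. f (b - g) \<noteq> 0}"
      moreover have "b = (b - g) + g" by simp
      ultimately show "b \<in> (\<lambda>a. a + g) ` {a. f a \<noteq> 0}" by blast
    qed
    then show "finite {b. f (b - g) \<noteq> 0}"
      using finite_fns_finite[OF assms] finite_surj by blast
    show "b \<in> T" if b: "f (b - g) \<noteq> 0" for b using g(2)[OF b vecs_on_zero] by simp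
  qed
  then obtain m where m: "m \<in> carrier M" "rep m = (\<lambda>b. f (b - g))"
    using rep_bij unfolding bij_betw_def by (metis (no_types, lifting) imageE)
  define e where "e = vec_expo g"
  have e: "monomial e \<in> (monomials_on \<sigma> :: ('v, 'k) mpoly set)" "expo_vec e = g"
    unfolding e_def using mono_vec_expo[OF g(1)] by simp_all
  have "Poly_Mapping.keys e \<subseteq> \<sigma>"
  proof
    fix v assume "v \<in> Poly_Mapping.keys e"
    then have "g v \<noteq> 0" using e(2) by (auto simp: expo_vec_apply in_keys_iff)
    then show "v \<in> \<sigma>" using g(1) by (auto simp: vecs_on_def)
  qed
  moreover have "frac_coeff \<sigma> (m, monomial e) = f"
    using finite_fns_supp[OF assms] by (auto simp: fun_eq_iff frac_coeff_apply m(2) e(2))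
  moreover have "\<forall>b. rep m b = f (b - expo_vec e)" by (simp add: m(2) e(2))
  ultimately show ?thesis using m(1) by blast
qed

lemma frac_class_nonempty:
  assumes "f \<in> finite_fns (Tloc \<sigma>)"
  shows "\<exists>m s. m \<in> carrier M \<and> s \<in> monomials_on \<sigma> \<and> frac_coeff \<sigma> (m, s) = f"
  using finite_fns_frac_coeff[OF assms] unfolding monomials_on_def by blast

lemma frac_class_eqD:
  assumes "f \<in> finite_fns (Tloc \<sigma>)" "frac_class \<sigma> f = frac_class \<sigma> g"
  shows "f = g"
proof -
  obtain m s where "(m, s) \<in> frac_class \<sigma> f"
    using frac_class_nonempty[OF assms(1)] by (auto simp: frac_class_def)
  then have "(m, s) \<in> frac_class \<sigma> g" "frac_coeff \<sigma> (m, s) = f" using assms(2) by (auto simp: frac_class_def)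
  then show ?thesis by (simp add: frac_class_def)
qed

text \<open>The operations on localizations are unions over all representatives; on a class where all
  representatives give the same result, the union is that result.\<close>

lemma UN_frac_class:
  assumes "f \<in> finite_fns (Tloc \<sigma>)"
    and "\<And>m s. m \<in> carrier M \<Longrightarrow> s \<in> monomials_on \<sigma> \<Longrightarrow> frac_coeff \<sigma> (m, s) = f \<Longrightarrow> G m s = A"
  shows "(\<Union>(m, s)\<in>frac_class \<sigma> f. G m s) = A"
proof -
  obtain m s where ms: "(m, s) \<in> frac_class \<sigma> f"
    using frac_class_nonempty[OF assms(1)] by (auto simp: frac_class_def)
  have "(case x of (m, s) \<Rightarrow> G m s) = A" if "x \<in> frac_class \<sigma> f" for x
    using that assms(2) by (auto simp: frac_class_def)
  then show ?thesis using ms by blast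
qed

lemma cech_term_carrier: "carrier (cech_term M \<sigma>) = frac_class \<sigma> ` finite_fns (Tloc \<sigma>)"
proof -
  have "carrier (cech_term M \<sigma>)
      = (\<lambda>(m, s). fraction M (monomials_on \<sigma>) m s) ` (carrier M \<times> monomials_on \<sigma>)"
    by (auto simp: localization_def quotient_def fraction_def)
  also have "\<dots> = frac_class \<sigma> ` frac_coeff \<sigma> ` (carrier M \<times> monomials_on \<sigma>)"
    unfolding image_image by (rule image_cong) (auto simp: fraction_eq)
  also have "frac_coeff \<sigma> ` (carrier M \<times> monomials_on \<sigma>) = finite_fns (Tloc \<sigma>)"
  proof (intro subset_antisym subsetI)
    fix f assume "f \<in> frac_coeff \<sigma> ` (carrier M \<times> monomials_on \<sigma>)"
    then show "f \<in> finite_fns (Tloc \<sigma>)" using frac_coeff_fns by auto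
  next
    fix f :: "('v \<Rightarrow> int) \<Rightarrow> 'k" assume "f \<in> finite_fns (Tloc \<sigma>)"
    then show "f \<in> frac_coeff \<sigma> ` (carrier M \<times> monomials_on \<sigma>)"
      using frac_class_nonempty[of f \<sigma>] by force
  qed
  finally show ?thesis .
qed

lemma cech_term_zero: "\<zero>\<^bsub>cech_term M \<sigma>\<^esub> = frac_class \<sigma> (\<lambda>a. 0)"
proof -
  have "\<zero>\<^bsub>cech_term M \<sigma>\<^esub> = frac_class \<sigma> (frac_coeff \<sigma> (\<zero>\<^bsub>M\<^esub>, 1))"
    using fraction_eq[OF zero_closed one_mem_monomials_on] by (simp add: localization_def)
  also have "frac_coeff \<sigma> (\<zero>\<^bsub>M\<^esub>, 1) = (\<lambda>a. 0)" by (auto simp: frac_coeff_apply rep_zero)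
  finally show ?thesis .
qed

lemma rep_shift_supp:
  assumes "x \<in> carrier M" "a \<in> Tloc \<sigma>" "s \<in> monomials_on \<sigma>" "s' \<in> monomials_on \<sigma>"
  shows "rep (s' \<odot>\<^bsub>M\<^esub> x) (a + (mono_vec s + mono_vec s')) = rep x (a + mono_vec s)"
proof (cases "rep x (a + mono_vec s) = 0")
  case True
  then show ?thesis using rep_monomial_smult[OF assms(1,4)] by (simp add: algebra_simps)
next
  case False
  then have "a + mono_vec s \<in> T" using rep_supp[OF assms(1)] by blast
  then have "(a + mono_vec s) + mono_vec s' \<in> T"
    by (rule TlocD[OF assms(2) _ mono_vec_on[OF assms(3)] refl mono_vec_on[OF assms(4)]])
  then show ?thesis using rep_monomial_smult[OF assms(1,4)] by (simp add: algebra_simps)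
qed

lemma cech_term_add:
  assumes "f \<in> finite_fns (Tloc \<sigma>)" "g \<in> finite_fns (Tloc \<sigma>)"
  shows "frac_class \<sigma> f \<oplus>\<^bsub>cech_term M \<sigma>\<^esub> frac_class \<sigma> g = frac_class \<sigma> (\<lambda>a. f a + g a)"
proof -
  have "fraction M (monomials_on \<sigma>) (s' \<odot>\<^bsub>M\<^esub> m \<oplus>\<^bsub>M\<^esub> s \<odot>\<^bsub>M\<^esub> m') (s * s') = frac_class \<sigma> (\<lambda>a. f a + g a)"
    if m: "m \<in> carrier M" "s \<in> monomials_on \<sigma>" "frac_coeff \<sigma> (m, s) = f"
      and m': "m' \<in> carrier M" "s' \<in> monomials_on \<sigma>" "frac_coeff \<sigma> (m', s') = g" for m s m' s'
  proof -
    have c: "s' \<odot>\<^bsub>M\<^esub> m \<in> carrier M" "s \<odot>\<^bsub>M\<^esub> m' \<in> carrier M"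
      using m m' monomial_smult_closed by blast+
    have "frac_coeff \<sigma> (s' \<odot>\<^bsub>M\<^esub> m \<oplus>\<^bsub>M\<^esub> s \<odot>\<^bsub>M\<^esub> m', s * s') a = f a + g a" for a
    proof (cases "a \<in> Tloc \<sigma>")
      case True
      have "f a = rep m (a + mono_vec s)" "g a = rep m' (a + mono_vec s')"
        using True m(3) m'(3) by (auto simp: frac_coeff_apply)
      moreover have "rep (s \<odot>\<^bsub>M\<^esub> m') (a + (mono_vec s + mono_vec s')) = rep m' (a + mono_vec s')"
        using rep_shift_supp[OF m'(1) True m'(2) m(2)] by (simp add: add.commute)
      ultimately show ?thesis
        using True rep_shift_supp[OF m(1) True m(2) m'(2)]
        by (simp add: frac_coeff_apply monomials_on_mult(2)[OF m(2) m'(2)] rep_add[OF c])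
    next
      case False
      then show ?thesis using m(3) m'(3) by (auto simp: frac_coeff_apply)
    qed
    then have "frac_coeff \<sigma> (s' \<odot>\<^bsub>M\<^esub> m \<oplus>\<^bsub>M\<^esub> s \<odot>\<^bsub>M\<^esub> m', s * s') = (\<lambda>a. f a + g a)" by auto
    then show ?thesis using fraction_eq[OF add_closed[OF c] monomials_on_mult(1)[OF m(2) m'(2)]] by simp
  qed
  then show ?thesis unfolding localization_def by (simp) (intro UN_frac_class assms, blast)
qed

lemma cech_term_smult:
  assumes "f \<in> finite_fns (Tloc \<sigma>)"
  shows "(Poly_Mapping.single 0 c) \<odot>\<^bsub>cech_term M \<sigma>\<^esub> frac_class \<sigma> f = frac_class \<sigma> (\<lambda>a. c * f a)"
proof -
  have "fraction M (monomials_on \<sigma>) (Poly_Mapping.single 0 c \<odot>\<^bsub>M\<^esub> m) s = frac_class \<sigma> (\<lambda>a. c * f a)"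
    if m: "m \<in> carrier M" "s \<in> monomials_on \<sigma>" "frac_coeff \<sigma> (m, s) = f" for m s
  proof -
    have "rep (Poly_Mapping.single 0 c \<odot>\<^bsub>M\<^esub> m) b = c * rep m b" for b
      using rep_smult[OF m(1), of 0 c b] rep_supp[OF m(1), of b] by (auto simp: expo_vec_zero)
    then have "frac_coeff \<sigma> (Poly_Mapping.single 0 c \<odot>\<^bsub>M\<^esub> m, s) = (\<lambda>a. c * f a)"
      using m(3) by (auto simp: frac_coeff_apply)
    then show ?thesis using fraction_eq[OF smult_closed[OF m(1)] m(2)] by simp
  qed
  then show ?thesis unfolding localization_def by (simp) (intro UN_frac_class assms, blast)
qed

lemma cech_term_monoid: "abelian_monoid (cech_term M \<sigma>)"
proof (rule abelian_monoidI)
  fix x y z assume "x \<in> carrier (cech_term M \<sigma>)" "y \<in> carrier (cech_term M \<sigma>)" "z \<in> carrier (cech_term M \<sigma>)"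
  then obtain f g h where f: "f \<in> finite_fns (Tloc \<sigma>)" "x = frac_class \<sigma> f"
    and g: "g \<in> finite_fns (Tloc \<sigma>)" "y = frac_class \<sigma> g"
    and h: "h \<in> finite_fns (Tloc \<sigma>)" "z = frac_class \<sigma> h"
    unfolding cech_term_carrier by blast
  show "(x \<oplus>\<^bsub>cech_term M \<sigma>\<^esub> y) \<oplus>\<^bsub>cech_term M \<sigma>\<^esub> z = x \<oplus>\<^bsub>cech_term M \<sigma>\<^esub> (y \<oplus>\<^bsub>cech_term M \<sigma>\<^esub> z)"
    using f g h by (simp add: cech_term_add finite_fns_add add.assoc)
next
  fix x y assume "x \<in> carrier (cech_term M \<sigma>)" "y \<in> carrier (cech_term M \<sigma>)"
  then obtain f g where f: "f \<in> finite_fns (Tloc \<sigma>)" "x = frac_class \<sigma> f"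
    and g: "g \<in> finite_fns (Tloc \<sigma>)" "y = frac_class \<sigma> g"
    unfolding cech_term_carrier by blast
  show "x \<oplus>\<^bsub>cech_term M \<sigma>\<^esub> y \<in> carrier (cech_term M \<sigma>)"
    unfolding cech_term_carrier using f g finite_fns_add[OF f(1) g(1)] by (simp add: cech_term_add)
  show "x \<oplus>\<^bsub>cech_term M \<sigma>\<^esub> y = y \<oplus>\<^bsub>cech_term M \<sigma>\<^esub> x"
    using f g by (simp add: cech_term_add add.commute)
  show "\<zero>\<^bsub>cech_term M \<sigma>\<^esub> \<oplus>\<^bsub>cech_term M \<sigma>\<^esub> x = x"
    using f by (simp add: cech_term_zero cech_term_add finite_fns_zero)
next
  show "\<zero>\<^bsub>cech_term M \<sigma>\<^esub> \<in> carrier (cech_term M \<sigma>)"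
    unfolding cech_term_carrier cech_term_zero using finite_fns_zero by blast
qed

lemma cech_term_finsum:
  assumes "finite A" "\<And>j. j \<in> A \<Longrightarrow> F j \<in> finite_fns (Tloc \<sigma>)"
    and "\<And>j. j \<in> A \<Longrightarrow> x j = frac_class \<sigma> (F j)"
  shows "finsum (cech_term M \<sigma>) x A = frac_class \<sigma> (\<lambda>a. \<Sum>j\<in>A. F j a)"
  using assms
proof (induction A rule: finite_induct)
  case empty
  interpret abelian_monoid "cech_term M \<sigma>" by (rule cech_term_monoid)
  show ?case by (simp add: cech_term_zero)
next
  case (insert j A)
  interpret abelian_monoid "cech_term M \<sigma>" by (rule cech_term_monoid)
  have x: "x i \<in> carrier (cech_term M \<sigma>)" if "i \<in> insert j A" for i
    using insert.prems that unfolding cech_term_carrier by blast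
  have "finsum (cech_term M \<sigma>) x (insert j A) = x j \<oplus>\<^bsub>cech_term M \<sigma>\<^esub> finsum (cech_term M \<sigma>) x A"
    using insert.hyps x by (intro finsum_insert) auto
  also have "\<dots> = frac_class \<sigma> (\<lambda>a. F j a + (\<Sum>j\<in>A. F j a))"
    using insert by (simp add: cech_term_add finite_fns_sum)
  finally show ?case using insert.hyps by simp
qed

end

text \<open>In coordinates, the maps between localizations are restrictions of functions.  The compatibility
  hypothesis rules out that a coordinate which is zero in \<open>M\<close> localized at \<open>\<sigma>\<close> reappears in \<open>N\<close>
  localized at \<open>\<tau>\<close>.  The lemma covers both the inclusions of localizations in the Cech
  differential and the projections between two quotients.\<close>

lemma frac_map_class:
  assumes M: "monomial_module M T rep" and N: "monomial_module N T' rep'"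
    and f: "\<And>m. m \<in> carrier M \<Longrightarrow> f m \<in> carrier N"
    and rep_f: "\<And>m a. m \<in> carrier M \<Longrightarrow> rep' (f m) a = (if a \<in> T' then rep m a else 0)"
    and "\<sigma> \<subseteq> \<tau>"
    and comp: "\<And>a e. a \<in> loc_exps T' \<tau> \<Longrightarrow> e \<in> vecs_on \<sigma> \<Longrightarrow> a + e \<in> T \<Longrightarrow>
      a + e \<in> T' \<and> a \<in> loc_exps T \<sigma>"
    and F: "F \<in> finite_fns (loc_exps T \<sigma>)"
  shows "frac_map f N (monomials_on \<tau>) (monomial_module.frac_class M T rep \<sigma> F)
    = monomial_module.frac_class N T' rep' \<tau> (\<lambda>a. if a \<in> loc_exps T' \<tau> then F a else 0)"
proof -
  interpret M: monomial_module M T rep by (rule M)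
  interpret N: monomial_module N T' rep' by (rule N)
  show ?thesis
    unfolding frac_map_def
  proof (rule M.UN_frac_class[OF F])
    fix m s assume m: "m \<in> carrier M" "s \<in> monomials_on \<sigma>" "M.frac_coeff \<sigma> (m, s) = F"
    have s: "s \<in> monomials_on \<tau>" using m(2) monomials_on_mono[OF \<open>\<sigma> \<subseteq> \<tau>\<close>] by blast
    have "N.frac_coeff \<tau> (f m, s) a = (if a \<in> loc_exps T' \<tau> then F a else 0)" for a
    proof (cases "a \<in> loc_exps T' \<tau> \<and> rep m (a + mono_vec s) \<noteq> 0")
      case True
      then have "a + mono_vec s \<in> T" using M.rep_supp[OF m(1)] by blast
      then have "a + mono_vec s \<in> T' \<and> a \<in> loc_exps T \<sigma>"
        using True mono_vec_on[OF m(2)] by (intro comp) auto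
      then show ?thesis
        using True m(3) by (auto simp: N.frac_coeff_apply M.frac_coeff_apply rep_f[OF m(1)])
    next
      case False
      then show ?thesis
        using m(3) by (auto simp: N.frac_coeff_apply M.frac_coeff_apply rep_f[OF m(1)])
    qed
    then have "N.frac_coeff \<tau> (f m, s) = (\<lambda>a. if a \<in> loc_exps T' \<tau> then F a else 0)" by auto
    then show "fraction N (monomials_on \<tau>) (f m) s
        = N.frac_class \<tau> (\<lambda>a. if a \<in> loc_exps T' \<tau> then F a else 0)"
      using N.fraction_eq[OF f[OF m(1)] s] by simp
  qed
qed

section \<open>The Cech complex in Laurent coordinates\<close>

type_synonym ('v, 'k) laurent_cochain = "'v set \<Rightarrow> ('v \<Rightarrow> int) \<Rightarrow> 'k"

text \<open>A cochain of degree \<open>p\<close> only has components at sets of cardinality \<open>p\<close>; the values of a Laurent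
  cochain at other sets are arbitrary and are ignored throughout.\<close>

definition cech_fns :: "('v \<Rightarrow> int) set \<Rightarrow> nat \<Rightarrow> ('v, 'k::field) laurent_cochain set" where
  "cech_fns T p = {F. \<forall>\<sigma>. card \<sigma> = p \<longrightarrow> F \<sigma> \<in> finite_fns (loc_exps T \<sigma>)}"

definition cech_sign :: "'v::linorder \<Rightarrow> 'v set \<Rightarrow> 'k::field" where
  "cech_sign j \<tau> = (-1) ^ card {l\<in>\<tau>. l < j}"

definition cech_d ::
  "('v \<Rightarrow> int) set \<Rightarrow> ('v::{finite,linorder}, 'k::field) laurent_cochain \<Rightarrow> ('v, 'k) laurent_cochain" where
  "cech_d T F \<tau> a = (if a \<in> loc_exps T \<tau> then \<Sum>j\<in>\<tau>. cech_sign j \<tau> * F (\<tau> - {j}) a else 0)"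

definition cocycle ::
  "('v \<Rightarrow> int) set \<Rightarrow> nat \<Rightarrow> ('v::{finite,linorder}, 'k::field) laurent_cochain \<Rightarrow> bool" where
  "cocycle T p F \<longleftrightarrow> F \<in> cech_fns T p \<and> (\<forall>\<tau>. card \<tau> = Suc p \<longrightarrow> cech_d T F \<tau> = (\<lambda>a. 0))"

definition coboundary ::
  "('v \<Rightarrow> int) set \<Rightarrow> nat \<Rightarrow> ('v::{finite,linorder}, 'k::field) laurent_cochain \<Rightarrow> bool" where
  "coboundary T p F \<longleftrightarrow> (case p of 0 \<Rightarrow> \<forall>\<sigma>. card \<sigma> = 0 \<longrightarrow> F \<sigma> = (\<lambda>a. 0)
     | Suc q \<Rightarrow> \<exists>G\<in>cech_fns T q. \<forall>\<sigma>. card \<sigma> = p \<longrightarrow> F \<sigma> = cech_d T G \<sigma>)"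

lemma cech_fnsD: "F \<in> cech_fns T p \<Longrightarrow> card \<sigma> = p \<Longrightarrow> F \<sigma> \<in> finite_fns (loc_exps T \<sigma>)"
  and cech_fnsI: "(\<And>\<sigma>. card \<sigma> = p \<Longrightarrow> F \<sigma> \<in> finite_fns (loc_exps T \<sigma>)) \<Longrightarrow> F \<in> cech_fns T p"
  by (simp_all add: cech_fns_def)

lemma cech_fns_zero: "(\<lambda>\<sigma> a. 0) \<in> cech_fns T p"
  by (simp add: cech_fns_def finite_fns_zero)

lemma cech_fns_add:
  "F \<in> cech_fns T p \<Longrightarrow> G \<in> cech_fns T p \<Longrightarrow> (\<lambda>\<sigma> a. F \<sigma> a + G \<sigma> a) \<in> cech_fns T p"
  by (simp add: cech_fns_def finite_fns_add)

lemma cech_fns_diff: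
  assumes "F \<in> cech_fns T p" "G \<in> cech_fns T p"
  shows "(\<lambda>\<sigma> a. F \<sigma> a - G \<sigma> a) \<in> cech_fns T p"
proof (rule cech_fnsI)
  fix \<sigma> :: "'a set" assume "card \<sigma> = p"
  then have "(\<lambda>a. F \<sigma> a + (-1) * G \<sigma> a) \<in> finite_fns (loc_exps T \<sigma>)"
    using assms by (intro finite_fns_add finite_fns_mult cech_fnsD)
  then show "(\<lambda>a. F \<sigma> a - G \<sigma> a) \<in> finite_fns (loc_exps T \<sigma>)" by simp
qed

lemma card_Diff_Suc: "card \<tau> = Suc p \<Longrightarrow> j \<in> \<tau> \<Longrightarrow> card (\<tau> - {j}) = p"
  by (simp add: card_Diff_singleton)

lemma cech_d_fns:
  assumes "F \<in> cech_fns T p"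
  shows "cech_d T F \<in> cech_fns T (Suc p)"
proof (rule cech_fnsI)
  fix \<tau> :: "'a set" assume \<tau>: "card \<tau> = Suc p"
  have eq: "cech_d T F \<tau> = (\<lambda>a. \<Sum>j\<in>\<tau>. cech_sign j \<tau> *
      (if a \<in> loc_exps T \<tau> then F (\<tau> - {j}) a else 0))"
    by (auto simp: cech_d_def fun_eq_iff)
  show "cech_d T F \<tau> \<in> finite_fns (loc_exps T \<tau>)"
    unfolding eq
    by (intro finite_fns_sum finite_fns_mult finite_fns_restrict[OF cech_fnsD[OF assms card_Diff_Suc[OF \<tau>]]])
qed

lemma cech_d_diff: "cech_d T (\<lambda>\<sigma> a. F \<sigma> a - G \<sigma> a) \<tau> a = cech_d T F \<tau> a - cech_d T G \<tau> a"
  by (simp add: cech_d_def right_diff_distrib sum_subtractf)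

lemma cech_d_zero: "cech_d T (\<lambda>\<sigma> a. 0) \<tau> a = 0"
  by (simp add: cech_d_def)

lemma coboundary_zero: "coboundary T p (\<lambda>\<sigma> a. 0)"
proof (cases p)
  case (Suc q)
  then show ?thesis
    using cech_fns_zero by (auto simp: coboundary_def cech_d_zero fun_eq_iff intro!: bexI[of _ "\<lambda>\<sigma> a. 0"])
qed (simp add: coboundary_def)

lemma coboundary_diff:
  assumes "coboundary T p F" "coboundary T p G"
  shows "coboundary T p (\<lambda>\<sigma> a. F \<sigma> a - G \<sigma> a)"
proof (cases p)
  case 0
  then show ?thesis using assms by (simp add: coboundary_def)
next
  case (Suc q)
  obtain F' where F': "F' \<in> cech_fns T q" "\<And>\<sigma>. card \<sigma> = p \<Longrightarrow> F \<sigma> = cech_d T F' \<sigma>"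
    using assms(1) Suc by (auto simp: coboundary_def)
  obtain G' where G': "G' \<in> cech_fns T q" "\<And>\<sigma>. card \<sigma> = p \<Longrightarrow> G \<sigma> = cech_d T G' \<sigma>"
    using assms(2) Suc by (auto simp: coboundary_def)
  have "(\<lambda>a. F \<sigma> a - G \<sigma> a) = cech_d T (\<lambda>\<sigma> a. F' \<sigma> a - G' \<sigma> a) \<sigma>" if "card \<sigma> = p" for \<sigma>
    using F'(2)[OF that] G'(2)[OF that] by (simp add: cech_d_diff fun_eq_iff)
  then show ?thesis
    using cech_fns_diff[OF F'(1) G'(1)] Suc by (auto simp: coboundary_def)
qed

lemma coboundary_add:
  assumes "coboundary T p F" "coboundary T p G"
  shows "coboundary T p (\<lambda>\<sigma> a. F \<sigma> a + G \<sigma> a)"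
  using coboundary_diff[OF assms(1) coboundary_diff[OF coboundary_zero assms(2)]] by simp

lemma coboundary_cong:
  assumes "coboundary T p F" "\<And>\<sigma>. card \<sigma> = p \<Longrightarrow> F \<sigma> = G \<sigma>"
  shows "coboundary T p G"
  using assms by (cases p) (auto simp: coboundary_def)

lemma minus_one_power_poly:
  "((-1) ^ n :: ('v, 'k::field) mpoly) = Poly_Mapping.single 0 ((-1) ^ n)"
proof (induction n)
  case (Suc n)
  have "(-1 :: ('v, 'k) mpoly) = Poly_Mapping.single 0 (-1)" by (simp add: single_uminus)
  then show ?case using Suc by (simp only: power_Suc mult_single add_0)
qed simp

context monomial_module
begin

text \<open>The compatibility hypothesis of \<open>frac_map_class\<close> for the inclusions in the Cech complex.\<close>

lemma Tloc_subset:
  assumes "a \<in> Tloc \<tau>" "\<sigma> \<subseteq> \<tau>" "e \<in> vecs_on \<sigma>" "a + e \<in> T"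
  shows "a \<in> Tloc \<sigma>"
proof (rule ccontr)
  assume "a \<notin> Tloc \<sigma>"
  then obtain g where g: "g \<in> vecs_on \<sigma>" "\<forall>h\<in>vecs_on \<sigma>. (a + e) + (g + h) \<notin> T"
    using Tloc_converse[OF _ assms(4,3) refl] by blast
  have "(a + e) + g \<in> T"
    by (rule TlocD[OF assms(1,4) vecs_on_mono[OF assms(2,3)] refl vecs_on_mono[OF assms(2) g(1)]])
  then show False using g(2) vecs_on_zero by fastforce
qed

lemma frac_map_id:
  assumes "\<sigma> \<subseteq> \<tau>" "F \<in> finite_fns (Tloc \<sigma>)"
  shows "frac_map (\<lambda>m. m) M (monomials_on \<tau>) (frac_class \<sigma> F)
    = frac_class \<tau> (\<lambda>a. if a \<in> Tloc \<tau> then F a else 0)"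
  using rep_supp Tloc_subset[OF _ assms(1)] assms
  by (intro frac_map_class[OF monomial_module_axioms monomial_module_axioms]) auto

definition cochain_of :: "nat \<Rightarrow> ('v, 'k) laurent_cochain \<Rightarrow> ('v, 'k, 'm) cochain" where
  "cochain_of p F = (\<lambda>\<sigma>\<in>{\<sigma>. card \<sigma> = p}. frac_class \<sigma> (F \<sigma>))"

lemma cochain_of_apply: "card \<sigma> = p \<Longrightarrow> cochain_of p F \<sigma> = frac_class \<sigma> (F \<sigma>)"
  by (simp add: cochain_of_def)

lemma cochain_of_cong:
  assumes "\<And>\<sigma>. card \<sigma> = p \<Longrightarrow> F \<sigma> = G \<sigma>"
  shows "cochain_of p F = cochain_of p G"
  unfolding cochain_of_def using assms by (intro restrict_ext) simp

lemma cochain_of_eqD: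
  assumes "F \<in> cech_fns T p" "cochain_of p F = cochain_of p G" "card \<sigma> = p"
  shows "F \<sigma> = G \<sigma>"
proof (rule frac_class_eqD)
  show "F \<sigma> \<in> finite_fns (Tloc \<sigma>)" using assms(1,3) by (rule cech_fnsD)
  show "frac_class \<sigma> (F \<sigma>) = frac_class \<sigma> (G \<sigma>)"
    using fun_cong[OF assms(2), of \<sigma>] assms(3) by (simp add: cochain_of_apply)
qed

lemma cech_module_carrier: "carrier (cech_module M p) = cochain_of p ` cech_fns T p"
proof (intro subset_antisym subsetI)
  fix c assume "c \<in> carrier (cech_module M p)"
  then have c: "c \<in> (\<Pi>\<^sub>E \<sigma>\<in>{\<sigma>. card \<sigma> = p}. frac_class \<sigma> ` finite_fns (Tloc \<sigma>))"
    by (simp add: cech_module_def cech_term_carrier)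
  define F where "F \<sigma> = (SOME f. f \<in> finite_fns (Tloc \<sigma>) \<and> c \<sigma> = frac_class \<sigma> f)" for \<sigma>
  have F: "F \<sigma> \<in> finite_fns (Tloc \<sigma>) \<and> c \<sigma> = frac_class \<sigma> (F \<sigma>)" if "card \<sigma> = p" for \<sigma>
  proof -
    have "c \<sigma> \<in> frac_class \<sigma> ` finite_fns (Tloc \<sigma>)" using PiE_mem[OF c] that by simp
    then have "\<exists>f. f \<in> finite_fns (Tloc \<sigma>) \<and> c \<sigma> = frac_class \<sigma> f" by blast
    then show ?thesis unfolding F_def by (rule someI_ex)
  qed
  have "c = cochain_of p F"
  proof
    fix \<sigma>
    show "c \<sigma> = cochain_of p F \<sigma>"
      using F[of \<sigma>] PiE_arb[OF c, of \<sigma>] by (cases "card \<sigma> = p") (auto simp: cochain_of_def)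
  qed
  moreover have "F \<in> cech_fns T p" using F by (auto intro: cech_fnsI)
  ultimately show "c \<in> cochain_of p ` cech_fns T p" by blast
next
  fix c assume "c \<in> cochain_of p ` cech_fns T p"
  then show "c \<in> carrier (cech_module M p)"
    by (auto simp: cech_module_def cech_term_carrier cochain_of_def cech_fns_def)
qed

lemma cech_module_zero: "\<zero>\<^bsub>cech_module M p\<^esub> = cochain_of p (\<lambda>\<sigma> a. 0)"
  by (simp add: cech_module_def cech_term_zero cochain_of_def)

lemma cech_module_add:
  assumes "F \<in> cech_fns T p" "G \<in> cech_fns T p"
  shows "cochain_of p F \<oplus>\<^bsub>cech_module M p\<^esub> cochain_of p G = cochain_of p (\<lambda>\<sigma> a. F \<sigma> a + G \<sigma> a)"
  using assms by (auto simp: cech_module_def cochain_of_def cech_fnsD cech_term_add fun_eq_iff)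

lemma cech_diff_class:
  assumes "F \<in> cech_fns T p"
  shows "cech_diff M p (cochain_of p F) = cochain_of (Suc p) (cech_d T F)"
proof
  fix \<tau>
  show "cech_diff M p (cochain_of p F) \<tau> = cochain_of (Suc p) (cech_d T F) \<tau>"
  proof (cases "card \<tau> = Suc p")
    case True
    let ?F = "\<lambda>j a. cech_sign j \<tau> * (if a \<in> Tloc \<tau> then F (\<tau> - {j}) a else 0)"
    have fns: "(\<lambda>a. if a \<in> Tloc \<tau> then F (\<tau> - {j}) a else 0) \<in> finite_fns (Tloc \<tau>)"
      if "j \<in> \<tau>" for j
      using cech_fnsD[OF assms card_Diff_Suc[OF True that]] by (rule finite_fns_restrict)
    have "((-1) ^ card {l\<in>\<tau>. l < j}) \<odot>\<^bsub>cech_term M \<tau>\<^esub>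
        frac_map (\<lambda>m. m) M (monomials_on \<tau>) (cochain_of p F (\<tau> - {j})) = frac_class \<tau> (?F j)"
      if j: "j \<in> \<tau>" for j
    proof -
      have "frac_map (\<lambda>m. m) M (monomials_on \<tau>) (cochain_of p F (\<tau> - {j}))
          = frac_class \<tau> (\<lambda>a. if a \<in> Tloc \<tau> then F (\<tau> - {j}) a else 0)"
        unfolding cochain_of_apply[OF card_Diff_Suc[OF True j]]
        using cech_fnsD[OF assms card_Diff_Suc[OF True j]] by (intro frac_map_id) auto
      then show ?thesis
        unfolding minus_one_power_poly cech_sign_def using fns[OF j] by (simp only: cech_term_smult)
    qed
    then have "finsum (cech_term M \<tau>) (\<lambda>j. ((-1) ^ card {l\<in>\<tau>. l < j}) \<odot>\<^bsub>cech_term M \<tau>\<^esub>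
        frac_map (\<lambda>m. m) M (monomials_on \<tau>) (cochain_of p F (\<tau> - {j}))) \<tau>
        = frac_class \<tau> (\<lambda>a. \<Sum>j\<in>\<tau>. ?F j a)"
      using fns by (intro cech_term_finsum finite_fns_mult) auto
    also have "(\<lambda>a. \<Sum>j\<in>\<tau>. ?F j a) = cech_d T F \<tau>"
      by (auto simp: cech_d_def fun_eq_iff)
    finally show ?thesis using True by (simp add: cech_diff_def cochain_of_apply)
  qed (simp add: cech_diff_def cochain_of_def)
qed

lemma cocycles_eq: "cocycles M p = cochain_of p ` {F. cocycle T p F}"
proof -
  have "cochain_of (Suc p) (cech_d T F) = cochain_of (Suc p) (\<lambda>\<sigma> a. 0)
      \<longleftrightarrow> (\<forall>\<tau>. card \<tau> = Suc p \<longrightarrow> cech_d T F \<tau> = (\<lambda>a. 0))" if "F \<in> cech_fns T p" for F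
    using cochain_of_eqD[OF cech_d_fns[OF that], of "\<lambda>\<sigma> a. 0"] cochain_of_cong[of "Suc p" "cech_d T F" "\<lambda>\<sigma> a. 0"]
    by blast
  then show ?thesis
    unfolding cocycles_def cech_module_carrier cech_module_zero cocycle_def
    by (auto simp: cech_diff_class)
qed

lemma coboundaries_eq:
  "coboundaries M p = cochain_of p ` {F \<in> cech_fns T p. coboundary T p F}"
proof (cases p)
  case 0
  have "cochain_of 0 F = cochain_of 0 (\<lambda>\<sigma> a. 0)" if "coboundary T 0 F" for F
    using that by (intro cochain_of_cong) (simp add: coboundary_def)
  then show ?thesis
    using 0 cech_fns_zero[of T 0] coboundary_zero[of T 0]
    by (auto simp: coboundaries_def cech_module_zero)
next
  case (Suc q)
  have "cech_diff M q ` cochain_of q ` cech_fns T q = cochain_of p ` {F \<in> cech_fns T p. coboundary T p F}"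
  proof (intro subset_antisym subsetI)
    fix c assume "c \<in> cech_diff M q ` cochain_of q ` cech_fns T q"
    then obtain G where G: "G \<in> cech_fns T q" "c = cochain_of p (cech_d T G)"
      using Suc by (auto simp: cech_diff_class)
    then show "c \<in> cochain_of p ` {F \<in> cech_fns T p. coboundary T p F}"
      using cech_d_fns[OF G(1)] Suc by (auto simp: coboundary_def)
  next
    fix c assume "c \<in> cochain_of p ` {F \<in> cech_fns T p. coboundary T p F}"
    then obtain F where F: "coboundary T p F" "c = cochain_of p F" by blast
    then obtain G where G: "G \<in> cech_fns T q" "\<And>\<sigma>. card \<sigma> = p \<Longrightarrow> F \<sigma> = cech_d T G \<sigma>"
      using Suc by (auto simp: coboundary_def)
    have "c = cochain_of p (cech_d T G)" unfolding F(2) using G(2) by (rule cochain_of_cong)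
    then have "c = cech_diff M q (cochain_of q G)" using G(1) Suc by (simp add: cech_diff_class)
    then show "c \<in> cech_diff M q ` cochain_of q ` cech_fns T q" using G(1) by blast
  qed
  then show ?thesis using Suc by (simp add: coboundaries_def cech_module_carrier)
qed

text \<open>The cohomology class of a Laurent cocycle, as an element of \<open>local_cohomology M p\<close>.\<close>

definition coh_class :: "nat \<Rightarrow> ('v, 'k) laurent_cochain \<Rightarrow> ('v, 'k, 'm) cochain set" where
  "coh_class p F = coboundaries M p +>\<^bsub>cech_module M p\<^esub> cochain_of p F"

lemma coh_class_eq:
  assumes "F \<in> cech_fns T p"
  shows "coh_class p F = cochain_of p ` {H \<in> cech_fns T p. coboundary T p (\<lambda>\<sigma> a. H \<sigma> a - F \<sigma> a)}"
proof -
  let ?A = "(\<lambda>G. cochain_of p (\<lambda>\<sigma> a. G \<sigma> a + F \<sigma> a)) ` {G \<in> cech_fns T p. coboundary T p G}"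
  let ?B = "cochain_of p ` {H \<in> cech_fns T p. coboundary T p (\<lambda>\<sigma> a. H \<sigma> a - F \<sigma> a)}"
  have "coh_class p F = ?A"
    using assms by (auto simp: coh_class_def a_r_coset_def r_coset_def coboundaries_eq cech_module_add)
  also have "?A = ?B"
  proof (intro subset_antisym subsetI)
    fix c assume "c \<in> ?A"
    then obtain G where "G \<in> cech_fns T p" "coboundary T p G" "c = cochain_of p (\<lambda>\<sigma> a. G \<sigma> a + F \<sigma> a)"
      by blast
    then show "c \<in> ?B"
      using cech_fns_add[OF _ assms] by (intro image_eqI[of _ _ "\<lambda>\<sigma> a. G \<sigma> a + F \<sigma> a"]) auto
  next
    fix c assume "c \<in> ?B"
    then obtain H where "H \<in> cech_fns T p" "coboundary T p (\<lambda>\<sigma> a. H \<sigma> a - F \<sigma> a)" "c = cochain_of p H"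
      by blast
    then show "c \<in> ?A"
      using cech_fns_diff[OF _ assms] by (intro image_eqI[of _ _ "\<lambda>\<sigma> a. H \<sigma> a - F \<sigma> a"]) auto
  qed
  finally show ?thesis .
qed

lemma coh_class_eqI:
  assumes "F \<in> cech_fns T p" "G \<in> cech_fns T p" "coboundary T p (\<lambda>\<sigma> a. F \<sigma> a - G \<sigma> a)"
  shows "coh_class p F = coh_class p G"
proof -
  have "coboundary T p (\<lambda>\<sigma> a. H \<sigma> a - F \<sigma> a) \<longleftrightarrow> coboundary T p (\<lambda>\<sigma> a. H \<sigma> a - G \<sigma> a)" for H
    using coboundary_add[OF _ assms(3), of "\<lambda>\<sigma> a. H \<sigma> a - F \<sigma> a"]
      coboundary_diff[OF _ assms(3), of "\<lambda>\<sigma> a. H \<sigma> a - G \<sigma> a"] by auto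
  then show ?thesis unfolding coh_class_eq[OF assms(1)] coh_class_eq[OF assms(2)] by simp
qed

lemma coh_class_zero_iff:
  assumes "F \<in> cech_fns T p"
  shows "coh_class p F = coboundaries M p \<longleftrightarrow> coboundary T p F"
proof
  assume eq: "coh_class p F = coboundaries M p"
  have "cochain_of p F \<in> coh_class p F"
    unfolding coh_class_eq[OF assms] using assms coboundary_zero[of T p] by auto
  then obtain G where G: "coboundary T p G" "cochain_of p F = cochain_of p G"
    unfolding eq coboundaries_eq by blast
  show "coboundary T p F"
    using G(1) cochain_of_eqD[OF assms G(2)] by (intro coboundary_cong[OF G(1)]) simp
next
  assume "coboundary T p F"
  then have "coh_class p F = coh_class p (\<lambda>\<sigma> a. 0)"
    using assms cech_fns_zero by (intro coh_class_eqI) auto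
  also have "\<dots> = coboundaries M p"
    unfolding coh_class_eq[OF cech_fns_zero] coboundaries_eq by simp
  finally show "coh_class p F = coboundaries M p" .
qed

lemma local_cohomology_carrier:
  "carrier (local_cohomology M p) = coh_class p ` {F. cocycle T p F}"
  by (auto simp: local_cohomology_def quot_module_def A_RCOSETS_def RCOSETS_def cocycles_eq
      coh_class_def a_r_coset_def r_coset_def)

lemma local_cohomology_zero: "\<zero>\<^bsub>local_cohomology M p\<^esub> = coboundaries M p"
  by (simp add: local_cohomology_def quot_module_def)

end

text \<open>On cohomology, too, the map is restriction of Laurent functions.  That the union over the
  representatives of a class is a single class is where coboundaries have to go to coboundaries.\<close>

lemma local_cohomology_map_class:
  fixes M :: "(('v::{finite,linorder}, 'k::field) mpoly, 'm) module"
    and N :: "(('v, 'k) mpoly, 'n) module"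
  assumes M: "monomial_module M T rep" and N: "monomial_module N T' rep'"
    and f: "\<And>m. m \<in> carrier M \<Longrightarrow> f m \<in> carrier N"
    and rep_f: "\<And>m a. m \<in> carrier M \<Longrightarrow> rep' (f m) a = (if a \<in> T' then rep m a else 0)"
    and comp: "\<And>\<sigma> a e. a \<in> loc_exps T' \<sigma> \<Longrightarrow> e \<in> vecs_on \<sigma> \<Longrightarrow> a + e \<in> T \<Longrightarrow>
      a + e \<in> T' \<and> a \<in> loc_exps T \<sigma>"
    and cob: "\<And>G :: ('v, 'k) laurent_cochain. coboundary T p G \<Longrightarrow> coboundary T' p
      (\<lambda>\<sigma> a. if a \<in> loc_exps T' \<sigma> then G \<sigma> a else 0)"
    and F: "F \<in> cech_fns T p"
  shows "local_cohomology_map f N p (monomial_module.coh_class M T rep p F)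
    = monomial_module.coh_class N T' rep' p (\<lambda>\<sigma> a. if a \<in> loc_exps T' \<sigma> then F \<sigma> a else 0)"
proof -
  interpret M: monomial_module M T rep by (rule M)
  interpret N: monomial_module N T' rep' by (rule N)
  let ?r = "\<lambda>F \<sigma> a. if a \<in> loc_exps T' \<sigma> then F \<sigma> a else (0 :: 'k)"
  have r_fns: "?r H \<in> cech_fns T' p" if "H \<in> cech_fns T p" for H
    using cech_fnsD[OF that] by (intro cech_fnsI finite_fns_restrict)
  have map: "(\<lambda>\<sigma>\<in>{\<sigma>. card \<sigma> = p}. frac_map f N (monomials_on \<sigma>) (M.cochain_of p H \<sigma>))
      = N.cochain_of p (?r H)" if H: "H \<in> cech_fns T p" for H
    unfolding N.cochain_of_def
  proof (rule restrict_ext)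
    fix \<sigma> :: "'v set" assume "\<sigma> \<in> {\<sigma>. card \<sigma> = p}"
    then have \<sigma>: "card \<sigma> = p" by simp
    show "frac_map f N (monomials_on \<sigma>) (M.cochain_of p H \<sigma>) = N.frac_class \<sigma> (?r H \<sigma>)"
      unfolding M.cochain_of_apply[OF \<sigma>]
      by (rule frac_map_class[OF M N f rep_f subset_refl comp cech_fnsD[OF H \<sigma>]])
  qed
  have "coboundaries N p +>\<^bsub>cech_module N p\<^esub>
      (\<lambda>\<sigma>\<in>{\<sigma>. card \<sigma> = p}. frac_map f N (monomials_on \<sigma>) (c \<sigma>)) = N.coh_class p (?r F)"
    if "c \<in> M.coh_class p F" for c
  proof -
    obtain H where H: "H \<in> cech_fns T p" "coboundary T p (\<lambda>\<sigma> a. H \<sigma> a - F \<sigma> a)"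
        "c = M.cochain_of p H"
      using \<open>c \<in> M.coh_class p F\<close> unfolding M.coh_class_eq[OF F] by blast
    have "coboundary T' p (\<lambda>\<sigma> a. ?r H \<sigma> a - ?r F \<sigma> a)"
      using cob[OF H(2)] by (rule coboundary_cong) auto
    then have "N.coh_class p (?r H) = N.coh_class p (?r F)"
      using r_fns H(1) F by (intro N.coh_class_eqI)
    then show ?thesis unfolding H(3) map[OF H(1)] N.coh_class_def .
  qed
  moreover have "M.cochain_of p F \<in> M.coh_class p F"
    unfolding M.coh_class_eq[OF F] using F coboundary_zero[of T p] by auto
  ultimately show ?thesis unfolding local_cohomology_map_def by blast
qed

section \<open>Monomial ideals and their quotients as monomial subquotients\<close>

definition poly_coeff :: "('v::finite, 'k::field) mpoly \<Rightarrow> ('v \<Rightarrow> int) \<Rightarrow> 'k" where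
  "poly_coeff p a = (if 0 \<le> a then Poly_Mapping.lookup p (vec_expo a) else 0)"

lemma poly_coeff_expo_vec: "poly_coeff p (expo_vec e) = Poly_Mapping.lookup p e"
  by (simp add: poly_coeff_def expo_vec_nonneg vec_expo_expo_vec)

lemma poly_coeff_nonzero:
  "poly_coeff p a \<noteq> 0 \<Longrightarrow> vec_expo a \<in> Poly_Mapping.keys p \<and> expo_vec (vec_expo a) = a"
  by (auto simp: poly_coeff_def in_keys_iff expo_vec_vec_expo split: if_splits)

lemma poly_coeff_add: "poly_coeff (p + q) a = poly_coeff p a + poly_coeff q a"
  by (simp add: poly_coeff_def lookup_add)

lemma poly_coeff_diff: "poly_coeff (p - q) a = poly_coeff p a - poly_coeff q a"
  by (simp add: poly_coeff_def lookup_minus)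

lemma poly_coeff_zero: "poly_coeff 0 a = 0"
  by (simp add: poly_coeff_def)

lemma poly_coeff_inj: "poly_coeff p = poly_coeff q \<Longrightarrow> p = q"
  by (rule poly_mapping_eqI) (metis poly_coeff_expo_vec)

lemma lookup_single_mult:
  fixes p :: "('v, 'k::field) mpoly"
  shows "Poly_Mapping.lookup (Poly_Mapping.single e r * p) (e + f) = r * Poly_Mapping.lookup p f"
    and "(\<And>g. f \<noteq> e + g) \<Longrightarrow> Poly_Mapping.lookup (Poly_Mapping.single e r * p) f = 0"
proof -
  have expand: "Poly_Mapping.single e r * p
      = (\<Sum>g\<in>Poly_Mapping.keys p. Poly_Mapping.single (e + g) (r * Poly_Mapping.lookup p g))"
    using arg_cong[OF poly_mapping_sum_single[of p, symmetric], of "(*) (Poly_Mapping.single e r)"]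
    by (simp only: sum_distrib_left mult_single)
  have eq: "Poly_Mapping.lookup (Poly_Mapping.single e r * p) f
      = (\<Sum>g\<in>Poly_Mapping.keys p. (r * Poly_Mapping.lookup p g when e + g = f))" for f
    unfolding expand lookup_sum lookup_single ..
  show "Poly_Mapping.lookup (Poly_Mapping.single e r * p) (e + f) = r * Poly_Mapping.lookup p f"
    unfolding eq by (auto simp: when_def in_keys_iff)
  show "(\<And>g. f \<noteq> e + g) \<Longrightarrow> Poly_Mapping.lookup (Poly_Mapping.single e r * p) f = 0"
    unfolding eq by (rule sum.neutral) (auto simp: when_def)
qed

lemma poly_coeff_single_mult:
  "poly_coeff (Poly_Mapping.single e r * p) a = r * poly_coeff p (a - expo_vec e)"
proof (cases "0 \<le> a - expo_vec e")
  case True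
  then have a: "a = expo_vec (e + vec_expo (a - expo_vec e))"
    by (simp only: expo_vec_add expo_vec_vec_expo) simp
  have "poly_coeff (Poly_Mapping.single e r * p) a
      = Poly_Mapping.lookup (Poly_Mapping.single e r * p) (e + vec_expo (a - expo_vec e))"
    by (subst a) (rule poly_coeff_expo_vec)
  also have "\<dots> = r * poly_coeff p (a - expo_vec e)"
    using True by (simp add: lookup_single_mult(1) poly_coeff_def)
  finally show ?thesis .
next
  case False
  have "poly_coeff (Poly_Mapping.single e r * p) a = 0"
  proof (cases "0 \<le> a")
    case True
    have "vec_expo a \<noteq> e + g" for g
    proof
      assume "vec_expo a = e + g"
      then have "a = expo_vec e + expo_vec g"
        using expo_vec_vec_expo[OF True] expo_vec_add by metis
      then show False using False expo_vec_nonneg[of g] by simp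
    qed
    then show ?thesis by (simp add: poly_coeff_def lookup_single_mult(2))
  qed (simp add: poly_coeff_def)
  then show ?thesis using False by (simp add: poly_coeff_def)
qed

lemma poly_coeff_fns: "finite {a. poly_coeff p a \<noteq> 0}"
proof (rule finite_subset)
  show "{a. poly_coeff p a \<noteq> 0} \<subseteq> expo_vec ` Poly_Mapping.keys p"
  proof
    fix a assume "a \<in> {a. poly_coeff p a \<noteq> 0}"
    then have a: "vec_expo a \<in> Poly_Mapping.keys p" "expo_vec (vec_expo a) = a"
      using poly_coeff_nonzero[of p a] by auto
    show "a \<in> expo_vec ` Poly_Mapping.keys p" using imageI[OF a(1), of expo_vec] a(2) by simp
  qed
qed simp

lemma poly_coeff_surj:
  fixes f :: "('v::finite \<Rightarrow> int) \<Rightarrow> 'k::field"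
  assumes "finite {a. f a \<noteq> 0}" "\<And>a. f a \<noteq> 0 \<Longrightarrow> 0 \<le> a"
  obtains p where "poly_coeff p = f"
proof
  have "finite (expo_vec -` {a. f a \<noteq> 0})"
    using assms(1) by (rule finite_vimageI) (simp add: inj_on_def expo_vec_eq_iff)
  then have "finite {e. f (expo_vec e) \<noteq> 0}" by (simp add: vimage_def)
  then have lookup: "Poly_Mapping.lookup (Abs_poly_mapping (\<lambda>e. f (expo_vec e))) e = f (expo_vec e)" for e
    by simp
  show "poly_coeff (Abs_poly_mapping (\<lambda>e. f (expo_vec e))) = f"
  proof
    fix a show "poly_coeff (Abs_poly_mapping (\<lambda>e. f (expo_vec e))) a = f a"
    proof (cases "0 \<le> a")
      case True
      then show ?thesis
        by (simp only: poly_coeff_def lookup expo_vec_vec_expo[OF True] if_True)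
    next
      case False
      then show ?thesis using assms(2) by (auto simp: poly_coeff_def)
    qed
  qed
qed

lemma mem_mono_ideal_iff:
  "p \<in> mono_ideal U \<longleftrightarrow> (\<forall>a. poly_coeff p a \<noteq> 0 \<longrightarrow> a \<in> U)"
proof
  assume p: "p \<in> mono_ideal U"
  show "\<forall>a. poly_coeff p a \<noteq> 0 \<longrightarrow> a \<in> U"
  proof (intro allI impI)
    fix a assume "poly_coeff p a \<noteq> 0"
    note a = poly_coeff_nonzero[OF this]
    then have "expo_vec (vec_expo a) \<in> U" using p unfolding mono_ideal_def by blast
    then show "a \<in> U" using a by simp
  qed
next
  assume "\<forall>a. poly_coeff p a \<noteq> 0 \<longrightarrow> a \<in> U"
  then show "p \<in> mono_ideal U"
    by (auto simp: mono_ideal_def in_keys_iff poly_coeff_expo_vec[symmetric])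
qed

lemma ideal_monomial_module:
  fixes U :: "('v::{finite,linorder} \<Rightarrow> int) set"
  assumes U: "upset U"
  shows "monomial_module (ideal_module (mono_ideal U :: ('v, 'k::field) mpoly set)) U poly_coeff"
proof
  let ?J = "mono_ideal U :: ('v, 'k) mpoly set"
  let ?M = "ideal_module ?J"
  have M: "carrier ?M = ?J" "\<zero>\<^bsub>?M\<^esub> = 0" "add ?M = (+)" "smult ?M = (*)"
    by (simp_all add: ideal_module_def poly_module_def)
  show "b \<in> U" if "a \<in> U" "c \<in> U" "a \<le> b" "b \<le> c" for a b c using upset_mono[OF U that(1,3)] .
  show "bij_betw poly_coeff (carrier ?M) (finite_fns U)"
    unfolding bij_betw_def M
  proof (intro conjI subset_antisym subsetI)
    show "inj_on poly_coeff ?J" by (auto simp: inj_on_def intro: poly_coeff_inj)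
    fix f assume "f \<in> poly_coeff ` ?J"
    then obtain p where "p \<in> ?J" "f = poly_coeff p" by blast
    then show "f \<in> finite_fns U"
      by (intro finite_fnsI) (simp_all add: poly_coeff_fns mem_mono_ideal_iff)
  next
    fix f :: "('v \<Rightarrow> int) \<Rightarrow> 'k" assume f: "f \<in> finite_fns U"
    obtain p where p: "poly_coeff p = f"
      using finite_fns_finite[OF f] upset_nonneg[OF U finite_fns_supp[OF f]] by (rule poly_coeff_surj)
    then have "p \<in> ?J" using finite_fns_supp[OF f] by (simp add: mem_mono_ideal_iff)
    then show "f \<in> poly_coeff ` ?J" using p by blast
  qed
  show "\<zero>\<^bsub>?M\<^esub> \<in> carrier ?M" unfolding M by (simp add: mono_ideal_def)
  show "poly_coeff \<zero>\<^bsub>?M\<^esub> a = 0" for a unfolding M by (rule poly_coeff_zero)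
  show "x \<oplus>\<^bsub>?M\<^esub> y \<in> carrier ?M" if "x \<in> carrier ?M" "y \<in> carrier ?M" for x y
    using that unfolding M by (rule mono_ideal_add)
  show "poly_coeff (x \<oplus>\<^bsub>?M\<^esub> y) a = poly_coeff x a + poly_coeff y a" for x y a
    unfolding M by (rule poly_coeff_add)
  show "Poly_Mapping.single e r \<odot>\<^bsub>?M\<^esub> x \<in> carrier ?M" if "x \<in> carrier ?M" for x e r
    using that unfolding M by (rule mono_ideal_mult[OF U])
  show "poly_coeff (Poly_Mapping.single e r \<odot>\<^bsub>?M\<^esub> x) a
      = (if a \<in> U then r * poly_coeff x (a - expo_vec e) else 0)"
    if x: "x \<in> carrier ?M" for x e r a
  proof -
    have "Poly_Mapping.single e r * x \<in> ?J" using x unfolding M by (rule mono_ideal_mult[OF U])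
    then have "poly_coeff (Poly_Mapping.single e r * x) a \<noteq> 0 \<Longrightarrow> a \<in> U"
      by (simp add: mem_mono_ideal_iff)
    then show ?thesis unfolding M by (auto simp: poly_coeff_single_mult)
  qed
qed

definition compl_exps :: "('v \<Rightarrow> int) set \<Rightarrow> ('v \<Rightarrow> int) set" where
  "compl_exps U = {a. 0 \<le> a \<and> a \<notin> U}"

text \<open>Off \<open>U\<close> the coefficients are constant on a coset of the monomial ideal, so any representative
  will do.\<close>

definition coset_coeff ::
  "('v::finite \<Rightarrow> int) set \<Rightarrow> ('v, 'k::field) mpoly set \<Rightarrow> ('v \<Rightarrow> int) \<Rightarrow> 'k" where
  "coset_coeff U X a = (if a \<in> compl_exps U then poly_coeff (SOME p. p \<in> X) a else 0)"

abbreviation poly_coset :: "('v, 'k::field) mpoly set \<Rightarrow> ('v, 'k) mpoly \<Rightarrow> ('v, 'k) mpoly set" where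
  "poly_coset J p \<equiv> J +>\<^bsub>poly_module\<^esub> p"

lemma poly_coset_eq: "poly_coset J p = {x. x - p \<in> J}"
proof -
  have "x \<in> (\<lambda>h. h + p) ` J \<longleftrightarrow> x - p \<in> J" for x
    by (metis (no_types, lifting) diff_add_cancel image_iff add_diff_cancel)
  then show ?thesis by (auto simp: a_r_coset_def r_coset_def poly_module_def)
qed

lemma mono_ideal_diff:
  "p \<in> mono_ideal U \<Longrightarrow> q \<in> mono_ideal U
    \<Longrightarrow> (p - q :: ('v::finite, 'k::field) mpoly) \<in> mono_ideal U"
  unfolding mem_mono_ideal_iff poly_coeff_diff by (metis diff_zero)

lemma poly_coset_cong:
  fixes p q :: "('v::finite, 'k::field) mpoly"
  assumes "p - q \<in> mono_ideal U"
  shows "poly_coset (mono_ideal U) p = poly_coset (mono_ideal U) q"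
proof -
  have "x - p \<in> mono_ideal U \<longleftrightarrow> x - q \<in> mono_ideal U" for x
    using mono_ideal_add[OF _ assms, of "x - p"] mono_ideal_diff[OF _ assms, of "x - q"]
    by auto
  then show ?thesis unfolding poly_coset_eq by simp
qed

lemma coset_coeff_coset:
  fixes p :: "('v::finite, 'k::field) mpoly"
  shows
  "coset_coeff U (poly_coset (mono_ideal U) p) a
    = (if a \<in> compl_exps U then poly_coeff p a else 0)"
proof -
  let ?q = "SOME x. x \<in> poly_coset (mono_ideal U) p"
  have "p \<in> poly_coset (mono_ideal U) p" by (simp add: poly_coset_eq mono_ideal_def)
  then have "?q \<in> poly_coset (mono_ideal U) p" by (rule someI)
  then have "?q - p \<in> mono_ideal U" by (simp add: poly_coset_eq)
  then have "poly_coeff ?q a = poly_coeff p a" if "a \<notin> U"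
    using that by (auto simp: mem_mono_ideal_iff poly_coeff_diff)
  then show ?thesis by (simp add: coset_coeff_def compl_exps_def)
qed

lemma quot_module_simps:
  shows "carrier (quot_module poly_module J) = poly_coset J ` UNIV"
    and "\<zero>\<^bsub>quot_module poly_module J\<^esub> = J"
    and "add (quot_module poly_module J) = set_add poly_module"
    and "smult (quot_module poly_module J) r X = (\<Union>x\<in>X. poly_coset J (r * x))"
  by (auto simp: quot_module_def A_RCOSETS_def RCOSETS_def a_r_coset_def poly_module_def)

lemma mem_set_add_poly_module: "x \<in> set_add poly_module A B \<longleftrightarrow> (\<exists>y\<in>A. \<exists>z\<in>B. x = y + z)"
  by (auto simp: set_add_def set_mult_def poly_module_def)

lemma poly_coset_set_add:
  fixes p q :: "('v::finite, 'k::field) mpoly"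
  assumes "mono_ideal U \<subseteq> (mono_ideal V :: ('v, 'k) mpoly set)"
  shows "set_add poly_module (poly_coset (mono_ideal V) p) (poly_coset (mono_ideal U) q)
    = poly_coset (mono_ideal V) (p + q)"
proof (intro subset_antisym subsetI)
  fix x assume "x \<in> set_add poly_module (poly_coset (mono_ideal V) p) (poly_coset (mono_ideal U) q)"
  then obtain y z where x: "x = y + z" "y - p \<in> mono_ideal V" "z - q \<in> mono_ideal V"
    using assms unfolding mem_set_add_poly_module poly_coset_eq by blast
  have "x - (p + q) = (y - p) + (z - q)" by (simp add: x)
  then show "x \<in> poly_coset (mono_ideal V) (p + q)"
    using mono_ideal_add[OF x(2,3)] by (simp only: poly_coset_eq mem_Collect_eq)
next
  fix x assume "x \<in> poly_coset (mono_ideal V) (p + q)"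
  then have "(x - q) - p \<in> mono_ideal V" by (simp add: poly_coset_eq algebra_simps)
  moreover have "q - q \<in> mono_ideal U" by (simp add: mono_ideal_def)
  moreover have "x = (x - q) + q" by simp
  ultimately show "x \<in> set_add poly_module (poly_coset (mono_ideal V) p) (poly_coset (mono_ideal U) q)"
    unfolding mem_set_add_poly_module poly_coset_eq by blast
qed

lemma poly_coset_zero: "poly_coset (mono_ideal U) 0 = mono_ideal U"
  by (simp add: poly_coset_eq)

lemma quot_proj_coset:
  fixes p :: "('v::finite, 'k::field) mpoly"
  assumes "mono_ideal U \<subseteq> (mono_ideal V :: ('v, 'k) mpoly set)"
  shows "quot_proj (mono_ideal V) (poly_coset (mono_ideal U) p) = poly_coset (mono_ideal V) p"
  using poly_coset_set_add[OF assms, of 0 p] by (simp add: quot_proj_def poly_coset_zero)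

lemma quot_monomial_module:
  fixes U :: "('v::{finite,linorder} \<Rightarrow> int) set"
  assumes U: "upset U"
  shows "monomial_module (quot_module poly_module (mono_ideal U :: ('v, 'k::field) mpoly set))
    (compl_exps U) (coset_coeff U)"
proof
  let ?J = "mono_ideal U :: ('v, 'k) mpoly set"
  let ?M = "quot_module poly_module ?J"
  note M = quot_module_simps[of ?J]
  have smult: "Poly_Mapping.single e r \<odot>\<^bsub>?M\<^esub> poly_coset ?J p = poly_coset ?J (Poly_Mapping.single e r * p)"
    for e r p
  proof -
    have "poly_coset ?J (Poly_Mapping.single e r * x) = poly_coset ?J (Poly_Mapping.single e r * p)"
      if "x \<in> poly_coset ?J p" for x
    proof (rule poly_coset_cong)
      have "Poly_Mapping.single e r * (x - p) \<in> ?J"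
        using that by (intro mono_ideal_mult[OF U]) (simp add: poly_coset_eq)
      then show "Poly_Mapping.single e r * x - Poly_Mapping.single e r * p \<in> ?J"
        by (simp add: right_diff_distrib)
    qed
    moreover have "p \<in> poly_coset ?J p" by (simp add: poly_coset_eq mono_ideal_def)
    ultimately show ?thesis unfolding M by blast
  qed
  show "b \<in> compl_exps U"
    if "a \<in> compl_exps U" "c \<in> compl_exps U" "a \<le> b" "b \<le> c" for a b c
    using that upset_mono[OF U] order_trans[of 0 a b] unfolding compl_exps_def by blast
  show "bij_betw (coset_coeff U) (carrier ?M) (finite_fns (compl_exps U))"
    unfolding bij_betw_def M
  proof (intro conjI subset_antisym subsetI)
    show "inj_on (coset_coeff U) (range (poly_coset ?J))"
    proof (rule inj_onI, clarify)
      fix p q :: "('v, 'k) mpoly"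
      assume eq: "coset_coeff U (poly_coset ?J p) = coset_coeff U (poly_coset ?J q)"
      have "poly_coeff p a = poly_coeff q a" if "a \<notin> U" for a
        using fun_cong[OF eq, of a] that
        by (cases "0 \<le> a") (auto simp: coset_coeff_coset compl_exps_def poly_coeff_def)
      then have "p - q \<in> ?J" by (auto simp: mem_mono_ideal_iff poly_coeff_diff)
      then show "poly_coset ?J p = poly_coset ?J q" by (rule poly_coset_cong)
    qed
    fix f assume "f \<in> coset_coeff U ` range (poly_coset ?J)"
    then obtain p where f: "f = coset_coeff U (poly_coset ?J p)" by blast
    show "f \<in> finite_fns (compl_exps U)"
    proof (rule finite_fnsI)
      have "{a. f a \<noteq> 0} \<subseteq> {a. poly_coeff p a \<noteq> 0}" by (auto simp: f coset_coeff_coset)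
      then show "finite {a. f a \<noteq> 0}" using poly_coeff_fns by (rule finite_subset)
      show "a \<in> compl_exps U" if "f a \<noteq> 0" for a
        using that by (auto simp: f coset_coeff_coset split: if_splits)
    qed
  next
    fix f :: "('v \<Rightarrow> int) \<Rightarrow> 'k" assume f: "f \<in> finite_fns (compl_exps U)"
    have "0 \<le> a" if "f a \<noteq> 0" for a using finite_fns_supp[OF f that] by (simp add: compl_exps_def)
    with finite_fns_finite[OF f] obtain p where p: "poly_coeff p = f" by (rule poly_coeff_surj)
    have "f = coset_coeff U (poly_coset ?J p)"
      using finite_fns_supp[OF f] by (auto simp: coset_coeff_coset p fun_eq_iff)
    then show "f \<in> coset_coeff U ` range (poly_coset ?J)" by blast
  qed
  show "\<zero>\<^bsub>?M\<^esub> \<in> carrier ?M"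
    unfolding M using poly_coset_zero[of U, where ?'b = 'k] by (metis rangeI)
  show "coset_coeff U \<zero>\<^bsub>?M\<^esub> a = 0" for a
    unfolding M using coset_coeff_coset[of U "0 :: ('v, 'k) mpoly" a]
    by (simp add: poly_coset_zero poly_coeff_zero)
  fix x assume "x \<in> carrier ?M"
  then obtain p where p: "x = poly_coset ?J p" unfolding M by blast
  show "Poly_Mapping.single e r \<odot>\<^bsub>?M\<^esub> x \<in> carrier ?M" for e r
    unfolding p smult unfolding M by blast
  show "coset_coeff U (Poly_Mapping.single e r \<odot>\<^bsub>?M\<^esub> x) a
      = (if a \<in> compl_exps U then r * coset_coeff U x (a - expo_vec e) else 0)" for e r a
  proof -
    have "poly_coeff p (a - expo_vec e) = 0"
      if "a \<in> compl_exps U" "a - expo_vec e \<notin> compl_exps U"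
    proof (cases "0 \<le> a - expo_vec e")
      case True
      then have "a - expo_vec e \<in> U" using that(2) by (simp add: compl_exps_def)
      moreover have "a - expo_vec e \<le> a" by (simp add: le_fun_def expo_vec_def)
      ultimately have "a \<in> U" by (rule upset_mono[OF U])
      then show ?thesis using that(1) by (simp add: compl_exps_def)
    qed (simp add: poly_coeff_def)
    then show ?thesis unfolding p smult by (simp add: coset_coeff_coset poly_coeff_single_mult)
  qed
  fix y assume "y \<in> carrier ?M"
  then obtain q where q: "y = poly_coset ?J q" unfolding M by blast
  have add: "x \<oplus>\<^bsub>?M\<^esub> y = poly_coset ?J (p + q)"
    unfolding p q M by (rule poly_coset_set_add) simp
  show "x \<oplus>\<^bsub>?M\<^esub> y \<in> carrier ?M" unfolding add unfolding M by blast
  show "coset_coeff U (x \<oplus>\<^bsub>?M\<^esub> y) a = coset_coeff U x a + coset_coeff U y a" for a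
    unfolding add unfolding p q by (simp add: coset_coeff_coset poly_coeff_add)
qed

section \<open>Comparing two monomial ideals with the saturation property\<close>

definition pos_part :: "('v \<Rightarrow> int) \<Rightarrow> 'v \<Rightarrow> int" where
  "pos_part a = (\<lambda>v. max 0 (a v))"

lemma pos_part_nonneg: "0 \<le> pos_part a"
  by (simp add: pos_part_def le_fun_def)

lemma le_pos_part: "a \<le> pos_part a"
  by (simp add: pos_part_def le_fun_def)

lemma neg_part_on:
  "(\<And>v. v \<notin> \<sigma> \<Longrightarrow> 0 \<le> a v) \<Longrightarrow> pos_part a - a \<in> vecs_on \<sigma>"
  by (auto simp: vecs_on_def pos_part_def le_fun_def)

lemma localized_upset_iff:
  assumes "upset U"
  shows "a \<in> loc_exps U \<sigma> \<longleftrightarrow> (\<exists>g\<in>vecs_on \<sigma>. a + g \<in> U)"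
proof
  assume "a \<in> loc_exps U \<sigma>"
  then obtain g where g: "g \<in> vecs_on \<sigma>" "\<forall>h\<in>vecs_on \<sigma>. a + (g + h) \<in> U"
    by (auto simp: loc_exps_def)
  have "a + (g + 0) \<in> U" using g(2) vecs_on_zero by blast
  then show "\<exists>g\<in>vecs_on \<sigma>. a + g \<in> U" using g(1) by auto
next
  assume "\<exists>g\<in>vecs_on \<sigma>. a + g \<in> U"
  then obtain g where g: "g \<in> vecs_on \<sigma>" "a + g \<in> U" by blast
  have "a + (g + h) \<in> U" if h: "h \<in> vecs_on \<sigma>" for h
  proof (rule upset_mono[OF assms g(2)])
    show "a + g \<le> a + (g + h)" using vecs_on_nonneg[OF h] by (simp add: le_fun_def)
  qed
  then show "a \<in> loc_exps U \<sigma>" using g(1) unfolding loc_exps_def by blast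
qed

lemma localized_upset_mono:
  assumes "upset U" "a \<in> loc_exps U \<sigma>" "\<sigma> \<subseteq> \<tau>"
  shows "a \<in> loc_exps U \<tau>"
  using assms vecs_on_mono[OF assms(3)] unfolding localized_upset_iff[OF assms(1)] by blast

lemma localized_upset_subset:
  assumes "upset U" "upset V" "U \<subseteq> V"
  shows "loc_exps U \<sigma> \<subseteq> loc_exps V \<sigma>"
proof
  fix a assume "a \<in> loc_exps U \<sigma>"
  then have "\<exists>g\<in>vecs_on \<sigma>. a + g \<in> U" by (simp only: localized_upset_iff[OF assms(1)])
  then show "a \<in> loc_exps V \<sigma>" unfolding localized_upset_iff[OF assms(2)] using assms(3) by blast
qed

lemma localized_upset_nonneg:
  assumes "upset U" "a \<in> loc_exps U \<sigma>" "v \<notin> \<sigma>"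
  shows "0 \<le> a v"
proof -
  obtain g where g: "g \<in> vecs_on \<sigma>" "a + g \<in> U"
    using assms(2) unfolding localized_upset_iff[OF assms(1)] by blast
  then have "0 \<le> (a + g) v" using upset_nonneg[OF assms(1) g(2)] by (simp add: le_fun_def)
  then show ?thesis using g(1) assms(3) by (simp add: vecs_on_def)
qed

lemma localized_complement_iff:
  assumes "upset U"
  shows "a \<in> loc_exps (compl_exps U) \<sigma>
    \<longleftrightarrow> (\<forall>v. v \<notin> \<sigma> \<longrightarrow> 0 \<le> a v) \<and> (\<forall>g\<in>vecs_on \<sigma>. a + g \<notin> U)"
proof
  assume "a \<in> loc_exps (compl_exps U) \<sigma>"
  then obtain g where g: "g \<in> vecs_on \<sigma>" "\<And>h. h \<in> vecs_on \<sigma> \<Longrightarrow> a + (g + h) \<in> compl_exps U"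
    by (auto simp: loc_exps_def)
  have "0 \<le> a v" if "v \<notin> \<sigma>" for v
  proof -
    have "0 \<le> a + (g + 0)" using g(2)[OF vecs_on_zero] by (simp add: compl_exps_def)
    then have "0 \<le> (a + (g + 0)) v" by (simp only: le_fun_def zero_fun_apply)
    then show ?thesis using g(1) that by (simp add: vecs_on_def)
  qed
  moreover have "a + h \<notin> U" if h: "h \<in> vecs_on \<sigma>" for h
  proof
    assume "a + h \<in> U"
    moreover have "a + h \<le> a + (g + h)" using vecs_on_nonneg[OF g(1)] by (simp add: le_fun_def)
    ultimately have "a + (g + h) \<in> U" by (rule upset_mono[OF assms])
    then show False using g(2)[OF h] by (simp add: compl_exps_def)
  qed
  ultimately show "(\<forall>v. v \<notin> \<sigma> \<longrightarrow> 0 \<le> a v) \<and> (\<forall>g\<in>vecs_on \<sigma>. a + g \<notin> U)" by blast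
next
  assume a: "(\<forall>v. v \<notin> \<sigma> \<longrightarrow> 0 \<le> a v) \<and> (\<forall>g\<in>vecs_on \<sigma>. a + g \<notin> U)"
  have g: "pos_part a - a \<in> vecs_on \<sigma>" using a by (intro neg_part_on) blast
  have "a + ((pos_part a - a) + h) \<in> compl_exps U" if h: "h \<in> vecs_on \<sigma>" for h
  proof -
    have "0 \<le> pos_part a + h" using pos_part_nonneg vecs_on_nonneg[OF h] by (rule add_nonneg_vec)
    moreover have "a + ((pos_part a - a) + h) = pos_part a + h" by simp
    ultimately have "0 \<le> a + ((pos_part a - a) + h)" by simp
    then show ?thesis using a vecs_on_add[OF g h] unfolding compl_exps_def by blast
  qed
  then show "a \<in> loc_exps (compl_exps U) \<sigma>"
    using g unfolding loc_exps_def by blast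
qed

text \<open>Two monomial ideals \<open>I \<subseteq> J\<close>, with exponent sets \<open>U\<close> and \<open>V\<close>, such that \<open>I : x\<^sup>a\<close> and \<open>J : x\<^sup>a\<close>
  have the same radical for every monomial \<open>x\<^sup>a\<close> outside \<open>J\<close>, with the exponent 2 sufficing to pass
  from one to the other.\<close>

locale saturated_pair =
  fixes U V :: "('v::{finite,linorder} \<Rightarrow> int) set"
  assumes upset_U: "upset U" and upset_V: "upset V" and subset: "U \<subseteq> V"
    and saturated: "0 \<le> a \<Longrightarrow> a \<notin> V \<Longrightarrow> 0 \<le> b \<Longrightarrow> a + b \<in> V \<Longrightarrow> a + b + b \<in> U"
begin

text \<open>Saturation transferred from \<open>pos_part a\<close> to \<open>a\<close>: the two differ by a monomial in the inverted
  variables.\<close>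

lemma saturated_shift:
  assumes "pos_part a \<notin> V" "\<And>v. v \<notin> \<sigma> \<Longrightarrow> 0 \<le> a v" "g \<in> vecs_on \<sigma>" "a + g \<in> V"
  shows "\<exists>h\<in>vecs_on \<sigma>. a + h \<in> U"
proof -
  have "a + g \<le> pos_part a + g" using le_pos_part[of a] by (simp add: le_fun_def)
  then have "pos_part a + g \<in> V" using upset_mono[OF upset_V assms(4)] by blast
  then have "pos_part a + g + g \<in> U"
    by (rule saturated[OF pos_part_nonneg assms(1) vecs_on_nonneg[OF assms(3)]])
  moreover have "pos_part a + g + g = a + ((pos_part a - a) + (g + g))" by simp
  moreover have "(pos_part a - a) + (g + g) \<in> vecs_on \<sigma>"
    using assms(2,3) by (intro vecs_on_add neg_part_on)
  ultimately show ?thesis by metis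
qed

lemma localized_upset_eq:
  assumes "pos_part a \<notin> V" "a \<in> loc_exps V \<sigma>"
  shows "a \<in> loc_exps U \<sigma>"
proof -
  obtain g where g: "g \<in> vecs_on \<sigma>" "a + g \<in> V"
    using assms(2) unfolding localized_upset_iff[OF upset_V] by blast
  show ?thesis
    unfolding localized_upset_iff[OF upset_U]
    using localized_upset_nonneg[OF upset_V assms(2)] by (rule saturated_shift[OF assms(1) _ g])
qed

lemma localized_complement_eq:
  assumes "pos_part a \<notin> V" "a \<in> loc_exps (compl_exps U) \<sigma>"
  shows "a \<in> loc_exps (compl_exps V) \<sigma>"
proof -
  have a: "\<And>v. v \<notin> \<sigma> \<Longrightarrow> 0 \<le> a v" "\<And>g. g \<in> vecs_on \<sigma> \<Longrightarrow> a + g \<notin> U"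
    using assms(2) unfolding localized_complement_iff[OF upset_U] by blast+
  have "a + g \<notin> V" if g: "g \<in> vecs_on \<sigma>" for g
    using saturated_shift[OF assms(1) a(1) g] a(2) by blast
  then show ?thesis using a(1) unfolding localized_complement_iff[OF upset_V] by blast
qed

lemma localized_complement_subset:
  "loc_exps (compl_exps V) \<sigma> \<subseteq> loc_exps (compl_exps U) \<sigma>"
proof
  fix a assume "a \<in> loc_exps (compl_exps V) \<sigma>"
  then have "(\<forall>v. v \<notin> \<sigma> \<longrightarrow> 0 \<le> a v) \<and> (\<forall>g\<in>vecs_on \<sigma>. a + g \<notin> V)"
    by (simp only: localized_complement_iff[OF upset_V])
  then show "a \<in> loc_exps (compl_exps U) \<sigma>"
    unfolding localized_complement_iff[OF upset_U] using subset by blast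
qed

lemma localized_complement_pos_part:
  assumes "a \<in> loc_exps (compl_exps V) \<sigma>"
  shows "pos_part a \<notin> V"
proof -
  have a: "\<And>v. v \<notin> \<sigma> \<Longrightarrow> 0 \<le> a v" "\<And>g. g \<in> vecs_on \<sigma> \<Longrightarrow> a + g \<notin> V"
    using assms unfolding localized_complement_iff[OF upset_V] by blast+
  have "a + (pos_part a - a) \<notin> V" using a(1) by (intro a(2) neg_part_on)
  then show ?thesis by simp
qed

abbreviation quot_U :: "('v \<Rightarrow> int) set" where "quot_U \<equiv> compl_exps U"
abbreviation quot_V :: "('v \<Rightarrow> int) set" where "quot_V \<equiv> compl_exps V"

definition restrict_cochain :: "('v, 'k::field) laurent_cochain \<Rightarrow> ('v, 'k) laurent_cochain" where
  "restrict_cochain F = (\<lambda>\<sigma> a. if a \<in> loc_exps quot_V \<sigma> then F \<sigma> a else 0)"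

lemma restrict_cochain_fns:
  "F \<in> cech_fns quot_U p \<Longrightarrow> restrict_cochain F \<in> cech_fns quot_V p"
  unfolding restrict_cochain_def
  by (rule cech_fnsI, rule finite_fns_restrict, rule cech_fnsD)

text \<open>Restriction is a chain map: if a coordinate survives for \<open>S/I\<close> localized at \<open>\<tau> - {j}\<close> and for
  \<open>S/J\<close> localized at \<open>\<tau>\<close>, then it survives for \<open>S/J\<close> localized at \<open>\<tau> - {j}\<close>.\<close>

lemma cech_d_restrict_cochain:
  assumes "F \<in> cech_fns quot_U p" "card \<tau> = Suc p"
  shows "cech_d quot_V (restrict_cochain F) \<tau> = restrict_cochain (cech_d quot_U F) \<tau>"
proof
  fix a
  show "cech_d quot_V (restrict_cochain F) \<tau> a = restrict_cochain (cech_d quot_U F) \<tau> a"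
  proof (cases "a \<in> loc_exps quot_V \<tau>")
    case True
    have "restrict_cochain F (\<tau> - {j}) a = F (\<tau> - {j}) a" if j: "j \<in> \<tau>" for j
    proof (cases "F (\<tau> - {j}) a = 0")
      case False
      then have "a \<in> loc_exps quot_U (\<tau> - {j})"
        using cech_fnsD[OF assms(1) card_Diff_Suc[OF assms(2) j]] finite_fns_supp by blast
      then have "\<forall>v. v \<notin> \<tau> - {j} \<longrightarrow> 0 \<le> a v"
        unfolding localized_complement_iff[OF upset_U] by blast
      moreover have "a + g \<notin> V" if "g \<in> vecs_on (\<tau> - {j})" for g
        using True vecs_on_mono[OF Diff_subset that] unfolding localized_complement_iff[OF upset_V] by blast
      ultimately have "a \<in> loc_exps quot_V (\<tau> - {j})"
        unfolding localized_complement_iff[OF upset_V] by blast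
      then show ?thesis by (simp add: restrict_cochain_def)
    qed (simp add: restrict_cochain_def)
    moreover have "a \<in> loc_exps quot_U \<tau>" using True localized_complement_subset by blast
    ultimately show ?thesis using True by (simp add: cech_d_def restrict_cochain_def)
  qed (simp add: cech_d_def restrict_cochain_def)
qed

lemma restrict_cochain_coboundary:
  assumes "coboundary quot_U p G"
  shows "coboundary quot_V p (restrict_cochain G)"
proof (cases p)
  case 0
  then show ?thesis using assms by (auto simp: coboundary_def restrict_cochain_def)
next
  case (Suc q)
  obtain H where H: "H \<in> cech_fns quot_U q" "\<And>\<sigma>. card \<sigma> = p \<Longrightarrow> G \<sigma> = cech_d quot_U H \<sigma>"
    using assms Suc by (auto simp: coboundary_def)
  have "restrict_cochain G \<sigma> = cech_d quot_V (restrict_cochain H) \<sigma>" if \<sigma>: "card \<sigma> = p" for \<sigma>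
  proof -
    have "restrict_cochain G \<sigma> = restrict_cochain (cech_d quot_U H) \<sigma>"
      unfolding restrict_cochain_def H(2)[OF \<sigma>] ..
    then show ?thesis using cech_d_restrict_cochain[OF H(1)] \<sigma> Suc by simp
  qed
  then show ?thesis using restrict_cochain_fns[OF H(1)] Suc unfolding coboundary_def by auto
qed

lemma restrict_cochain_cocycle:
  assumes "cocycle quot_U p F"
  shows "cocycle quot_V p (restrict_cochain F)"
proof -
  have F: "F \<in> cech_fns quot_U p" using assms by (simp add: cocycle_def)
  have "restrict_cochain (cech_d quot_U F) \<tau> = (\<lambda>a. 0)" if "card \<tau> = Suc p" for \<tau>
    using assms that by (auto simp: cocycle_def restrict_cochain_def fun_eq_iff)
  then show ?thesis
    unfolding cocycle_def using restrict_cochain_fns[OF F] cech_d_restrict_cochain[OF F] by simp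
qed

text \<open>The same functions serve as a cocycle of \<open>S/I\<close>.  A coordinate of \<open>F\<close> has positive part outside
  \<open>V\<close>, and at such exponents the localizations of \<open>S/I\<close> and \<open>S/J\<close> agree, so the differential of
  \<open>S/I\<close> has no additional component.\<close>

lemma quot_cocycle_lift:
  assumes "cocycle quot_V p F"
  shows "cocycle quot_U p F" "\<And>\<sigma>. card \<sigma> = p \<Longrightarrow> restrict_cochain F \<sigma> = F \<sigma>"
proof -
  have F: "F \<in> cech_fns quot_V p" using assms by (simp add: cocycle_def)
  have supp: "a \<in> loc_exps quot_V \<sigma>" if "card \<sigma> = p" "F \<sigma> a \<noteq> 0" for \<sigma> a
    using cech_fnsD[OF F that(1)] that(2) finite_fns_supp by blast
  then show "restrict_cochain F \<sigma> = F \<sigma>" if "card \<sigma> = p" for \<sigma>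
    using that by (auto simp: restrict_cochain_def fun_eq_iff)
  have "F \<in> cech_fns quot_U p"
  proof (rule cech_fnsI)
    fix \<sigma> :: "'v set" assume \<sigma>: "card \<sigma> = p"
    show "F \<sigma> \<in> finite_fns (loc_exps quot_U \<sigma>)"
      using finite_fns_finite[OF cech_fnsD[OF F \<sigma>]] supp[OF \<sigma>] localized_complement_subset
      by (intro finite_fnsI) auto
  qed
  moreover have "cech_d quot_U F \<tau> a = 0" if \<tau>: "card \<tau> = Suc p" for \<tau> a
  proof (cases "a \<in> loc_exps quot_U \<tau> \<and> (\<exists>j\<in>\<tau>. F (\<tau> - {j}) a \<noteq> 0)")
    case True
    then obtain j where j: "j \<in> \<tau>" "F (\<tau> - {j}) a \<noteq> 0" by blast
    then have "pos_part a \<notin> V"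
      using supp[OF card_Diff_Suc[OF \<tau> j(1)] j(2)] localized_complement_pos_part by blast
    then have "a \<in> loc_exps quot_V \<tau>" using True localized_complement_eq by blast
    moreover have "cech_d quot_V F \<tau> a = 0" using assms \<tau> by (simp add: cocycle_def)
    ultimately show ?thesis using True by (simp add: cech_d_def)
  next
    case False
    then show ?thesis by (auto simp: cech_d_def)
  qed
  ultimately show "cocycle quot_U p F" by (auto simp: cocycle_def fun_eq_iff)
qed

theorem local_cohomology_map_surjective:
  defines "I \<equiv> mono_ideal U :: ('v, 'k::field) mpoly set" and "J \<equiv> mono_ideal V"
  shows "local_cohomology_map (quot_proj J) (quot_module poly_module J) p
      ` carrier (local_cohomology (quot_module poly_module I) p)
    = carrier (local_cohomology (quot_module poly_module J) p)"
proof -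
  let ?M = "quot_module poly_module I" and ?N = "quot_module poly_module J"
  have M: "monomial_module ?M quot_U (coset_coeff U)"
    unfolding I_def by (rule quot_monomial_module[OF upset_U])
  have N: "monomial_module ?N quot_V (coset_coeff V)"
    unfolding J_def by (rule quot_monomial_module[OF upset_V])
  interpret M: monomial_module ?M quot_U "coset_coeff U" by (rule M)
  interpret N: monomial_module ?N quot_V "coset_coeff V" by (rule N)
  have IJ: "I \<subseteq> J" using subset by (auto simp: I_def J_def mono_ideal_def)
  have proj: "quot_proj J (poly_coset I x) = poly_coset J x" for x
    using quot_proj_coset IJ unfolding I_def J_def by blast
  have map: "local_cohomology_map (quot_proj J) ?N p (M.coh_class p F) = N.coh_class p (restrict_cochain F)"
    if F: "cocycle quot_U p F" for F
    unfolding restrict_cochain_def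
  proof (rule local_cohomology_map_class[OF M N])
    show "F \<in> cech_fns quot_U p" using F by (simp add: cocycle_def)
    fix m assume "m \<in> carrier ?M"
    then obtain x where m: "m = poly_coset I x" unfolding quot_module_simps by blast
    show "quot_proj J m \<in> carrier ?N" unfolding m proj quot_module_simps by blast
    show "coset_coeff V (quot_proj J m) a = (if a \<in> quot_V then coset_coeff U m a else 0)" for a
      unfolding m proj unfolding I_def J_def coset_coeff_coset
      using subset by (auto simp: compl_exps_def)
  next
    fix \<sigma> a e
    assume a: "a \<in> loc_exps quot_V \<sigma>" and e: "e \<in> vecs_on \<sigma>" and ae: "a + e \<in> quot_U"
    have "a + e \<notin> V" using a e unfolding localized_complement_iff[OF upset_V] by blast
    then show "a + e \<in> quot_V \<and> a \<in> loc_exps quot_U \<sigma>"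
      using a ae localized_complement_subset unfolding compl_exps_def by blast
  next
    fix G :: "('v, 'k) laurent_cochain" assume "coboundary quot_U p G"
    then show "coboundary quot_V p (\<lambda>\<sigma> a. if a \<in> loc_exps quot_V \<sigma> then G \<sigma> a else 0)"
      using restrict_cochain_coboundary unfolding restrict_cochain_def by blast
  qed
  show ?thesis
  proof (intro subset_antisym subsetI)
    fix y assume "y \<in> local_cohomology_map (quot_proj J) ?N p ` carrier (local_cohomology ?M p)"
    then obtain F where F: "cocycle quot_U p F" "y = N.coh_class p (restrict_cochain F)"
      using map by (auto simp: M.local_cohomology_carrier)
    then show "y \<in> carrier (local_cohomology ?N p)"
      using restrict_cochain_cocycle unfolding N.local_cohomology_carrier by blast
  next
    fix y assume "y \<in> carrier (local_cohomology ?N p)"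
    then obtain F where F: "cocycle quot_V p F" "y = N.coh_class p F"
      unfolding N.local_cohomology_carrier by blast
    have "N.cochain_of p (restrict_cochain F) = N.cochain_of p F"
      using quot_cocycle_lift(2)[OF F(1)] by (rule N.cochain_of_cong)
    then have "y = N.coh_class p (restrict_cochain F)" unfolding F(2) N.coh_class_def by simp
    then have "y = local_cohomology_map (quot_proj J) ?N p (M.coh_class p F)"
      using map quot_cocycle_lift(1)[OF F(1)] by simp
    then show "y \<in> local_cohomology_map (quot_proj J) ?N p ` carrier (local_cohomology ?M p)"
      using quot_cocycle_lift(1)[OF F(1)] unfolding M.local_cohomology_carrier by blast
  qed
qed

end

section \<open>Homogeneous cohomology classes and regularity\<close>

lemma mono_deg_eq: "mono_deg e = sum (expo_vec e) UNIV"
  by (simp add: mono_deg_def expo_vec_def)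

definition homogeneous_cochain :: "nat \<Rightarrow> int \<Rightarrow> ('v::finite, 'k::field) laurent_cochain \<Rightarrow> bool" where
  "homogeneous_cochain p d F \<longleftrightarrow> (\<forall>\<sigma> a. card \<sigma> = p \<longrightarrow> F \<sigma> a \<noteq> 0 \<longrightarrow> sum a UNIV = d)"

context monomial_module
begin

lemma cech_term_degree_eq:
  assumes D: "\<And>d. D d = {m \<in> carrier M. \<forall>a. rep m a \<noteq> 0 \<longrightarrow> sum a UNIV = d}"
  shows "cech_term_degree M D \<sigma> d
    = frac_class \<sigma> ` {f \<in> finite_fns (Tloc \<sigma>). \<forall>a. f a \<noteq> 0 \<longrightarrow> sum a UNIV = d}"
proof (intro subset_antisym subsetI)
  fix X assume "X \<in> cech_term_degree M D \<sigma> d"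
  then obtain m e where e: "Poly_Mapping.keys e \<subseteq> \<sigma>" and m: "m \<in> D (d + mono_deg e)"
    and X: "X = fraction M (monomials_on \<sigma>) m (monomial e)"
    unfolding cech_term_degree_def by blast
  have mM: "m \<in> carrier M" using m by (simp add: D)
  have s: "monomial e \<in> (monomials_on \<sigma> :: ('v, 'k) mpoly set)" using e unfolding monomials_on_def by blast
  have "sum a UNIV = d" if "frac_coeff \<sigma> (m, monomial e) a \<noteq> 0" for a
  proof -
    have "rep m (a + expo_vec e) \<noteq> 0" using that by (auto simp: frac_coeff_apply split: if_splits)
    then have "sum (a + expo_vec e) UNIV = d + mono_deg e" using m unfolding D by blast
    then show ?thesis by (simp add: mono_deg_eq sum.distrib)
  qed
  then show "X \<in> frac_class \<sigma> ` {f \<in> finite_fns (Tloc \<sigma>). \<forall>a. f a \<noteq> 0 \<longrightarrow> sum a UNIV = d}"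
    unfolding X fraction_eq[OF mM s] using frac_coeff_fns[OF mM s] by blast
next
  fix X assume "X \<in> frac_class \<sigma> ` {f \<in> finite_fns (Tloc \<sigma>). \<forall>a. f a \<noteq> 0 \<longrightarrow> sum a UNIV = d}"
  then obtain f where f: "f \<in> finite_fns (Tloc \<sigma>)" "\<And>a. f a \<noteq> 0 \<Longrightarrow> sum a UNIV = d"
    and X: "X = frac_class \<sigma> f" by blast
  obtain m e where m: "m \<in> carrier M" "Poly_Mapping.keys e \<subseteq> \<sigma>"
      "frac_coeff \<sigma> (m, monomial e) = f" "\<And>b. rep m b = f (b - expo_vec e)"
    using finite_fns_frac_coeff[OF f(1)] by blast
  have "sum b UNIV = d + mono_deg e" if "rep m b \<noteq> 0" for b
  proof -
    have "sum (b - expo_vec e) UNIV = d" using that f(2) m(4) by metis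
    then show ?thesis by (simp add: mono_deg_eq sum_subtractf)
  qed
  then have "m \<in> D (d + mono_deg e)" using m(1) by (simp add: D)
  moreover have "X = fraction M (monomials_on \<sigma>) m (monomial e)"
  proof -
    have "monomial e \<in> (monomials_on \<sigma> :: ('v, 'k) mpoly set)"
      using m(2) unfolding monomials_on_def by blast
    then show ?thesis using fraction_eq[OF m(1)] m(3) X by simp
  qed
  ultimately show "X \<in> cech_term_degree M D \<sigma> d"
    using m(2) unfolding cech_term_degree_def by blast
qed

lemma local_cohomology_degree_eq:
  assumes D: "\<And>d. D d = {m \<in> carrier M. \<forall>a. rep m a \<noteq> 0 \<longrightarrow> sum a UNIV = d}"
  shows "local_cohomology_degree M D p d
    = coh_class p ` {F. cocycle T p F \<and> homogeneous_cochain p d F}"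
proof -
  have "(\<forall>\<sigma>. card \<sigma> = p \<longrightarrow> cochain_of p F \<sigma> \<in> cech_term_degree M D \<sigma> d) \<longleftrightarrow> homogeneous_cochain p d F"
    if F: "cocycle T p F" for F
  proof -
    have "cochain_of p F \<sigma> \<in> cech_term_degree M D \<sigma> d \<longleftrightarrow> (\<forall>a. F \<sigma> a \<noteq> 0 \<longrightarrow> sum a UNIV = d)"
      if \<sigma>: "card \<sigma> = p" for \<sigma>
    proof -
      have fns: "F \<sigma> \<in> finite_fns (Tloc \<sigma>)" using F \<sigma> by (auto simp: cocycle_def intro: cech_fnsD)
      show ?thesis
        unfolding cochain_of_apply[OF \<sigma>] cech_term_degree_eq[where D = D, OF D]
        using fns frac_class_eqD[OF fns] by (auto simp: image_iff)
    qed
    then show ?thesis unfolding homogeneous_cochain_def by blast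
  qed
  then show ?thesis
    unfolding local_cohomology_degree_def cocycles_eq coh_class_def by blast
qed

lemma local_cohomology_degree_nonzero_iff:
  assumes D: "\<And>d. D d = {m \<in> carrier M. \<forall>a. rep m a \<noteq> 0 \<longrightarrow> sum a UNIV = d}"
  shows "local_cohomology_degree M D p d \<noteq> {\<zero>\<^bsub>local_cohomology M p\<^esub>}
    \<longleftrightarrow> (\<exists>F :: ('v, 'k) laurent_cochain. cocycle T p F \<and> homogeneous_cochain p d F \<and> \<not> coboundary T p F)"
proof -
  have zero: "cocycle T p (\<lambda>\<sigma> a. 0)" "homogeneous_cochain p d (\<lambda>\<sigma> a. 0 :: 'k)"
    by (auto simp: cocycle_def cech_fns_zero cech_d_zero homogeneous_cochain_def fun_eq_iff)
  have class_zero: "coh_class p F = coboundaries M p \<longleftrightarrow> coboundary T p F" if "cocycle T p F" for F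
    using that by (intro coh_class_zero_iff) (simp add: cocycle_def)
  have "coh_class p (\<lambda>\<sigma> a. 0) \<in> local_cohomology_degree M D p d"
    unfolding local_cohomology_degree_eq[where D = D, OF D] using zero by blast
  then have "coboundaries M p \<in> local_cohomology_degree M D p d"
    unfolding iffD2[OF class_zero[OF zero(1)] coboundary_zero] .
  then have "local_cohomology_degree M D p d \<noteq> {coboundaries M p}
      \<longleftrightarrow> (\<exists>X\<in>local_cohomology_degree M D p d. X \<noteq> coboundaries M p)" by blast
  also have "\<dots> \<longleftrightarrow> (\<exists>F :: ('v, 'k) laurent_cochain. cocycle T p F \<and> homogeneous_cochain p d F \<and> \<not> coboundary T p F)"
    unfolding local_cohomology_degree_eq[where D = D, OF D] by (auto simp: class_zero)
  finally show ?thesis unfolding local_cohomology_zero .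
qed

end

lemma homogeneous_mono_ideal:
  "mono_ideal U \<inter> homogeneous_polys d
    = {p \<in> carrier (ideal_module (mono_ideal U)). \<forall>a. poly_coeff p a \<noteq> 0 \<longrightarrow> sum a UNIV = d}"
proof -
  have "p \<in> homogeneous_polys d \<longleftrightarrow> (\<forall>a. poly_coeff p a \<noteq> 0 \<longrightarrow> sum a UNIV = d)"
    for p :: "('a, 'b) mpoly"
  proof
    assume p: "p \<in> homogeneous_polys d"
    show "\<forall>a. poly_coeff p a \<noteq> 0 \<longrightarrow> sum a UNIV = d"
    proof (intro allI impI)
      fix a assume "poly_coeff p a \<noteq> 0"
      note a = poly_coeff_nonzero[OF this]
      then have "sum (expo_vec (vec_expo a)) UNIV = d"
        using p unfolding homogeneous_polys_def mono_deg_eq by blast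
      then show "sum a UNIV = d" using a by simp
    qed
  next
    assume "\<forall>a. poly_coeff p a \<noteq> 0 \<longrightarrow> sum a UNIV = d"
    then show "p \<in> homogeneous_polys d"
      by (auto simp: homogeneous_polys_def mono_deg_eq in_keys_iff poly_coeff_expo_vec[symmetric])
  qed
  then show ?thesis by (auto simp: ideal_module_def)
qed

lemma cech_sign_square: "cech_sign j \<tau> * (cech_sign j \<tau> * x) = (x :: 'k::field)"
  unfolding cech_sign_def by (simp flip: mult.assoc power_add power_mult_distrib add: mult_2[symmetric])

text \<open>The sign identity behind the contracting homotopy: removing \<open>j\<close> and inserting \<open>i\<close> anticommute.\<close>

lemma cech_sign_swap:
  fixes j :: "'v::{finite,linorder}"
  assumes "j \<in> \<tau>" "i \<notin> \<tau>"
  shows "cech_sign j \<tau> * cech_sign i (insert i (\<tau> - {j}))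
    = - (cech_sign i (insert i \<tau>) * cech_sign j (insert i \<tau>) :: 'k::field)"
proof -
  have ij: "i \<noteq> j" using assms by auto
  have 1: "{l \<in> insert i (\<tau> - {j}). l < i} = {l \<in> \<tau>. l < i} - {j}"
    and 2: "{l \<in> insert i \<tau>. l < i} = {l \<in> \<tau>. l < i}" by auto
  show ?thesis
  proof (cases "i < j")
    case True
    have "{l \<in> insert i \<tau>. l < j} = insert i {l \<in> \<tau>. l < j}" using True by auto
    moreover have "{l \<in> \<tau>. l < i} - {j} = {l \<in> \<tau>. l < i}" using True by auto
    moreover have "card (insert i {l \<in> \<tau>. l < j}) = Suc (card {l \<in> \<tau>. l < j})" using assms(2) by simp
    ultimately show ?thesis unfolding cech_sign_def 1 2 by (simp add: mult.commute)
  next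
    case False
    then have ji: "j < i" using ij by simp
    have "{l \<in> insert i \<tau>. l < j} = {l \<in> \<tau>. l < j}" using ji by auto
    moreover have "card {l \<in> \<tau>. l < i} = Suc (card ({l \<in> \<tau>. l < i} - {j}))"
      using assms(1) ji by (intro card.remove) auto
    ultimately show ?thesis unfolding cech_sign_def 1 2 by (simp add: mult.commute)
  qed
qed

context saturated_pair
begin

text \<open>This is the cocycle condition at \<open>insert i \<tau>\<close>, solved for the term that omits \<open>i\<close>.\<close>

lemma cocycle_contraction:
  fixes F :: "('v, 'k::field) laurent_cochain"
  assumes F: "cocycle V p F" and \<tau>: "card \<tau> = p" "i \<notin> \<tau>"
    and a: "a \<in> loc_exps V \<tau>"
  shows "(\<Sum>j\<in>\<tau>. cech_sign j \<tau> * (cech_sign i (insert i (\<tau> - {j})) * F (insert i (\<tau> - {j})) a)) = F \<tau> a"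
proof -
  let ?\<rho> = "insert i \<tau>"
  let ?S = "\<Sum>j\<in>\<tau>. cech_sign j ?\<rho> * F (?\<rho> - {j}) a"
  have "card ?\<rho> = Suc p" using \<tau> by simp
  then have "cech_d V F ?\<rho> a = 0" using F by (simp add: cocycle_def)
  moreover have "a \<in> loc_exps V ?\<rho>" using localized_upset_mono[OF upset_V a] by blast
  ultimately have "(\<Sum>j\<in>?\<rho>. cech_sign j ?\<rho> * F (?\<rho> - {j}) a) = 0" by (simp add: cech_d_def)
  moreover have "?\<rho> - {i} = \<tau>" using \<tau>(2) by simp
  ultimately have S: "?S = - (cech_sign i ?\<rho> * F \<tau> a)"
    using \<tau>(2) by (simp add: eq_neg_iff_add_eq_0 add.commute)
  have "(\<Sum>j\<in>\<tau>. cech_sign j \<tau> * (cech_sign i (insert i (\<tau> - {j})) * F (insert i (\<tau> - {j})) a))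
      = (\<Sum>j\<in>\<tau>. - (cech_sign i ?\<rho> * (cech_sign j ?\<rho> * F (?\<rho> - {j}) a)))"
  proof (rule sum.cong)
    fix j assume j: "j \<in> \<tau>"
    have "insert i (\<tau> - {j}) = ?\<rho> - {j}" using j \<tau>(2) by auto
    then show "cech_sign j \<tau> * (cech_sign i (insert i (\<tau> - {j})) * F (insert i (\<tau> - {j})) a)
        = - (cech_sign i ?\<rho> * (cech_sign j ?\<rho> * F (?\<rho> - {j}) a))"
      using cech_sign_swap[OF j \<tau>(2), where 'k = 'k] by (simp flip: mult.assoc)
  qed simp
  also have "\<dots> = - (cech_sign i ?\<rho> * ?S)" by (simp add: sum_negf sum_distrib_left)
  also have "\<dots> = F \<tau> a" unfolding S by (simp add: cech_sign_square)
  finally show ?thesis .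
qed

text \<open>Where \<open>pos_part a\<close> lies in \<open>V\<close>, the complex of the ideal coincides with that of the whole ring:
  \<open>a\<close> occurs at \<open>\<sigma>\<close> if and only if \<open>a\<close> is nonnegative off \<open>\<sigma>\<close>.  Adding or removing a vertex \<open>i a\<close>
  with \<open>0 \<le> a (i a)\<close> does not change this condition, and inserting that vertex is a contracting
  homotopy \<open>H\<close>.  In degree 0 the homotopy has no room, but there the cocycle itself is zero.\<close>

lemma cocycle_inside_coboundary:
  fixes F :: "('v, 'k::field) laurent_cochain"
  assumes F: "cocycle V p F" and "0 \<notin> V"
  shows "coboundary V p (\<lambda>\<sigma> a. if pos_part a \<in> V then F \<sigma> a else 0)"
proof -
  define i where "i a = (SOME v. 0 \<le> a v)" for a :: "'v \<Rightarrow> int"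
  have i: "0 \<le> a (i a)" if "pos_part a \<in> V" for a
  proof -
    have "\<exists>v. 0 \<le> a v"
    proof (rule ccontr)
      assume "\<not> ?thesis"
      then have "pos_part a = 0" by (auto simp: pos_part_def fun_eq_iff not_le intro!: max_absorb1 less_imp_le)
      then show False using \<open>pos_part a \<in> V\<close> \<open>0 \<notin> V\<close> by simp
    qed
    then show ?thesis unfolding i_def by (rule someI_ex)
  qed
  have Ffns: "F \<in> cech_fns V p" using F by (simp add: cocycle_def)
  have supp: "a \<in> loc_exps V \<sigma>" if "card \<sigma> = p" "F \<sigma> a \<noteq> 0" for \<sigma> a
    using cech_fnsD[OF Ffns that(1)] that(2) finite_fns_supp by blast
  define F2 where "F2 \<sigma> a = (if pos_part a \<in> V then F \<sigma> a else 0)" for \<sigma> a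
  define H where "H \<sigma> a = (if i a \<in> \<sigma> then 0
    else cech_sign (i a) (insert (i a) \<sigma>) * F2 (insert (i a) \<sigma>) a)" for \<sigma> a
  have dH: "F2 \<tau> a = cech_d V H \<tau> a" if \<tau>: "card \<tau> = p" for \<tau> a
  proof (cases "pos_part a \<in> V \<and> a \<in> loc_exps V \<tau>")
    case True
    show ?thesis
    proof (cases "i a \<in> \<tau>")
      case in_\<tau>: True
      have "cech_sign j \<tau> * H (\<tau> - {j}) a = (if j = i a then F2 \<tau> a else 0)" if "j \<in> \<tau>" for j
        using in_\<tau> by (auto simp: H_def insert_absorb cech_sign_square)
      then have "cech_d V H \<tau> a = (\<Sum>j\<in>\<tau>. if j = i a then F2 \<tau> a else 0)"
        using True by (simp add: cech_d_def)
      then show ?thesis using in_\<tau> by simp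
    next
      case False
      have "cech_d V H \<tau> a
          = (\<Sum>j\<in>\<tau>. cech_sign j \<tau> * (cech_sign (i a) (insert (i a) (\<tau> - {j})) * F (insert (i a) (\<tau> - {j})) a))"
        using True False by (simp add: cech_d_def H_def F2_def)
      also have "\<dots> = F \<tau> a" using True by (intro cocycle_contraction[OF F \<tau> False]) simp
      finally show ?thesis using True by (simp add: F2_def)
    qed
  next
    case False
    then have "F2 \<tau> a = 0" using supp[OF \<tau>] by (auto simp: F2_def)
    moreover have "cech_d V H \<tau> a = 0"
    proof (cases "pos_part a \<in> V")
      case False
      then have "H \<sigma> a = 0" for \<sigma> by (simp add: H_def F2_def)
      then show ?thesis by (simp add: cech_d_def)
    qed (use False in \<open>simp add: cech_d_def\<close>)
    ultimately show ?thesis by simp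
  qed
  have "coboundary V p F2"
  proof (cases p)
    case 0
    have "F2 \<sigma> = (\<lambda>a. 0)" if "card \<sigma> = 0" for \<sigma>
    proof
      fix a
      have "\<sigma> = {}" using that by simp
      then show "F2 \<sigma> a = 0" using dH[of \<sigma> a] that 0 by (simp add: cech_d_def)
    qed
    then show ?thesis using 0 by (simp add: coboundary_def)
  next
    case (Suc q)
    have "H \<in> cech_fns V q"
    proof (intro cech_fnsI finite_fnsI)
      fix \<sigma> :: "'v set" assume \<sigma>: "card \<sigma> = q"
      have H: "i a \<notin> \<sigma> \<and> pos_part a \<in> V \<and> F (insert (i a) \<sigma>) a \<noteq> 0" if "H \<sigma> a \<noteq> 0" for a
        using that by (auto simp: H_def F2_def split: if_splits)
      have card: "card (insert v \<sigma>) = p" if "v \<notin> \<sigma>" for v using that \<sigma> Suc by simp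
      have "{a. H \<sigma> a \<noteq> 0} \<subseteq> (\<Union>v\<in>- \<sigma>. {a. F (insert v \<sigma>) a \<noteq> 0})" using H by blast
      moreover have "finite (\<Union>v\<in>- \<sigma>. {a. F (insert v \<sigma>) a \<noteq> 0})"
        using finite_fns_finite[OF cech_fnsD[OF Ffns card]] by auto
      ultimately show "finite {a. H \<sigma> a \<noteq> 0}" by (rule finite_subset)
      show "a \<in> loc_exps V \<sigma>" if "H \<sigma> a \<noteq> 0" for a
      proof -
        have a: "i a \<notin> \<sigma>" "pos_part a \<in> V" "F (insert (i a) \<sigma>) a \<noteq> 0" using H[OF that] by auto
        have "a \<in> loc_exps V (insert (i a) \<sigma>)" by (rule supp[OF card[OF a(1)] a(3)])
        then have "0 \<le> a v" if "v \<notin> insert (i a) \<sigma>" for v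
          using that by (rule localized_upset_nonneg[OF upset_V])
        then have "0 \<le> a v" if "v \<notin> \<sigma>" for v using that i[OF a(2)] by (cases "v = i a") auto
        then have "pos_part a - a \<in> vecs_on \<sigma>" by (rule neg_part_on)
        moreover have "a + (pos_part a - a) \<in> V" using a(2) by simp
        ultimately show ?thesis unfolding localized_upset_iff[OF upset_V] by blast
      qed
    qed
    then show ?thesis using dH Suc unfolding coboundary_def by (auto simp: fun_eq_iff)
  qed
  then show ?thesis unfolding F2_def .
qed

text \<open>The remaining part of a cocycle of \<open>J\<close> is a cocycle of \<open>I\<close>, since saturation identifies the
  two complexes in these degrees.\<close>

lemma cocycle_outside:
  fixes F :: "('v, 'k::field) laurent_cochain"
  assumes F: "cocycle V p F"
  shows "cocycle U p (\<lambda>\<sigma> a. if pos_part a \<in> V then 0 else F \<sigma> a)"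
proof -
  let ?F = "\<lambda>\<sigma> a. if pos_part a \<in> V then 0 else F \<sigma> a"
  have Ffns: "F \<in> cech_fns V p" using F by (simp add: cocycle_def)
  have "?F \<in> cech_fns U p"
  proof (intro cech_fnsI finite_fnsI)
    fix \<sigma> :: "'v set" assume \<sigma>: "card \<sigma> = p"
    have "{a. ?F \<sigma> a \<noteq> 0} \<subseteq> {a. F \<sigma> a \<noteq> 0}" by auto
    then show "finite {a. ?F \<sigma> a \<noteq> 0}"
      using finite_fns_finite[OF cech_fnsD[OF Ffns \<sigma>]] by (rule finite_subset)
    fix a assume "?F \<sigma> a \<noteq> 0"
    then have "pos_part a \<notin> V" "F \<sigma> a \<noteq> 0" by (auto split: if_splits)
    then show "a \<in> loc_exps U \<sigma>"
      using finite_fns_supp[OF cech_fnsD[OF Ffns \<sigma>]] localized_upset_eq by blast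
  qed
  moreover have "cech_d U ?F \<tau> a = 0" if \<tau>: "card \<tau> = Suc p" for \<tau> a
  proof (cases "pos_part a \<notin> V \<and> a \<in> loc_exps U \<tau>")
    case True
    have "cech_d V F \<tau> a = 0" using F \<tau> by (simp add: cocycle_def)
    moreover have "a \<in> loc_exps V \<tau>"
      using True localized_upset_subset[OF upset_U upset_V subset] by blast
    ultimately show ?thesis using True by (simp add: cech_d_def)
  next
    case False
    then show ?thesis by (auto simp: cech_d_def)
  qed
  ultimately show ?thesis by (auto simp: cocycle_def fun_eq_iff)
qed

text \<open>The inclusion of complexes induced by \<open>I \<subseteq> J\<close> does not change Laurent coordinates.\<close>

lemma coboundary_extend:
  assumes "coboundary U p F"
  shows "coboundary V p F"
proof (cases p)
  case 0
  then show ?thesis using assms by (simp add: coboundary_def)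
next
  case (Suc q)
  note sub = localized_upset_subset[OF upset_U upset_V subset]
  obtain H where H: "H \<in> cech_fns U q" "\<And>\<sigma>. card \<sigma> = p \<Longrightarrow> F \<sigma> = cech_d U H \<sigma>"
    using assms Suc by (auto simp: coboundary_def)
  have "H \<in> cech_fns V q"
  proof (intro cech_fnsI finite_fnsI)
    fix \<sigma> :: "'v set" assume \<sigma>: "card \<sigma> = q"
    show "finite {a. H \<sigma> a \<noteq> 0}" using finite_fns_finite[OF cech_fnsD[OF H(1) \<sigma>]] .
    show "a \<in> loc_exps V \<sigma>" if "H \<sigma> a \<noteq> 0" for a
      using finite_fns_supp[OF cech_fnsD[OF H(1) \<sigma>] that] sub by blast
  qed
  moreover have "F \<sigma> = cech_d V H \<sigma>" if \<sigma>: "card \<sigma> = p" for \<sigma>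
  proof -
    have "cech_d U H \<sigma> a = cech_d V H \<sigma> a" for a
    proof (cases "a \<in> loc_exps V \<sigma> \<and> a \<notin> loc_exps U \<sigma>")
      case True
      have "H (\<sigma> - {j}) a = 0" if j: "j \<in> \<sigma>" for j
      proof (rule ccontr)
        assume "H (\<sigma> - {j}) a \<noteq> 0"
        moreover have "card (\<sigma> - {j}) = q" using \<sigma> Suc j by (intro card_Diff_Suc) auto
        ultimately have "a \<in> loc_exps U (\<sigma> - {j})"
          using finite_fns_supp[OF cech_fnsD[OF H(1)]] by blast
        then show False using True localized_upset_mono[OF upset_U _ Diff_subset] by blast
      qed
      then show ?thesis by (simp add: cech_d_def)
    next
      case False
      then show ?thesis using sub by (auto simp: cech_d_def)
    qed
    then show ?thesis using H(2)[OF \<sigma>] by auto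
  qed
  ultimately show ?thesis using Suc by (auto simp: coboundary_def)
qed

text \<open>A nonzero homogeneous class of \<open>J\<close> is represented by its part outside \<open>V\<close>, which is a cocycle of
  \<open>I\<close> of the same degree; if it were a coboundary in \<open>I\<close>, it would be one in \<open>J\<close>.\<close>

theorem ideal_regularity_le:
  assumes "0 \<notin> V"
  shows "ideal_regularity (mono_ideal V :: ('v, 'k::field) mpoly set)
    \<le> ideal_regularity (mono_ideal U :: ('v, 'k) mpoly set)"
proof -
  let ?I = "mono_ideal U :: ('v, 'k) mpoly set" and ?J = "mono_ideal V :: ('v, 'k) mpoly set"
  interpret I: monomial_module "ideal_module ?I" U poly_coeff by (rule ideal_monomial_module[OF upset_U])
  interpret J: monomial_module "ideal_module ?J" V poly_coeff by (rule ideal_monomial_module[OF upset_V])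
  have "local_cohomology_degree (ideal_module ?I) (\<lambda>d. ?I \<inter> homogeneous_polys d) p d
      \<noteq> {\<zero>\<^bsub>local_cohomology (ideal_module ?I) p\<^esub>}"
    if nonzero: "local_cohomology_degree (ideal_module ?J) (\<lambda>d. ?J \<inter> homogeneous_polys d) p d
      \<noteq> {\<zero>\<^bsub>local_cohomology (ideal_module ?J) p\<^esub>}" for p d
  proof -
    obtain F :: "('v, 'k) laurent_cochain" where F: "cocycle V p F" "homogeneous_cochain p d F" "\<not> coboundary V p F"
      using nonzero J.local_cohomology_degree_nonzero_iff[OF homogeneous_mono_ideal] by blast
    let ?F1 = "\<lambda>\<sigma> a. if pos_part a \<in> V then 0 else F \<sigma> a"
    let ?F2 = "\<lambda>\<sigma> a. if pos_part a \<in> V then F \<sigma> a else 0"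
    have "\<not> coboundary V p ?F1"
    proof
      assume "coboundary V p ?F1"
      then have "coboundary V p (\<lambda>\<sigma> a. ?F1 \<sigma> a + ?F2 \<sigma> a)"
        using cocycle_inside_coboundary[OF F(1) assms] by (rule coboundary_add)
      then have "coboundary V p F" by (rule coboundary_cong) auto
      then show False using F(3) by blast
    qed
    then have "\<not> coboundary U p ?F1" using coboundary_extend by blast
    moreover have "cocycle U p ?F1" using F(1) by (rule cocycle_outside)
    moreover have "homogeneous_cochain p d ?F1" using F(2) by (simp add: homogeneous_cochain_def)
    ultimately show ?thesis
      using I.local_cohomology_degree_nonzero_iff[OF homogeneous_mono_ideal] by blast
  qed
  then show ?thesis
    unfolding ideal_regularity_def regularity_def by (intro SUP_subset_mono) auto
qed

end

section \<open>Symbolic and ordinary powers of edge ideals\<close>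

theorem theorem1p3:
  fixes E :: "'v::{finite,linorder} set set"
    and I :: "('v, 'k::field) mpoly set"
    and t :: nat
  assumes "simple_graph E"
    and "odd_girth E = enat (2 * t - 1)"
    and "I = edge_ideal E"
  shows "(\<forall>k i. 1 \<le> k \<and> k \<le> t \<longrightarrow>
            local_cohomology_map (quot_proj (symbolic_power I k))
                (quot_module poly_module (symbolic_power I k)) i
              ` carrier (local_cohomology (quot_module poly_module (ideal_power I k)) i)
            = carrier (local_cohomology (quot_module poly_module (symbolic_power I k)) i))
       \<and> (\<forall>k. 1 \<le> k \<and> k \<le> t \<longrightarrow>
            ideal_regularity (symbolic_power I k) \<le> ideal_regularity (ideal_power I k))"
proof -
  have power: "ideal_power I k = mono_ideal (upset_power (edge_exps E) k)" for k
    unfolding assms(3) edge_ideal_eq by (rule mono_ideal_power[OF edge_exps_upset])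
  have symbolic: "symbolic_power I k = mono_ideal (sym_exps E k)" for k
    unfolding assms(3) by (rule symbolic_power_edge_ideal)
  have pair: "saturated_pair (upset_power (edge_exps E) k) (sym_exps E k)" if k: "1 \<le> k" "k \<le> t" for k
  proof
    show "upset (upset_power (edge_exps E) k)" by (rule upset_power_upset[OF edge_exps_upset])
    show "upset (sym_exps E k)" by (rule sym_exps_upset)
    show "upset_power (edge_exps E) k \<subseteq> sym_exps E k" by (rule edge_power_subset_sym_exps)
    have "enat (2 * t - 1) \<le> odd_girth E" using assms(2) by simp
    then show "a + b + b \<in> upset_power (edge_exps E) k"
      if "0 \<le> a" "a \<notin> sym_exps E k" "0 \<le> b" "a + b \<in> sym_exps E k" for a b
      using sym_exps_saturation[OF assms(1) _ k that] by blast
  qed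
  have "0 \<notin> sym_exps E k" if "1 \<le> k" for k
  proof
    assume "0 \<in> sym_exps E k"
    moreover have "vertex_cover E UNIV" by (simp add: vertex_cover_def)
    ultimately have "int k \<le> sum (0 :: 'v \<Rightarrow> int) UNIV" unfolding sym_exps_def by blast
    then show False using that by simp
  qed
  then show ?thesis
    unfolding power symbolic
    using saturated_pair.local_cohomology_map_surjective[OF pair]
      saturated_pair.ideal_regularity_le[OF pair] by blast
qed

end
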